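(* For a Banach algebra $A$ the following conditions are equivalent. (i) $A$ is tensor radical, i.e. $A\widehat{\otimes}B$ is a Jacobson radical algebra for every Banach algebra $B$. (ii) $A$ is $1$-quasinilpotent. (iii) $A\widehat{\otimes}B$ is $1$-quasinilpotent, for any Banach algebra $B$.
   Context: All algebras are complex and associative. $A\widehat{\otimes}B$ is the projective tensor product of Banach algebras, a Banach algebra with $(a\otimes b)(c\otimes d)=ac\otimes bd$. An algebra is Jacobson radical if it equals its Jacobson radical. A generalized subset $M$ of a normed algebra $A$ is a family $(a_\alpha)_{\alpha\in\Lambda}$ of elements of $A$ considered up to reindexing (i.e. elements are counted with multiplicity). For $M=(a_\alpha)_{\alpha\in\Lambda}$ and $N=(b_\beta)_{\beta\in\Omega}$, the product is $MN=(a_\alpha b_\beta)_{(\alpha,\beta)\in\Lambda\times\Omega}$, and $M^n=M\cdots M$ ($n$ times). Put $\|M\|_1=\sum_{\alpha\in\Lambda}\|a_\alpha\|$; $M$ is summable if $\|M\|_1<\infty$, and then $\rho_1(M)=\lim_n(\|M^n\|_1)^{1/n}=\inf_n(\|M^n\|_1)^{1/n}$. An ordinary subset of $A$ is regarded as a generalized subset in which each of its elements occurs exactly once; its powers are computed as for generalized subsets (with multiplicities). A normed algebra $A$ is $1$-quasinilpotent if $\rho_1(M)=0$ for every summable subset $M$ of $A$. *)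

theory Defs
  imports
    "HOL-Algebra.Module"
    "HOL-Analysis.Analysis"
    "HOL-Library.Poly_Mapping"
    "HOL-Library.Equipollence"
begin

section \<open>Complex normed algebras\<close>

text \<open>
  Algebras are not assumed to be unital, and they live on carrier sets, so that one can quantify
  over all Banach algebras inside a formula. The record of modules is extended by a norm.
  The field \<open>one\<close>, which it inherits from the record of monoids, plays no role.
\<close>

record 'a normed_alg = "(complex, 'a) module" +
  nrm :: "'a \<Rightarrow> real"

definition complex_ring :: "complex ring" where
  "complex_ring =
     \<lparr>carrier = UNIV, monoid.mult = (*), one = 1, ring.zero = 0, add = (+)\<rparr>"

locale complex_algebra = Module.module complex_ring A for A (structure) +
  assumes mult_closed: "\<lbrakk>x \<in> carrier A; y \<in> carrier A\<rbrakk> \<Longrightarrow> x \<otimes> y \<in> carrier A"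
    and mult_assoc: "\<lbrakk>x \<in> carrier A; y \<in> carrier A; z \<in> carrier A\<rbrakk> \<Longrightarrow>
      (x \<otimes> y) \<otimes> z = x \<otimes> (y \<otimes> z)"
    and distr_left: "\<lbrakk>x \<in> carrier A; y \<in> carrier A; z \<in> carrier A\<rbrakk> \<Longrightarrow>
      (x \<oplus> y) \<otimes> z = x \<otimes> z \<oplus> y \<otimes> z"
    and distr_right: "\<lbrakk>x \<in> carrier A; y \<in> carrier A; z \<in> carrier A\<rbrakk> \<Longrightarrow>
      z \<otimes> (x \<oplus> y) = z \<otimes> x \<oplus> z \<otimes> y"
    and smult_mult_left: "\<lbrakk>x \<in> carrier A; y \<in> carrier A\<rbrakk> \<Longrightarrow>
      (c \<odot> x) \<otimes> y = c \<odot> (x \<otimes> y)"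
    and smult_mult_right: "\<lbrakk>x \<in> carrier A; y \<in> carrier A\<rbrakk> \<Longrightarrow>
      x \<otimes> (c \<odot> y) = c \<odot> (x \<otimes> y)"

locale normed_algebra = complex_algebra A for A :: "('a, 'm) normed_alg_scheme" (structure) +
  assumes nrm_nonneg: "x \<in> carrier A \<Longrightarrow> 0 \<le> nrm A x"
    and nrm_eq_0_iff: "x \<in> carrier A \<Longrightarrow> nrm A x = 0 \<longleftrightarrow> x = \<zero>"
    and nrm_triangle: "\<lbrakk>x \<in> carrier A; y \<in> carrier A\<rbrakk> \<Longrightarrow>
      nrm A (x \<oplus> y) \<le> nrm A x + nrm A y"
    and nrm_smult: "x \<in> carrier A \<Longrightarrow> nrm A (c \<odot> x) = cmod c * nrm A x"
    and nrm_mult: "\<lbrakk>x \<in> carrier A; y \<in> carrier A\<rbrakk> \<Longrightarrow>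
      nrm A (x \<otimes> y) \<le> nrm A x * nrm A y"

locale banach_algebra = normed_algebra A for A :: "('a, 'm) normed_alg_scheme" (structure) +
  assumes complete: "Metric_space.mcomplete (carrier A) (\<lambda>x y. nrm A (x \<ominus> y))"


section \<open>The Jacobson radical\<close>

definition left_ideal :: "'a set \<Rightarrow> ('a, 'm) normed_alg_scheme \<Rightarrow> bool" where
  "left_ideal L A \<longleftrightarrow> submodule L complex_ring A \<and>
     (\<forall>a\<in>carrier A. \<forall>x\<in>L. a \<otimes>\<^bsub>A\<^esub> x \<in> L)"

text \<open>A left ideal is modular if the algebra has a right unit modulo it.\<close>

definition modular_left_ideal :: "'a set \<Rightarrow> ('a, 'm) normed_alg_scheme \<Rightarrow> bool" where
  "modular_left_ideal L A \<longleftrightarrow> left_ideal L A \<and>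
     (\<exists>e\<in>carrier A. \<forall>a\<in>carrier A. a \<ominus>\<^bsub>A\<^esub> a \<otimes>\<^bsub>A\<^esub> e \<in> L)"

definition maximal_modular_left_ideal :: "'a set \<Rightarrow> ('a, 'm) normed_alg_scheme \<Rightarrow> bool" where
  "maximal_modular_left_ideal L A \<longleftrightarrow> modular_left_ideal L A \<and> L \<noteq> carrier A \<and>
     (\<forall>J. left_ideal J A \<and> L \<subseteq> J \<longrightarrow> J = L \<or> J = carrier A)"

text \<open>The whole algebra is the radical if there are no maximal modular left ideals.\<close>

definition jacobson_radical :: "('a, 'm) normed_alg_scheme \<Rightarrow> 'a set" where
  "jacobson_radical A = carrier A \<inter> \<Inter>{L. maximal_modular_left_ideal L A}"

definition jacobson_radical_algebra :: "('a, 'm) normed_alg_scheme \<Rightarrow> bool" where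
  "jacobson_radical_algebra A \<longleftrightarrow> jacobson_radical A = carrier A"


section \<open>Completion\<close>

definition cauchy_seqs :: "('a, 'm) normed_alg_scheme \<Rightarrow> (nat \<Rightarrow> 'a) set" where
  "cauchy_seqs A = {X. (\<forall>n. X n \<in> carrier A) \<and>
     (\<forall>\<epsilon>>0. \<exists>N. \<forall>m\<ge>N. \<forall>n\<ge>N. nrm A (X m \<ominus>\<^bsub>A\<^esub> X n) < \<epsilon>)}"

definition same_limit :: "('a, 'm) normed_alg_scheme \<Rightarrow> ((nat \<Rightarrow> 'a) \<times> (nat \<Rightarrow> 'a)) set" where
  "same_limit A = {(X, Y). X \<in> cauchy_seqs A \<and> Y \<in> cauchy_seqs A \<and>
     (\<lambda>n. nrm A (X n \<ominus>\<^bsub>A\<^esub> Y n)) \<longlonglongrightarrow> 0}"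

definition normed_completion :: "('a, 'm) normed_alg_scheme \<Rightarrow> (nat \<Rightarrow> 'a) set normed_alg" where
  "normed_completion A =
     \<lparr>carrier = cauchy_seqs A // same_limit A,
      monoid.mult = (\<lambda>U V. \<Union>X\<in>U. \<Union>Y\<in>V. same_limit A `` {\<lambda>n. X n \<otimes>\<^bsub>A\<^esub> Y n}),
      one = undefined,
      ring.zero = same_limit A `` {\<lambda>n. \<zero>\<^bsub>A\<^esub>},
      add = (\<lambda>U V. \<Union>X\<in>U. \<Union>Y\<in>V. same_limit A `` {\<lambda>n. X n \<oplus>\<^bsub>A\<^esub> Y n}),
      module.smult = (\<lambda>c U. \<Union>X\<in>U. same_limit A `` {\<lambda>n. c \<odot>\<^bsub>A\<^esub> X n}),
      nrm = (\<lambda>U. THE r. \<forall>X\<in>U. (\<lambda>n. nrm A (X n)) \<longlonglongrightarrow> r)\<rparr>"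


section \<open>The projective tensor product\<close>

text \<open>
  The algebraic tensor product of \<open>A\<close> and \<open>B\<close> is the quotient of the free vector space on
  \<open>carrier A \<times> carrier B\<close> by the span of the bilinearity relations.
\<close>

definition scale_free :: "complex \<Rightarrow> ('k \<Rightarrow>\<^sub>0 complex) \<Rightarrow> ('k \<Rightarrow>\<^sub>0 complex)" where
  "scale_free c f = Poly_Mapping.map (\<lambda>z. c * z) f"

global_interpretation free_vs: Vector_Spaces.vector_space "scale_free :: complex \<Rightarrow> ('k \<Rightarrow>\<^sub>0 complex) \<Rightarrow> _"
  defines free_span = free_vs.span
proof
  have lookup: "Poly_Mapping.lookup (scale_free c f) k = c * Poly_Mapping.lookup f k"
    for c and f :: "'k \<Rightarrow>\<^sub>0 complex" and k
    by (simp add: scale_free_def Poly_Mapping.map.rep_eq when_def)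
  fix a b :: complex and x y :: "'k \<Rightarrow>\<^sub>0 complex"
  show "scale_free a (x + y) = scale_free a x + scale_free a y"
    "scale_free (a + b) x = scale_free a x + scale_free b x"
    "scale_free a (scale_free b x) = scale_free (a * b) x"
    "scale_free 1 x = x"
    by (auto intro!: poly_mapping_eqI simp: lookup Poly_Mapping.lookup_add algebra_simps)
qed

abbreviation basis_vec :: "'a \<Rightarrow> 'b \<Rightarrow> ('a \<times> 'b \<Rightarrow>\<^sub>0 complex)" where
  "basis_vec a b \<equiv> Poly_Mapping.single (a, b) 1"

definition free_space ::
  "('a, 'm) normed_alg_scheme \<Rightarrow> ('b, 'n) normed_alg_scheme \<Rightarrow> ('a \<times> 'b \<Rightarrow>\<^sub>0 complex) set" where
  "free_space A B = {f. Poly_Mapping.keys f \<subseteq> carrier A \<times> carrier B}"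

definition bilinear_relations ::
  "('a, 'm) normed_alg_scheme \<Rightarrow> ('b, 'n) normed_alg_scheme \<Rightarrow> ('a \<times> 'b \<Rightarrow>\<^sub>0 complex) set" where
  "bilinear_relations A B = free_span (
     {basis_vec (a \<oplus>\<^bsub>A\<^esub> a') b - basis_vec a b - basis_vec a' b | a a' b.
        a \<in> carrier A \<and> a' \<in> carrier A \<and> b \<in> carrier B} \<union>
     {basis_vec a (b \<oplus>\<^bsub>B\<^esub> b') - basis_vec a b - basis_vec a b' | a b b'.
        a \<in> carrier A \<and> b \<in> carrier B \<and> b' \<in> carrier B} \<union>
     {basis_vec (c \<odot>\<^bsub>A\<^esub> a) b - scale_free c (basis_vec a b) | c a b.
        a \<in> carrier A \<and> b \<in> carrier B} \<union>
     {basis_vec a (c \<odot>\<^bsub>B\<^esub> b) - scale_free c (basis_vec a b) | c a b.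
        a \<in> carrier A \<and> b \<in> carrier B})"

definition tensor_rel ::
  "('a, 'm) normed_alg_scheme \<Rightarrow> ('b, 'n) normed_alg_scheme \<Rightarrow>
     (('a \<times> 'b \<Rightarrow>\<^sub>0 complex) \<times> ('a \<times> 'b \<Rightarrow>\<^sub>0 complex)) set" where
  "tensor_rel A B = {(f, g). f \<in> free_space A B \<and> g \<in> free_space A B \<and>
     f - g \<in> bilinear_relations A B}"

text \<open>The bilinear extension of \<open>(a \<otimes> b)(c \<otimes> d) = ac \<otimes> bd\<close> to the free vector space.\<close>

definition free_mult ::
  "('a, 'm) normed_alg_scheme \<Rightarrow> ('b, 'n) normed_alg_scheme \<Rightarrow>
     ('a \<times> 'b \<Rightarrow>\<^sub>0 complex) \<Rightarrow> ('a \<times> 'b \<Rightarrow>\<^sub>0 complex) \<Rightarrow> ('a \<times> 'b \<Rightarrow>\<^sub>0 complex)" where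
  "free_mult A B f g =
     (\<Sum>(a, b)\<in>Poly_Mapping.keys f. \<Sum>(c, d)\<in>Poly_Mapping.keys g.
        scale_free (Poly_Mapping.lookup f (a, b) * Poly_Mapping.lookup g (c, d))
          (basis_vec (a \<otimes>\<^bsub>A\<^esub> c) (b \<otimes>\<^bsub>B\<^esub> d)))"

definition projective_norm ::
  "('a, 'm) normed_alg_scheme \<Rightarrow> ('b, 'n) normed_alg_scheme \<Rightarrow>
     ('a \<times> 'b \<Rightarrow>\<^sub>0 complex) set \<Rightarrow> real" where
  "projective_norm A B U =
     Inf {(\<Sum>(a, b)\<leftarrow>ts. nrm A a * nrm B b) | ts.
       set ts \<subseteq> carrier A \<times> carrier B \<and> U = tensor_rel A B `` {\<Sum>(a, b)\<leftarrow>ts. basis_vec a b}}"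

definition algebraic_tensor ::
  "('a, 'm) normed_alg_scheme \<Rightarrow> ('b, 'n) normed_alg_scheme \<Rightarrow>
     ('a \<times> 'b \<Rightarrow>\<^sub>0 complex) set normed_alg" where
  "algebraic_tensor A B =
     \<lparr>carrier = free_space A B // tensor_rel A B,
      monoid.mult = (\<lambda>U V. \<Union>f\<in>U. \<Union>g\<in>V. tensor_rel A B `` {free_mult A B f g}),
      one = undefined,
      ring.zero = tensor_rel A B `` {0},
      add = (\<lambda>U V. \<Union>f\<in>U. \<Union>g\<in>V. tensor_rel A B `` {f + g}),
      module.smult = (\<lambda>c U. \<Union>f\<in>U. tensor_rel A B `` {scale_free c f}),
      nrm = projective_norm A B\<rparr>"

definition projective_tensor (infixl \<open>\<otimes>\<^sub>\<pi>\<close> 70) where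
  "A \<otimes>\<^sub>\<pi> B = normed_completion (algebraic_tensor A B)"

text \<open>
  A HOL formula cannot quantify over types. The Banach algebras \<open>B\<close> therefore range over those
  whose carrier is a subset of a type \<open>'b\<close>. This type acts as a universe: it remains a free type
  variable in theorems, which may only assume that it has at least the cardinality of the
  continuum, i.e. that it is large enough for the carrier of some nonzero Banach algebra.
\<close>

definition tensor_radical :: "'b itself \<Rightarrow> ('a, 'm) normed_alg_scheme \<Rightarrow> bool" where
  "tensor_radical (_ :: 'b itself) A \<longleftrightarrow>
     (\<forall>B :: 'b normed_alg. banach_algebra B \<longrightarrow> jacobson_radical_algebra (A \<otimes>\<^sub>\<pi> B))"


section \<open>Generalized subsets\<close>

text \<open>A generalized subset is given by an index set and a family of elements.\<close>

type_synonym ('i, 'a) gen_subset = "'i set \<times> ('i \<Rightarrow> 'a)"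

definition gen_mult ::
  "('a, 'm) normed_alg_scheme \<Rightarrow> ('i, 'a) gen_subset \<Rightarrow> ('j, 'a) gen_subset \<Rightarrow>
     ('i \<times> 'j, 'a) gen_subset" where
  "gen_mult A M N = (fst M \<times> fst N, \<lambda>(\<alpha>, \<beta>). snd M \<alpha> \<otimes>\<^bsub>A\<^esub> snd N \<beta>)"

text \<open>The product of a nonempty list; the value at the empty list is immaterial.\<close>

fun word_prod :: "('a, 'm) normed_alg_scheme \<Rightarrow> 'a list \<Rightarrow> 'a" where
  "word_prod A [] = \<zero>\<^bsub>A\<^esub>"
| "word_prod A [x] = x"
| "word_prod A (x # y # xs) = x \<otimes>\<^bsub>A\<^esub> word_prod A (y # xs)"

text \<open>
  The type of an index of \<open>M \<cdots> M\<close> would depend on the number \<open>n\<close> of factors, so the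
  \<open>n\<close>th power (for \<open>n \<ge> 1\<close>) is indexed by the lists of length \<open>n\<close> over the index set of \<open>M\<close>.
  The next two lemmas show that this is the iterated product up to reindexing.
\<close>

definition gen_power ::
  "('a, 'm) normed_alg_scheme \<Rightarrow> ('i, 'a) gen_subset \<Rightarrow> nat \<Rightarrow> ('i list, 'a) gen_subset" where
  "gen_power A M n =
     ({w. length w = n \<and> set w \<subseteq> fst M}, \<lambda>w. word_prod A (map (snd M) w))"

lemma gen_power_1:
  "bij_betw (\<lambda>\<alpha>. [\<alpha>]) (fst M) (fst (gen_power A M 1))"
  "snd (gen_power A M 1) [\<alpha>] = snd M \<alpha>"
  by (auto simp: gen_power_def bij_betw_def inj_on_def length_Suc_conv)

lemma gen_power_Suc:
  assumes "n \<ge> 1"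
  shows "bij_betw (\<lambda>(\<alpha>, w). \<alpha> # w) (fst (gen_mult A M (gen_power A M n)))
           (fst (gen_power A M (Suc n)))"
    and "p \<in> fst (gen_mult A M (gen_power A M n)) \<Longrightarrow>
         snd (gen_power A M (Suc n)) (case p of (\<alpha>, w) \<Rightarrow> \<alpha> # w) =
           snd (gen_mult A M (gen_power A M n)) p"
proof -
  show "bij_betw (\<lambda>(\<alpha>, w). \<alpha> # w) (fst (gen_mult A M (gen_power A M n)))
          (fst (gen_power A M (Suc n)))"
    by (force simp: gen_power_def gen_mult_def bij_betw_def inj_on_def length_Suc_conv image_iff)
next
  assume "p \<in> fst (gen_mult A M (gen_power A M n))"
  then show "snd (gen_power A M (Suc n)) (case p of (\<alpha>, w) \<Rightarrow> \<alpha> # w) =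
      snd (gen_mult A M (gen_power A M n)) p"
    using assms by (cases "snd p") (auto simp: gen_power_def gen_mult_def)
qed

definition summable_gen ::
  "('a, 'm) normed_alg_scheme \<Rightarrow> ('i, 'a) gen_subset \<Rightarrow> bool" where
  "summable_gen A M \<longleftrightarrow> (\<lambda>\<alpha>. nrm A (snd M \<alpha>)) summable_on fst M"

definition norm1 :: "('a, 'm) normed_alg_scheme \<Rightarrow> ('i, 'a) gen_subset \<Rightarrow> real" where
  "norm1 A M = (\<Sum>\<^sub>\<infinity>\<alpha>\<in>fst M. nrm A (snd M \<alpha>))"

definition rho1 :: "('a, 'm) normed_alg_scheme \<Rightarrow> ('i, 'a) gen_subset \<Rightarrow> real" where
  "rho1 A M = lim (\<lambda>n. root n (norm1 A (gen_power A M n)))"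

definition gen_of_set :: "'a set \<Rightarrow> ('a, 'a) gen_subset" where
  "gen_of_set S = (S, \<lambda>x. x)"

definition one_quasinilpotent :: "('a, 'm) normed_alg_scheme \<Rightarrow> bool" where
  "one_quasinilpotent A \<longleftrightarrow>
     (\<forall>S. S \<subseteq> carrier A \<and> summable_gen A (gen_of_set S) \<longrightarrow> rho1 A (gen_of_set S) = 0)"

end

theory Submission
  imports Defs
begin

text \<open>
  A 1-quasinilpotent algebra \<open>A\<close> makes every \<open>A \<otimes>\<^sub>\<pi> B\<close> 1-quasinilpotent, a 1-quasinilpotent Banach
  algebra is radical, and if \<open>A \<otimes>\<^sub>\<pi> B\<close> is radical for one well chosen \<open>B\<close>, then \<open>A\<close> is
  1-quasinilpotent. These three implications form a cycle.

  For the first implication (\<open>one_quasinilpotent_tensor\<close>), every \<open>u\<close> in \<open>A \<otimes>\<^sub>\<pi> B\<close> is a sum of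
  elementary tensors \<open>a\<^sub>j \<otimes> b\<^sub>j\<close> with \<open>\<Sum>\<^sub>j \<parallel>a\<^sub>j\<parallel> \<parallel>b\<^sub>j\<parallel> \<le> 2 \<parallel>u\<parallel>\<close> (\<open>tensor_decomposition\<close>). For a summable set
  \<open>S\<close> of such \<open>u\<close>, the elements \<open>\<parallel>b\<^sub>j\<parallel> a\<^sub>j\<close> of all these expansions form a summable family \<open>M\<close> in
  \<open>A\<close>. Multiplying out gives \<open>\<parallel>S\<^sup>n\<parallel>\<^sub>1 \<le> \<parallel>M\<^sup>n\<parallel>\<^sub>1\<close>, and so \<open>\<rho>\<^sub>1(S) \<le> \<rho>\<^sub>1(M)\<close>. The family may have
  repetitions, whereas 1-quasinilpotence is a statement about sets. Multiplying the members by
  suitable scalars makes them distinct (\<open>rho1_family_eq_0\<close>).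

  For the second implication (\<open>one_quasinilpotent_imp_jacobson_radical\<close>), the norms of the powers
  of an element \<open>T\<close> decay faster than any geometric sequence, so \<open>T + T\<^sup>2 + T\<^sup>3 + \<cdots>\<close> converges to a
  quasi-inverse of \<open>T\<close>. An algebra is radical if and only if all its elements have quasi-inverses
  (\<open>jacobson_radical_algebra_iff\<close>).

  For the third implication (\<open>jacobson_radical_imp_one_quasinilpotent\<close>), let \<open>B\<close> be the algebra
  \<open>\<ell>\<^sup>1\<close> of the free monoid in \<open>x\<^sub>0, x\<^sub>1, \<dots>\<close>, let \<open>a\<^sub>0, a\<^sub>1, \<dots>\<close> enumerate the nonzero elements of a
  summable set \<open>S\<close>, and let \<open>t > 0\<close>. A quasi-inverse \<open>c\<close> of \<open>T = \<Sum>\<^sub>i t a\<^sub>i \<otimes> x\<^sub>i\<close> satisfies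
  \<open>c = T + c T\<close>. Comparing coefficients shows that the coefficient of \<open>c\<close> at a word of length \<open>n\<close> is \<open>t\<^sup>n\<close> times the
  product of the \<open>a\<^sub>i\<close> along this word. The norm of \<open>c\<close> bounds the sum of the norms of the
  coefficients, hence \<open>t\<^sup>n \<parallel>S\<^sup>n\<parallel>\<^sub>1 \<le> \<parallel>c\<parallel>\<close> for all \<open>n \<ge> 1\<close>. Since \<open>t\<close> is arbitrary, \<open>\<rho>\<^sub>1(S) = 0\<close>.
  The algebra \<open>B\<close> has the cardinality of the continuum, so it has a copy whose carrier lies in the
  given type (\<open>free_generators_exist\<close>).
\<close>


section \<open>Complex algebras on carrier sets\<close>

lemma complex_ring_simps [simp]:
  "carrier complex_ring = UNIV" "x \<otimes>\<^bsub>complex_ring\<^esub> y = x * y"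
  "\<one>\<^bsub>complex_ring\<^esub> = 1" "\<zero>\<^bsub>complex_ring\<^esub> = 0" "x \<oplus>\<^bsub>complex_ring\<^esub> y = x + y"
  by (simp_all add: complex_ring_def)

lemma cring_complex_ring: "cring complex_ring"
proof (rule cringI)
  show "abelian_group complex_ring"
  proof (rule abelian_groupI)
    show "\<exists>y\<in>carrier complex_ring. y \<oplus>\<^bsub>complex_ring\<^esub> x = \<zero>\<^bsub>complex_ring\<^esub>" for x
      by (rule bexI[of _ "-x"]) auto
  qed auto
  show "comm_monoid complex_ring"
    by (rule comm_monoidI) auto
qed (auto simp: algebra_simps)

lemma complex_algebraI:
  fixes A (structure)
  assumes add_closed: "\<And>x y. \<lbrakk>x \<in> carrier A; y \<in> carrier A\<rbrakk> \<Longrightarrow> x \<oplus> y \<in> carrier A"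
    and zero_closed: "\<zero> \<in> carrier A"
    and smult_closed: "\<And>c x. x \<in> carrier A \<Longrightarrow> c \<odot> x \<in> carrier A"
    and mult_closed: "\<And>x y. \<lbrakk>x \<in> carrier A; y \<in> carrier A\<rbrakk> \<Longrightarrow> x \<otimes> y \<in> carrier A"
    and add_assoc: "\<And>x y z. \<lbrakk>x \<in> carrier A; y \<in> carrier A; z \<in> carrier A\<rbrakk> \<Longrightarrow>
        (x \<oplus> y) \<oplus> z = x \<oplus> (y \<oplus> z)"
    and add_comm: "\<And>x y. \<lbrakk>x \<in> carrier A; y \<in> carrier A\<rbrakk> \<Longrightarrow> x \<oplus> y = y \<oplus> x"
    and zero_add: "\<And>x. x \<in> carrier A \<Longrightarrow> \<zero> \<oplus> x = x"
    and smult_add_left: "\<And>c d x. x \<in> carrier A \<Longrightarrow> (c + d) \<odot> x = c \<odot> x \<oplus> d \<odot> x"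
    and smult_add_right: "\<And>c x y. \<lbrakk>x \<in> carrier A; y \<in> carrier A\<rbrakk> \<Longrightarrow>
        c \<odot> (x \<oplus> y) = c \<odot> x \<oplus> c \<odot> y"
    and smult_smult: "\<And>c d x. x \<in> carrier A \<Longrightarrow> (c * d) \<odot> x = c \<odot> (d \<odot> x)"
    and one_smult: "\<And>x. x \<in> carrier A \<Longrightarrow> 1 \<odot> x = x"
    and zero_smult: "\<And>x. x \<in> carrier A \<Longrightarrow> 0 \<odot> x = \<zero>"
    and mult_assoc: "\<And>x y z. \<lbrakk>x \<in> carrier A; y \<in> carrier A; z \<in> carrier A\<rbrakk> \<Longrightarrow>
      (x \<otimes> y) \<otimes> z = x \<otimes> (y \<otimes> z)"
    and distr_left: "\<And>x y z. \<lbrakk>x \<in> carrier A; y \<in> carrier A; z \<in> carrier A\<rbrakk> \<Longrightarrow>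
      (x \<oplus> y) \<otimes> z = x \<otimes> z \<oplus> y \<otimes> z"
    and distr_right: "\<And>x y z. \<lbrakk>x \<in> carrier A; y \<in> carrier A; z \<in> carrier A\<rbrakk> \<Longrightarrow>
      z \<otimes> (x \<oplus> y) = z \<otimes> x \<oplus> z \<otimes> y"
    and smult_mult_left: "\<And>c x y. \<lbrakk>x \<in> carrier A; y \<in> carrier A\<rbrakk> \<Longrightarrow>
      (c \<odot> x) \<otimes> y = c \<odot> (x \<otimes> y)"
    and smult_mult_right: "\<And>c x y. \<lbrakk>x \<in> carrier A; y \<in> carrier A\<rbrakk> \<Longrightarrow>
      x \<otimes> (c \<odot> y) = c \<odot> (x \<otimes> y)"
  shows "complex_algebra A"
proof (intro complex_algebra.intro complex_algebra_axioms.intro)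
  have neg: "\<exists>y\<in>carrier A. y \<oplus> x = \<zero>" if "x \<in> carrier A" for x
    using smult_add_left[of x "-1" 1] that
    by (intro bexI[of _ "(-1) \<odot> x"]) (simp_all add: one_smult zero_smult smult_closed)
  have "abelian_group A"
    by (intro abelian_groupI add_closed zero_closed add_assoc add_comm zero_add neg)
  then show "Module.module complex_ring A"
    by (intro moduleI cring_complex_ring) (simp_all add: assms)
qed (simp_all add: assms)

text \<open>All axioms except the closure properties are equations, so they pass to the image under a
  map that respects the operations. Quotients and transports of structure are obtained this way.\<close>

lemma complex_algebra_image:
  assumes "complex_algebra P"
    and carrier: "carrier Q = h ` carrier P"
    and zero: "h \<zero>\<^bsub>P\<^esub> = \<zero>\<^bsub>Q\<^esub>"
    and add: "\<And>x y. \<lbrakk>x \<in> carrier P; y \<in> carrier P\<rbrakk> \<Longrightarrow> h (x \<oplus>\<^bsub>P\<^esub> y) = h x \<oplus>\<^bsub>Q\<^esub> h y"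
    and mult: "\<And>x y. \<lbrakk>x \<in> carrier P; y \<in> carrier P\<rbrakk> \<Longrightarrow> h (x \<otimes>\<^bsub>P\<^esub> y) = h x \<otimes>\<^bsub>Q\<^esub> h y"
    and smult: "\<And>c x. x \<in> carrier P \<Longrightarrow> h (c \<odot>\<^bsub>P\<^esub> x) = c \<odot>\<^bsub>Q\<^esub> h x"
  shows "complex_algebra Q"
proof -
  interpret P: complex_algebra P by fact
  have P_smult: "c \<odot>\<^bsub>P\<^esub> x \<in> carrier P" if "x \<in> carrier P" for c x
    using P.smult_closed[of c x] that by simp
  note closed = P_smult P.mult_closed P.M.a_closed P.M.zero_closed
  note homs = add[symmetric] mult[symmetric] smult[symmetric] zero[symmetric]
  note laws = P.smult_l_distr P.smult_r_distr P.smult_assoc1 P.smult_one P.smult_l_null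
  show ?thesis
    by (rule complex_algebraI)
      (auto simp: carrier homs closed laws[simplified] P.M.a_assoc P.M.a_comm P.M.a_lcomm
        P.mult_assoc P.distr_left P.distr_right P.smult_mult_left P.smult_mult_right)
qed

context complex_algebra
begin

lemma smult_in [simp, intro]: "x \<in> carrier A \<Longrightarrow> c \<odot> x \<in> carrier A"
  using smult_closed[of c x] by simp

lemma mult_in [simp, intro]: "\<lbrakk>x \<in> carrier A; y \<in> carrier A\<rbrakk> \<Longrightarrow> x \<otimes> y \<in> carrier A"
  by (rule mult_closed)

lemma zero_smult [simp]: "x \<in> carrier A \<Longrightarrow> 0 \<odot> x = \<zero>"
  using smult_l_null[of x] by simp

lemma one_smult [simp]: "x \<in> carrier A \<Longrightarrow> 1 \<odot> x = x"
  using smult_one[of x] by simp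

lemma smult_zero [simp]: "c \<odot> \<zero> = \<zero>"
  using smult_r_null[of c] by simp

lemma smult_add_left: "x \<in> carrier A \<Longrightarrow> (c + d) \<odot> x = c \<odot> x \<oplus> d \<odot> x"
  using smult_l_distr[of c d x] by simp

lemma smult_add_right:
  "\<lbrakk>x \<in> carrier A; y \<in> carrier A\<rbrakk> \<Longrightarrow> c \<odot> (x \<oplus> y) = c \<odot> x \<oplus> c \<odot> y"
  using smult_r_distr[of c x y] by simp

lemma smult_smult: "x \<in> carrier A \<Longrightarrow> c \<odot> (d \<odot> x) = (c * d) \<odot> x"
  using smult_assoc1[of c d x] by simp

lemma minus_eq_smult: "x \<in> carrier A \<Longrightarrow> \<ominus> x = (- 1) \<odot> x"
  using smult_add_left[of x "-1" 1] by (simp add: M.minus_equality)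

lemma minus_in [simp, intro]: "\<lbrakk>x \<in> carrier A; y \<in> carrier A\<rbrakk> \<Longrightarrow> x \<ominus> y \<in> carrier A"
  by (rule M.minus_closed)

lemma zero_mult [simp]: "x \<in> carrier A \<Longrightarrow> \<zero> \<otimes> x = \<zero>"
  using smult_mult_left[of \<zero> x 0] by simp

lemma mult_zero [simp]: "x \<in> carrier A \<Longrightarrow> x \<otimes> \<zero> = \<zero>"
  using smult_mult_right[of x \<zero> 0] by simp

lemma diff_mult: "\<lbrakk>x \<in> carrier A; y \<in> carrier A; z \<in> carrier A\<rbrakk> \<Longrightarrow>
    (x \<ominus> y) \<otimes> z = x \<otimes> z \<ominus> y \<otimes> z"
  by (simp add: M.minus_eq minus_eq_smult distr_left smult_mult_left)

lemma mult_diff: "\<lbrakk>x \<in> carrier A; y \<in> carrier A; z \<in> carrier A\<rbrakk> \<Longrightarrow>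
    z \<otimes> (x \<ominus> y) = z \<otimes> x \<ominus> z \<otimes> y"
  by (simp add: M.minus_eq minus_eq_smult distr_right smult_mult_right)

lemma smult_diff: "\<lbrakk>x \<in> carrier A; y \<in> carrier A\<rbrakk> \<Longrightarrow>
    c \<odot> (x \<ominus> y) = c \<odot> x \<ominus> c \<odot> y"
  by (simp add: M.minus_eq minus_eq_smult smult_add_right smult_smult)

lemma diff_add_diff: "\<lbrakk>x \<in> carrier A; y \<in> carrier A; z \<in> carrier A\<rbrakk> \<Longrightarrow>
    (x \<ominus> y) \<oplus> (y \<ominus> z) = x \<ominus> z"
  by (simp add: M.minus_eq M.a_assoc) (metis M.a_assoc M.a_inv_closed M.l_neg M.l_zero)

lemma add_diff_add: "\<lbrakk>x \<in> carrier A; y \<in> carrier A; x' \<in> carrier A; y' \<in> carrier A\<rbrakk> \<Longrightarrow>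
    (x \<oplus> y) \<ominus> (x' \<oplus> y') = (x \<ominus> x') \<oplus> (y \<ominus> y')"
  by (simp add: M.minus_eq M.minus_add M.a_assoc M.a_lcomm)

lemma minus_diff: "\<lbrakk>x \<in> carrier A; y \<in> carrier A\<rbrakk> \<Longrightarrow> \<ominus> (x \<ominus> y) = y \<ominus> x"
  by (simp add: M.minus_eq M.minus_add M.a_comm)

lemma diff_add_cancel: "\<lbrakk>x \<in> carrier A; y \<in> carrier A\<rbrakk> \<Longrightarrow> (x \<ominus> y) \<oplus> y = x"
  by (simp add: M.minus_eq M.a_assoc M.l_neg)

lemma add_diff_cancel_left': "\<lbrakk>x \<in> carrier A; y \<in> carrier A\<rbrakk> \<Longrightarrow> (x \<oplus> y) \<ominus> x = y"
  by (metis M.minus_eq M.a_assoc M.a_comm M.a_inv_closed M.r_neg M.r_zero)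

lemma add_diff_cancel_right': "\<lbrakk>x \<in> carrier A; y \<in> carrier A\<rbrakk> \<Longrightarrow> (x \<oplus> y) \<ominus> y = x"
  using add_diff_cancel_left'[of y x] by (simp add: M.a_comm)

lemma diff_self [simp]: "x \<in> carrier A \<Longrightarrow> x \<ominus> x = \<zero>"
  by (simp add: M.minus_eq M.r_neg)

lemma diff_zero [simp]: "x \<in> carrier A \<Longrightarrow> x \<ominus> \<zero> = x"
  using add_diff_cancel_left'[of \<zero> x] by simp

end


section \<open>Radical algebras and quasi-inverses\<close>

context
  fixes A :: "('a, 'm) normed_alg_scheme" (structure)
  assumes complex_algebra: "complex_algebra A"
begin

interpretation complex_algebra A
  by (rule complex_algebra)

lemma left_ideal_iff:
  "left_ideal L A \<longleftrightarrow> L \<subseteq> carrier A \<and> \<zero> \<in> L \<and> (\<forall>x\<in>L. \<forall>y\<in>L. x \<oplus> y \<in> L) \<and>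
     (\<forall>c. \<forall>x\<in>L. c \<odot> x \<in> L) \<and> (\<forall>a\<in>carrier A. \<forall>x\<in>L. a \<otimes> x \<in> L)" (is "?l \<longleftrightarrow> ?r")
proof
  assume l: ?l
  then have sub: "submodule L complex_ring A" by (simp add: left_ideal_def)
  have "\<zero> \<in> L"
    using submoduleE(2,1,4)[OF sub] zero_smult by (metis UNIV_I all_not_in_conv
        complex_ring_simps(1) subsetD)
  with submoduleE[OF sub] l show ?r
    by (simp add: left_ideal_def)
next
  assume r: ?r
  then have "\<ominus> x \<in> L" if "x \<in> L" for x
    using that by (simp add: minus_eq_smult subset_iff)
  with r show ?l
    unfolding left_ideal_def by (intro conjI submoduleI) auto
qed

text \<open>If \<open>T\<close> has no left quasi-inverse, then \<open>T\<close> lies outside the modular left ideal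
  \<open>{a - aT}\<close>, and a left ideal that contains this one and is maximal among those without \<open>T\<close>
  is even a maximal left ideal, since together with \<open>T\<close> it yields every \<open>a = (a - aT) + aT\<close>.
  Conversely, a modular left ideal contains the left quasi-inverse of its modular unit \<open>e\<close>
  modulo \<open>L\<close>, hence \<open>e\<close> itself.\<close>

lemma jacobson_radical_algebra_iff:
  "jacobson_radical_algebra A \<longleftrightarrow> (\<forall>T\<in>carrier A. \<exists>c\<in>carrier A. c = T \<oplus> c \<otimes> T)"
proof
  assume J: "jacobson_radical_algebra A"
  have no_max: "\<not> maximal_modular_left_ideal L A" for L
  proof
    assume L: "maximal_modular_left_ideal L A"
    then have "carrier A \<subseteq> L"
      using J unfolding jacobson_radical_algebra_def jacobson_radical_def by blast
    with L show False
      unfolding maximal_modular_left_ideal_def modular_left_ideal_def left_ideal_iff by blast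
  qed
  show "\<forall>T\<in>carrier A. \<exists>c\<in>carrier A. c = T \<oplus> c \<otimes> T"
  proof
    fix T assume T: "T \<in> carrier A"
    define L where "L = (\<lambda>a. a \<ominus> a \<otimes> T) ` carrier A"
    have L: "left_ideal L A"
      unfolding left_ideal_iff
    proof (intro conjI ballI allI)
      show "L \<subseteq> carrier A" using T by (auto simp: L_def)
      show "\<zero> \<in> L" using T by (auto simp: L_def intro!: image_eqI[of _ _ "\<zero>"])
    next
      fix x y assume "x \<in> L" "y \<in> L"
      then obtain a b where "a \<in> carrier A" "b \<in> carrier A" "x = a \<ominus> a \<otimes> T" "y = b \<ominus> b \<otimes> T"
        by (auto simp: L_def)
      with T show "x \<oplus> y \<in> L"
        by (auto simp: L_def distr_left add_diff_add intro!: image_eqI[of _ _ "a \<oplus> b"])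
    next
      fix c x assume "x \<in> L"
      then obtain a where "a \<in> carrier A" "x = a \<ominus> a \<otimes> T"
        by (auto simp: L_def)
      with T show "c \<odot> x \<in> L"
        by (auto simp: L_def smult_diff smult_mult_left intro!: image_eqI[of _ _ "c \<odot> a"])
    next
      fix b x assume "b \<in> carrier A" "x \<in> L"
      moreover from \<open>x \<in> L\<close> obtain a where "a \<in> carrier A" "x = a \<ominus> a \<otimes> T"
        by (auto simp: L_def)
      ultimately show "b \<otimes> x \<in> L" using T
        by (auto simp: L_def mult_diff mult_assoc intro!: image_eqI[of _ _ "b \<otimes> a"])
    qed
    have "T \<in> L"
    proof (rule ccontr)
      assume notin: "T \<notin> L"
      define \<I> where "\<I> = {I. left_ideal I A \<and> L \<subseteq> I \<and> T \<notin> I}"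
      have "\<exists>I\<in>\<I>. \<forall>X\<in>\<I>. I \<subseteq> X \<longrightarrow> X = I"
      proof (rule subset_Zorn_nonempty)
        show "\<I> \<noteq> {}" using L notin by (auto simp: \<I>_def)
        fix \<C> assume ne: "\<C> \<noteq> {}" and chain: "subset.chain \<I> \<C>"
        then have sub: "\<C> \<subseteq> \<I>" and tot: "\<And>X Y. X \<in> \<C> \<Longrightarrow> Y \<in> \<C> \<Longrightarrow> X \<subseteq> Y \<or> Y \<subseteq> X"
          by (auto simp: subset_chain_def)
        have id: "I \<subseteq> carrier A" "\<zero> \<in> I" "\<And>x y. x \<in> I \<Longrightarrow> y \<in> I \<Longrightarrow> x \<oplus> y \<in> I"
            "\<And>c x. x \<in> I \<Longrightarrow> c \<odot> x \<in> I" "\<And>a x. a \<in> carrier A \<Longrightarrow> x \<in> I \<Longrightarrow> a \<otimes> x \<in> I"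
          if "I \<in> \<C>" for I
          using that sub by (auto simp: \<I>_def left_ideal_iff)
        have "left_ideal (\<Union>\<C>) A"
          unfolding left_ideal_iff
        proof (intro conjI ballI allI)
          show "\<Union>\<C> \<subseteq> carrier A" using id(1) by (rule Union_least)
          show "\<zero> \<in> \<Union>\<C>" using id(2) ne by auto
          show "c \<odot> x \<in> \<Union>\<C>" if "x \<in> \<Union>\<C>" for c x using that id(4) by auto
          show "a \<otimes> x \<in> \<Union>\<C>" if "a \<in> carrier A" "x \<in> \<Union>\<C>" for a x using that id(5) by auto
          fix x y assume "x \<in> \<Union>\<C>" "y \<in> \<Union>\<C>"
          then obtain I where "I \<in> \<C>" "x \<in> I" "y \<in> I" using tot by blast
          then show "x \<oplus> y \<in> \<Union>\<C>" using id by blast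
        qed
        then show "\<Union>\<C> \<in> \<I>" using sub ne by (auto simp: \<I>_def)
      qed
      then obtain I where I: "I \<in> \<I>" and max: "\<And>X. X \<in> \<I> \<Longrightarrow> I \<subseteq> X \<Longrightarrow> X = I" by blast
      have mod: "a \<ominus> a \<otimes> T \<in> I" if "a \<in> carrier A" for a
        using I that by (auto simp: \<I>_def L_def)
      have "maximal_modular_left_ideal I A"
        unfolding maximal_modular_left_ideal_def modular_left_ideal_def
      proof (intro conjI allI impI)
        show "left_ideal I A" "I \<noteq> carrier A" using I T by (auto simp: \<I>_def)
        show "\<exists>e\<in>carrier A. \<forall>a\<in>carrier A. a \<ominus> a \<otimes> e \<in> I" using mod T by blast
        fix X assume X: "left_ideal X A \<and> I \<subseteq> X"
        show "X = I \<or> X = carrier A"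
        proof (cases "T \<in> X")
          case True
          have "a \<in> X" if a: "a \<in> carrier A" for a
          proof -
            have "(a \<ominus> a \<otimes> T) \<oplus> a \<otimes> T \<in> X"
              using X True a mod[OF a] unfolding left_ideal_iff by blast
            then show ?thesis using a T by (simp add: diff_add_cancel)
          qed
          then show ?thesis using X by (auto simp: left_ideal_iff)
        next
          case False
          then have "X \<in> \<I>" using X I by (auto simp: \<I>_def)
          then show ?thesis using max X by blast
        qed
      qed
      with no_max show False by blast
    qed
    then obtain c where c: "c \<in> carrier A" "c \<ominus> c \<otimes> T = T" by (auto simp: L_def)
    then have "T \<oplus> c \<otimes> T = c"
      using T diff_add_cancel[of c "c \<otimes> T"] by simp
    then show "\<exists>c\<in>carrier A. c = T \<oplus> c \<otimes> T" using c(1) by (intro bexI[of _ c]) simp_all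
  qed
next
  assume Q: "\<forall>T\<in>carrier A. \<exists>c\<in>carrier A. c = T \<oplus> c \<otimes> T"
  have "\<not> maximal_modular_left_ideal L A" for L
  proof
    assume "maximal_modular_left_ideal L A"
    then have mL: "modular_left_ideal L A" and L: "left_ideal L A" "L \<noteq> carrier A"
      by (simp_all add: maximal_modular_left_ideal_def modular_left_ideal_def)
    from mL have "\<exists>e\<in>carrier A. \<forall>a\<in>carrier A. a \<ominus> a \<otimes> e \<in> L"
      by (simp add: modular_left_ideal_def)
    then obtain e where e: "e \<in> carrier A"
      and mod: "\<And>a. a \<in> carrier A \<Longrightarrow> a \<ominus> a \<otimes> e \<in> L"
      by (elim bexE) simp
    obtain c where c: "c \<in> carrier A" "c = e \<oplus> c \<otimes> e"
      by (rule bexE[OF bspec[OF Q e]])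
    have "c \<ominus> c \<otimes> e = e"
      using e c(1) add_diff_cancel_right'[of e "c \<otimes> e"] unfolding c(2)[symmetric] by simp
    then have eL: "e \<in> L" using mod[OF c(1)] by simp
    have "a \<in> L" if a: "a \<in> carrier A" for a
    proof -
      have "a \<otimes> e \<in> L" using L(1) eL a unfolding left_ideal_iff by blast
      then have "(a \<ominus> a \<otimes> e) \<oplus> a \<otimes> e \<in> L"
        using L(1) mod[OF a] unfolding left_ideal_iff by blast
      then show ?thesis using a e by (simp add: diff_add_cancel)
    qed
    then show False using L by (auto simp: left_ideal_iff)
  qed
  then show "jacobson_radical_algebra A"
    by (auto simp: jacobson_radical_algebra_def jacobson_radical_def)
qed

end


section \<open>Seminormed algebras and their completions\<close>

lemma UN_equiv_class_op:
  assumes equiv: "equiv S r" and f: "f \<in> S"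
    and cong: "\<And>f'. (f, f') \<in> r \<Longrightarrow> (p f, p f') \<in> r"
  shows "(\<Union>f'\<in>r `` {f}. r `` {p f'}) = r `` {p f}"
proof -
  have "r `` {p f'} = r `` {p f}" if "f' \<in> r `` {f}" for f'
    using equiv_class_eq[OF equiv cong] that by auto
  then show ?thesis using equiv_class_self[OF equiv f] by blast
qed

lemma UN_equiv_class_op2:
  assumes equiv: "equiv S r" and f: "f \<in> S" and g: "g \<in> S"
    and cong: "\<And>f' g'. \<lbrakk>(f, f') \<in> r; (g, g') \<in> r\<rbrakk> \<Longrightarrow> (p f g, p f' g') \<in> r"
  shows "(\<Union>f'\<in>r `` {f}. \<Union>g'\<in>r `` {g}. r `` {p f' g'}) = r `` {p f g}"
proof -
  have "r `` {p f' g'} = r `` {p f g}" if "f' \<in> r `` {f}" "g' \<in> r `` {g}" for f' g'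
    using equiv_class_eq[OF equiv cong] that by auto
  then show ?thesis using equiv_class_self[OF equiv f] equiv_class_self[OF equiv g] by blast
qed

text \<open>The completion identifies Cauchy sequences at distance \<open>0\<close>, so it turns a seminormed
  algebra into a normed one. The projective tensor product is treated as the completion of a
  seminormed algebra.\<close>

locale seminormed_algebra = complex_algebra A for A :: "('a, 'm) normed_alg_scheme" (structure) +
  assumes nrm_nonneg: "x \<in> carrier A \<Longrightarrow> 0 \<le> nrm A x"
    and nrm_triangle: "\<lbrakk>x \<in> carrier A; y \<in> carrier A\<rbrakk> \<Longrightarrow>
      nrm A (x \<oplus> y) \<le> nrm A x + nrm A y"
    and nrm_smult: "x \<in> carrier A \<Longrightarrow> nrm A (c \<odot> x) = cmod c * nrm A x"
    and nrm_mult: "\<lbrakk>x \<in> carrier A; y \<in> carrier A\<rbrakk> \<Longrightarrow>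
      nrm A (x \<otimes> y) \<le> nrm A x * nrm A y"
begin

lemma nrm_zero [simp]: "nrm A \<zero> = 0"
  using nrm_smult[of \<zero> 0] by simp

lemma nrm_minus: "x \<in> carrier A \<Longrightarrow> nrm A (\<ominus> x) = nrm A x"
  by (simp add: minus_eq_smult nrm_smult)

lemma nrm_diff_commute: "\<lbrakk>x \<in> carrier A; y \<in> carrier A\<rbrakk> \<Longrightarrow> nrm A (x \<ominus> y) = nrm A (y \<ominus> x)"
  using nrm_minus[of "x \<ominus> y"] by (simp add: minus_diff)

lemma nrm_diff_triangle: "\<lbrakk>x \<in> carrier A; y \<in> carrier A; z \<in> carrier A\<rbrakk> \<Longrightarrow>
    nrm A (x \<ominus> z) \<le> nrm A (x \<ominus> y) + nrm A (y \<ominus> z)"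
  using nrm_triangle[of "x \<ominus> y" "y \<ominus> z"] by (simp add: diff_add_diff)

lemma nrm_le_diff: "\<lbrakk>x \<in> carrier A; y \<in> carrier A\<rbrakk> \<Longrightarrow> nrm A x \<le> nrm A (x \<ominus> y) + nrm A y"
  using nrm_triangle[of "x \<ominus> y" y] by (simp add: diff_add_cancel)

lemma abs_nrm_diff_le: "\<lbrakk>x \<in> carrier A; y \<in> carrier A\<rbrakk> \<Longrightarrow> \<bar>nrm A x - nrm A y\<bar> \<le> nrm A (x \<ominus> y)"
  using nrm_le_diff[of x y] nrm_le_diff[of y x] by (simp add: nrm_diff_commute abs_le_iff)

lemma nrm_add_diff_le:
  "\<lbrakk>x \<in> carrier A; y \<in> carrier A; x' \<in> carrier A; y' \<in> carrier A\<rbrakk> \<Longrightarrow>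
    nrm A ((x \<oplus> y) \<ominus> (x' \<oplus> y')) \<le> nrm A (x \<ominus> x') + nrm A (y \<ominus> y')"
  using nrm_triangle[of "x \<ominus> x'" "y \<ominus> y'"] by (simp add: add_diff_add)

lemma nrm_mult_diff_le:
  assumes "x \<in> carrier A" "y \<in> carrier A" "x' \<in> carrier A" "y' \<in> carrier A"
  shows "nrm A (x \<otimes> y \<ominus> x' \<otimes> y') \<le> nrm A (x \<ominus> x') * nrm A y + nrm A x' * nrm A (y \<ominus> y')"
proof -
  have "nrm A (x \<otimes> y \<ominus> x' \<otimes> y') \<le> nrm A (x \<otimes> y \<ominus> x' \<otimes> y) + nrm A (x' \<otimes> y \<ominus> x' \<otimes> y')"
    using assms by (intro nrm_diff_triangle) auto
  also have "\<dots> = nrm A ((x \<ominus> x') \<otimes> y) + nrm A (x' \<otimes> (y \<ominus> y'))"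
    using assms by (simp add: diff_mult mult_diff)
  also have "\<dots> \<le> nrm A (x \<ominus> x') * nrm A y + nrm A x' * nrm A (y \<ominus> y')"
    using assms by (intro add_mono nrm_mult) auto
  finally show ?thesis .
qed

lemma cauchy_seqsD: "X \<in> cauchy_seqs A \<Longrightarrow> X n \<in> carrier A"
  by (simp add: cauchy_seqs_def)

lemma cauchy_seqs_convergent_nrm:
  assumes "X \<in> cauchy_seqs A"
  shows "convergent (\<lambda>n. nrm A (X n))"
proof -
  have "Cauchy (\<lambda>n. nrm A (X n))"
    unfolding Cauchy_def dist_real_def
  proof (intro allI impI)
    fix e :: real assume "e > 0"
    then obtain N where "\<forall>m\<ge>N. \<forall>n\<ge>N. nrm A (X m \<ominus> X n) < e"
      using assms by (auto simp: cauchy_seqs_def)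
    then show "\<exists>M. \<forall>m\<ge>M. \<forall>n\<ge>M. \<bar>nrm A (X m) - nrm A (X n)\<bar> < e"
      using abs_nrm_diff_le[OF cauchy_seqsD[OF assms] cauchy_seqsD[OF assms]]
      by (meson order_le_less_trans)
  qed
  then show ?thesis by (simp add: Cauchy_convergent_iff)
qed

lemma cauchy_seqs_bounded:
  assumes "X \<in> cauchy_seqs A"
  shows "\<exists>K>0. \<forall>n. nrm A (X n) \<le> K"
proof -
  have "Bseq (\<lambda>n. nrm A (X n))"
    using assms cauchy_seqs_convergent_nrm convergent_imp_Bseq by blast
  then show ?thesis by (auto simp: Bseq_def abs_le_iff)
qed

text \<open>This covers sums, multiples and products of Cauchy sequences alike. For products, \<open>K\<close> is a
  common bound of the norms of both sequences.\<close>

lemma cauchy_seqs_dominated: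
  assumes "X \<in> cauchy_seqs A" "Y \<in> cauchy_seqs A" "\<And>n. Z n \<in> carrier A"
    and le: "\<And>m n. nrm A (Z m \<ominus> Z n) \<le> K * (nrm A (X m \<ominus> X n) + nrm A (Y m \<ominus> Y n))"
  shows "Z \<in> cauchy_seqs A"
  unfolding cauchy_seqs_def mem_Collect_eq
proof (intro conjI allI impI)
  fix e :: real assume e: "e > 0"
  define L where "L = \<bar>K\<bar> + 1"
  define d where "d = e / (2 * L)"
  have L: "L > 0" "K \<le> L" by (auto simp: L_def)
  then have d: "d > 0" using e by (simp add: d_def)
  obtain N1 where N1: "\<And>m n. m \<ge> N1 \<Longrightarrow> n \<ge> N1 \<Longrightarrow> nrm A (X m \<ominus> X n) < d"
    using assms(1) d unfolding cauchy_seqs_def by blast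
  obtain N2 where N2: "\<And>m n. m \<ge> N2 \<Longrightarrow> n \<ge> N2 \<Longrightarrow> nrm A (Y m \<ominus> Y n) < d"
    using assms(2) d unfolding cauchy_seqs_def by blast
  have "nrm A (Z m \<ominus> Z n) < e" if "m \<ge> max N1 N2" "n \<ge> max N1 N2" for m n
  proof -
    have nn: "0 \<le> nrm A (X m \<ominus> X n) + nrm A (Y m \<ominus> Y n)"
      using assms by (intro add_nonneg_nonneg nrm_nonneg) (auto dest: cauchy_seqsD)
    have "nrm A (Z m \<ominus> Z n) \<le> L * (nrm A (X m \<ominus> X n) + nrm A (Y m \<ominus> Y n))"
      using le[of m n] mult_right_mono[OF L(2) nn] by linarith
    also have "\<dots> < L * (d + d)"
      using L N1[of m n] N2[of m n] that by (intro mult_strict_left_mono add_strict_mono) auto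
    also have "\<dots> = e" using L by (simp add: d_def field_simps)
    finally show ?thesis .
  qed
  then show "\<exists>N. \<forall>m\<ge>N. \<forall>n\<ge>N. nrm A (Z m \<ominus> Z n) < e" by blast
qed (use assms in auto)

lemma cauchy_seqs_const: "x \<in> carrier A \<Longrightarrow> (\<lambda>n. x) \<in> cauchy_seqs A"
  by (simp add: cauchy_seqs_def)

lemma cauchy_seqs_add:
  assumes "X \<in> cauchy_seqs A" "Y \<in> cauchy_seqs A"
  shows "(\<lambda>n. X n \<oplus> Y n) \<in> cauchy_seqs A"
  using nrm_add_diff_le assms[THEN cauchy_seqsD]
  by (intro cauchy_seqs_dominated[OF assms, of _ 1]) simp_all

lemma cauchy_seqs_smult:
  assumes "X \<in> cauchy_seqs A"
  shows "(\<lambda>n. c \<odot> X n) \<in> cauchy_seqs A"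
proof (rule cauchy_seqs_dominated[OF assms assms, of _ "cmod c"])
  note X = cauchy_seqsD[OF assms]
  show "c \<odot> X n \<in> carrier A" for n using X by simp
  show "nrm A (c \<odot> X m \<ominus> c \<odot> X n) \<le> cmod c * (nrm A (X m \<ominus> X n) + nrm A (X m \<ominus> X n))" for m n
    using X nrm_nonneg[of "X m \<ominus> X n"]
    by (simp add: smult_diff[symmetric] nrm_smult mult_left_mono)
qed

lemma cauchy_seqs_mult:
  assumes "X \<in> cauchy_seqs A" "Y \<in> cauchy_seqs A"
  shows "(\<lambda>n. X n \<otimes> Y n) \<in> cauchy_seqs A"
proof -
  obtain K where K: "K > 0" "\<And>n. nrm A (X n) \<le> K"
    using cauchy_seqs_bounded[OF assms(1)] by blast
  obtain L where L: "L > 0" "\<And>n. nrm A (Y n) \<le> L"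
    using cauchy_seqs_bounded[OF assms(2)] by blast
  note X = cauchy_seqsD[OF assms(1)] and Y = cauchy_seqsD[OF assms(2)]
  show ?thesis
  proof (rule cauchy_seqs_dominated[OF assms, of _ "max K L"])
    show "X n \<otimes> Y n \<in> carrier A" for n using X Y by simp
    fix m n
    have "nrm A (X m \<otimes> Y m \<ominus> X n \<otimes> Y n) \<le>
        nrm A (X m \<ominus> X n) * nrm A (Y m) + nrm A (X n) * nrm A (Y m \<ominus> Y n)"
      using X Y by (intro nrm_mult_diff_le)
    also have "\<dots> \<le> nrm A (X m \<ominus> X n) * max K L + max K L * nrm A (Y m \<ominus> Y n)"
      using X Y K L
      by (intro add_mono mult_left_mono mult_right_mono nrm_nonneg) (auto simp: le_max_iff_disj)
    finally show "nrm A (X m \<otimes> Y m \<ominus> X n \<otimes> Y n) \<le>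
        max K L * (nrm A (X m \<ominus> X n) + nrm A (Y m \<ominus> Y n))"
      by (simp add: algebra_simps)
  qed
qed

lemma same_limitI:
  assumes "X \<in> cauchy_seqs A" "Y \<in> cauchy_seqs A" "f \<longlonglongrightarrow> 0"
    "\<And>n. nrm A (X n \<ominus> Y n) \<le> f n"
  shows "(X, Y) \<in> same_limit A"
  using assms tendsto_sandwich[of "\<lambda>n. 0" "\<lambda>n. nrm A (X n \<ominus> Y n)" sequentially f 0]
  by (auto simp: same_limit_def cauchy_seqsD nrm_nonneg)

lemma equiv_same_limit: "equiv (cauchy_seqs A) (same_limit A)"
proof (rule equivI)
  show "same_limit A \<subseteq> cauchy_seqs A \<times> cauchy_seqs A" by (auto simp: same_limit_def)
  show "refl_on (cauchy_seqs A) (same_limit A)"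
    by (auto simp: refl_on_def same_limit_def cauchy_seqsD)
  show "sym (same_limit A)"
    by (auto simp: sym_def same_limit_def cauchy_seqsD nrm_diff_commute)
  show "trans (same_limit A)"
  proof (rule transI)
    fix X Y Z assume "(X, Y) \<in> same_limit A" "(Y, Z) \<in> same_limit A"
    then have c: "X \<in> cauchy_seqs A" "Y \<in> cauchy_seqs A" "Z \<in> cauchy_seqs A"
      and "(\<lambda>n. nrm A (X n \<ominus> Y n)) \<longlonglongrightarrow> 0" "(\<lambda>n. nrm A (Y n \<ominus> Z n)) \<longlonglongrightarrow> 0"
      by (simp_all add: same_limit_def)
    then have "(\<lambda>n. nrm A (X n \<ominus> Y n) + nrm A (Y n \<ominus> Z n)) \<longlonglongrightarrow> 0 + 0"
      by (intro tendsto_add)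
    then show "(X, Z) \<in> same_limit A"
      using nrm_diff_triangle[OF c[THEN cauchy_seqsD]] by (intro same_limitI[OF c(1,3)]) simp_all
  qed
qed

lemma same_limit_dominated:
  assumes "(X, X') \<in> same_limit A" "(Y, Y') \<in> same_limit A"
    and "Z \<in> cauchy_seqs A" "Z' \<in> cauchy_seqs A"
    and "\<And>n. nrm A (Z n \<ominus> Z' n) \<le> K * (nrm A (X n \<ominus> X' n) + nrm A (Y n \<ominus> Y' n))"
  shows "(Z, Z') \<in> same_limit A"
proof (rule same_limitI[OF assms(3,4) _ assms(5)])
  have "(\<lambda>n. K * (nrm A (X n \<ominus> X' n) + nrm A (Y n \<ominus> Y' n))) \<longlonglongrightarrow> K * (0 + 0)"
    using assms(1,2) by (intro tendsto_mult tendsto_add tendsto_const) (auto simp: same_limit_def)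
  then show "(\<lambda>n. K * (nrm A (X n \<ominus> X' n) + nrm A (Y n \<ominus> Y' n))) \<longlonglongrightarrow> 0" by simp
qed

lemma same_limit_add:
  assumes "(X, X') \<in> same_limit A" "(Y, Y') \<in> same_limit A"
  shows "(\<lambda>n. X n \<oplus> Y n, \<lambda>n. X' n \<oplus> Y' n) \<in> same_limit A"
proof (rule same_limit_dominated[OF assms, of _ _ 1])
  have c: "X \<in> cauchy_seqs A" "X' \<in> cauchy_seqs A" "Y \<in> cauchy_seqs A" "Y' \<in> cauchy_seqs A"
    using assms by (auto simp: same_limit_def)
  then show "(\<lambda>n. X n \<oplus> Y n) \<in> cauchy_seqs A" "(\<lambda>n. X' n \<oplus> Y' n) \<in> cauchy_seqs A"
    by (auto intro: cauchy_seqs_add)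
  show "nrm A (X n \<oplus> Y n \<ominus> (X' n \<oplus> Y' n)) \<le>
      1 * (nrm A (X n \<ominus> X' n) + nrm A (Y n \<ominus> Y' n))" for n
    using nrm_add_diff_le[OF c(1,3,2,4)[THEN cauchy_seqsD]] by simp
qed

lemma same_limit_smult:
  assumes "(X, X') \<in> same_limit A"
  shows "(\<lambda>n. c \<odot> X n, \<lambda>n. c \<odot> X' n) \<in> same_limit A"
proof (rule same_limit_dominated[OF assms assms, of _ _ "cmod c"])
  have X: "X \<in> cauchy_seqs A" "X' \<in> cauchy_seqs A" using assms by (simp_all add: same_limit_def)
  then show "(\<lambda>n. c \<odot> X n) \<in> cauchy_seqs A" "(\<lambda>n. c \<odot> X' n) \<in> cauchy_seqs A"
    by (auto intro: cauchy_seqs_smult)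
  show "nrm A (c \<odot> X n \<ominus> c \<odot> X' n) \<le> cmod c * (nrm A (X n \<ominus> X' n) + nrm A (X n \<ominus> X' n))" for n
    using X[THEN cauchy_seqsD] nrm_nonneg[of "X n \<ominus> X' n"]
    by (simp add: smult_diff[symmetric] nrm_smult mult_left_mono)
qed

lemma same_limit_mult:
  assumes "(X, X') \<in> same_limit A" "(Y, Y') \<in> same_limit A"
  shows "(\<lambda>n. X n \<otimes> Y n, \<lambda>n. X' n \<otimes> Y' n) \<in> same_limit A"
proof -
  have c: "X \<in> cauchy_seqs A" "X' \<in> cauchy_seqs A" "Y \<in> cauchy_seqs A" "Y' \<in> cauchy_seqs A"
    using assms by (auto simp: same_limit_def)
  note X = c[THEN cauchy_seqsD]
  obtain K where K: "K > 0" "\<And>n. nrm A (X' n) \<le> K"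
    using cauchy_seqs_bounded[OF c(2)] by blast
  obtain L where L: "L > 0" "\<And>n. nrm A (Y n) \<le> L"
    using cauchy_seqs_bounded[OF c(3)] by blast
  show ?thesis
  proof (rule same_limit_dominated[OF assms, of _ _ "max K L"])
    fix n
    have "nrm A (X n \<otimes> Y n \<ominus> X' n \<otimes> Y' n) \<le>
        nrm A (X n \<ominus> X' n) * nrm A (Y n) + nrm A (X' n) * nrm A (Y n \<ominus> Y' n)"
      using X by (intro nrm_mult_diff_le)
    also have "\<dots> \<le> nrm A (X n \<ominus> X' n) * max K L + max K L * nrm A (Y n \<ominus> Y' n)"
      using X K L
      by (intro add_mono mult_left_mono mult_right_mono nrm_nonneg) (auto simp: le_max_iff_disj)
    finally show "nrm A (X n \<otimes> Y n \<ominus> X' n \<otimes> Y' n) \<le>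
        max K L * (nrm A (X n \<ominus> X' n) + nrm A (Y n \<ominus> Y' n))"
      by (simp add: algebra_simps)
  qed (use c in \<open>auto intro: cauchy_seqs_mult\<close>)
qed

definition completion_class :: "(nat \<Rightarrow> 'a) \<Rightarrow> (nat \<Rightarrow> 'a) set" where
  "completion_class X = same_limit A `` {X}"

lemma completion_class_eq_iff:
  "\<lbrakk>X \<in> cauchy_seqs A; Y \<in> cauchy_seqs A\<rbrakk> \<Longrightarrow>
    completion_class X = completion_class Y \<longleftrightarrow> (\<lambda>n. nrm A (X n \<ominus> Y n)) \<longlonglongrightarrow> 0"
  unfolding completion_class_def using eq_equiv_class_iff[OF equiv_same_limit]
  by (auto simp: same_limit_def)

lemma completion_class_cong:
  "(X, Y) \<in> same_limit A \<Longrightarrow> completion_class X = completion_class Y"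
  unfolding completion_class_def by (rule equiv_class_eq[OF equiv_same_limit])

lemma mem_completion_class: "Y \<in> completion_class X \<longleftrightarrow> (X, Y) \<in> same_limit A"
  by (simp add: completion_class_def)

lemma completion_class_self: "X \<in> cauchy_seqs A \<Longrightarrow> X \<in> completion_class X"
  unfolding completion_class_def by (rule equiv_class_self[OF equiv_same_limit])

lemma completion_carrier: "carrier (normed_completion A) = completion_class ` cauchy_seqs A"
  by (auto simp: normed_completion_def completion_class_def quotient_def)

lemma completion_zero: "\<zero>\<^bsub>normed_completion A\<^esub> = completion_class (\<lambda>n. \<zero>)"
  by (simp add: normed_completion_def completion_class_def)

lemma completion_add:
  assumes "X \<in> cauchy_seqs A" "Y \<in> cauchy_seqs A"
  shows "completion_class X \<oplus>\<^bsub>normed_completion A\<^esub> completion_class Y =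
    completion_class (\<lambda>n. X n \<oplus> Y n)"
  using UN_equiv_class_op2[OF equiv_same_limit assms, where p = "\<lambda>X Y n. X n \<oplus> Y n"]
  by (simp add: normed_completion_def completion_class_def same_limit_add)

lemma completion_mult:
  assumes "X \<in> cauchy_seqs A" "Y \<in> cauchy_seqs A"
  shows "completion_class X \<otimes>\<^bsub>normed_completion A\<^esub> completion_class Y =
    completion_class (\<lambda>n. X n \<otimes> Y n)"
  using UN_equiv_class_op2[OF equiv_same_limit assms, where p = "\<lambda>X Y n. X n \<otimes> Y n"]
  by (simp add: normed_completion_def completion_class_def same_limit_mult)

lemma completion_smult:
  assumes "X \<in> cauchy_seqs A"
  shows "c \<odot>\<^bsub>normed_completion A\<^esub> completion_class X = completion_class (\<lambda>n. c \<odot> X n)"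
  using UN_equiv_class_op[OF equiv_same_limit assms, where p = "\<lambda>X n. c \<odot> X n"]
  by (simp add: normed_completion_def completion_class_def same_limit_smult)

lemma completion_nrm:
  assumes "X \<in> cauchy_seqs A"
  shows "(\<lambda>n. nrm A (X n)) \<longlonglongrightarrow> nrm (normed_completion A) (completion_class X)"
proof -
  obtain r where r: "(\<lambda>n. nrm A (X n)) \<longlonglongrightarrow> r"
    using cauchy_seqs_convergent_nrm[OF assms] by (auto simp: convergent_def)
  have lim: "(\<lambda>n. nrm A (Y n)) \<longlonglongrightarrow> r" if "Y \<in> completion_class X" for Y
  proof -
    have sl: "(X, Y) \<in> same_limit A" using that by (simp add: mem_completion_class)
    have "(\<lambda>n. nrm A (Y n) - nrm A (X n)) \<longlonglongrightarrow> 0"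
    proof (rule tendsto_0_le[where K = 1])
      show "(\<lambda>n. nrm A (X n \<ominus> Y n)) \<longlonglongrightarrow> 0" using sl by (simp add: same_limit_def)
      show "\<forall>\<^sub>F n in sequentially. norm (nrm A (Y n) - nrm A (X n)) \<le> norm (nrm A (X n \<ominus> Y n)) * 1"
        using sl abs_nrm_diff_le nrm_nonneg
        by (intro always_eventually) (auto simp: same_limit_def cauchy_seqsD abs_minus_commute)
    qed
    from tendsto_add[OF this r] show ?thesis by simp
  qed
  have "nrm (normed_completion A) (completion_class X) = r"
    unfolding normed_completion_def
  proof (simp, rule the_equality)
    show "\<forall>Y\<in>completion_class X. (\<lambda>n. nrm A (Y n)) \<longlonglongrightarrow> r" using lim by blast
    fix s assume "\<forall>Y\<in>completion_class X. (\<lambda>n. nrm A (Y n)) \<longlonglongrightarrow> s"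
    then have "(\<lambda>n. nrm A (X n)) \<longlonglongrightarrow> s" using completion_class_self[OF assms] by blast
    then show "s = r" using r LIMSEQ_unique by blast
  qed
  with r show ?thesis by simp
qed

text \<open>The completion is the image of the algebra of Cauchy sequences with pointwise operations.\<close>

lemma complex_algebra_completion: "complex_algebra (normed_completion A)"
proof (rule complex_algebra_image)
  define P :: "(complex, nat \<Rightarrow> 'a) module" where
    "P = \<lparr>carrier = cauchy_seqs A, monoid.mult = (\<lambda>X Y n. X n \<otimes> Y n), one = undefined,
      ring.zero = (\<lambda>n. \<zero>), add = (\<lambda>X Y n. X n \<oplus> Y n), module.smult = (\<lambda>c X n. c \<odot> X n)\<rparr>"
  show "complex_algebra P"
    by (rule complex_algebraI)
      (auto simp: P_def fun_eq_iff cauchy_seqsD cauchy_seqs_add cauchy_seqs_const cauchy_seqs_mult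
        cauchy_seqs_smult M.a_ac smult_add_left smult_add_right smult_smult mult_assoc
        distr_left distr_right smult_mult_left smult_mult_right)
  show "carrier (normed_completion A) = completion_class ` carrier P"
    by (simp add: completion_carrier P_def)
qed (simp_all add: completion_zero completion_add completion_mult completion_smult)

lemma completion_diff:
  assumes "X \<in> cauchy_seqs A" "Y \<in> cauchy_seqs A"
  shows "completion_class X \<ominus>\<^bsub>normed_completion A\<^esub> completion_class Y =
    completion_class (\<lambda>n. X n \<ominus> Y n)"
proof -
  interpret C: complex_algebra "normed_completion A" by (rule complex_algebra_completion)
  have "completion_class Y \<in> carrier (normed_completion A)"
    using assms by (simp add: completion_carrier)
  then show ?thesis
    using assms
    by (simp add: C.M.minus_eq M.minus_eq C.minus_eq_smult minus_eq_smult completion_smult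
        completion_add cauchy_seqs_smult cauchy_seqsD)
qed

lemma cauchy_seqs_diff:
  assumes "X \<in> cauchy_seqs A" "Y \<in> cauchy_seqs A"
  shows "(\<lambda>n. X n \<ominus> Y n) \<in> cauchy_seqs A"
  using cauchy_seqs_add[OF assms(1) cauchy_seqs_smult[OF assms(2), of "-1"]] assms
  by (simp add: M.minus_eq minus_eq_smult cauchy_seqsD)

lemma normed_algebra_completion: "normed_algebra (normed_completion A)"
proof (intro normed_algebra.intro complex_algebra_completion normed_algebra_axioms.intro)
  let ?C = "normed_completion A"
  note [simp] = completion_carrier
  note lim = completion_nrm
  show "0 \<le> nrm ?C U" if U: "U \<in> carrier ?C" for U
    using U by (auto intro!: LIMSEQ_le_const[OF lim] nrm_nonneg dest: cauchy_seqsD)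
  show "nrm ?C U = 0 \<longleftrightarrow> U = \<zero>\<^bsub>?C\<^esub>" if U: "U \<in> carrier ?C" for U
  proof -
    obtain X where X: "X \<in> cauchy_seqs A" "U = completion_class X" using U by auto
    have "U = \<zero>\<^bsub>?C\<^esub> \<longleftrightarrow> (\<lambda>n. nrm A (X n)) \<longlonglongrightarrow> 0"
      using X completion_class_eq_iff[OF X(1) cauchy_seqs_const[of \<zero>]]
      by (simp add: completion_zero cauchy_seqsD)
    also have "\<dots> \<longleftrightarrow> nrm ?C U = 0"
      using lim[OF X(1)] X(2) LIMSEQ_unique by metis
    finally show ?thesis by blast
  qed
  show "nrm ?C (U \<oplus>\<^bsub>?C\<^esub> V) \<le> nrm ?C U + nrm ?C V"
    if UV: "U \<in> carrier ?C" "V \<in> carrier ?C" for U V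
  proof -
    obtain X Y where X: "X \<in> cauchy_seqs A" "U = completion_class X"
      and Y: "Y \<in> cauchy_seqs A" "V = completion_class Y" using UV by auto
    show ?thesis
      using lim[OF cauchy_seqs_add[OF X(1) Y(1)]] tendsto_add[OF lim[OF X(1)] lim[OF Y(1)]]
      unfolding X Y completion_add[OF X(1) Y(1)]
      by (rule LIMSEQ_le) (use X Y in \<open>auto intro!: nrm_triangle dest: cauchy_seqsD\<close>)
  qed
  show "nrm ?C (c \<odot>\<^bsub>?C\<^esub> U) = cmod c * nrm ?C U" if U: "U \<in> carrier ?C" for c U
  proof -
    obtain X where X: "X \<in> cauchy_seqs A" "U = completion_class X" using U by auto
    have "(\<lambda>n. nrm A (c \<odot> X n)) \<longlonglongrightarrow> cmod c * nrm ?C U"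
      using tendsto_mult_left[OF lim[OF X(1)], of "cmod c"] X by (simp add: nrm_smult cauchy_seqsD)
    with lim[OF cauchy_seqs_smult[OF X(1)], of c] show ?thesis
      unfolding X completion_smult[OF X(1)] by (rule LIMSEQ_unique)
  qed
  show "nrm ?C (U \<otimes>\<^bsub>?C\<^esub> V) \<le> nrm ?C U * nrm ?C V"
    if UV: "U \<in> carrier ?C" "V \<in> carrier ?C" for U V
  proof -
    obtain X Y where X: "X \<in> cauchy_seqs A" "U = completion_class X"
      and Y: "Y \<in> cauchy_seqs A" "V = completion_class Y" using UV by auto
    show ?thesis
      using lim[OF cauchy_seqs_mult[OF X(1) Y(1)]] tendsto_mult[OF lim[OF X(1)] lim[OF Y(1)]]
      unfolding X Y completion_mult[OF X(1) Y(1)]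
      by (rule LIMSEQ_le) (use X Y in \<open>auto intro!: nrm_mult dest: cauchy_seqsD\<close>)
  qed
qed

lemma same_limit_if_distance_tendsto_0:
  assumes X: "X \<in> cauchy_seqs A" and Z: "\<And>n. Z n \<in> carrier A"
    and lim: "(\<lambda>n. nrm A (X n \<ominus> Z n)) \<longlonglongrightarrow> 0"
  shows "(X, Z) \<in> same_limit A"
proof -
  note XA = cauchy_seqsD[OF X]
  have "Z \<in> cauchy_seqs A"
    unfolding cauchy_seqs_def mem_Collect_eq
  proof (intro conjI allI impI Z)
    fix e :: real assume "e > 0"
    then have e3: "e / 3 > 0" by simp
    obtain N1 where N1: "\<And>m n. m \<ge> N1 \<Longrightarrow> n \<ge> N1 \<Longrightarrow> nrm A (X m \<ominus> X n) < e / 3"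
      using X e3 unfolding cauchy_seqs_def by blast
    obtain N2 where N2: "\<And>n. n \<ge> N2 \<Longrightarrow> nrm A (X n \<ominus> Z n) < e / 3"
      using order_tendstoD(2)[OF lim e3] by (auto simp: eventually_sequentially)
    have "nrm A (Z m \<ominus> Z n) < e" if "m \<ge> max N1 N2" "n \<ge> max N1 N2" for m n
    proof -
      have "nrm A (Z m \<ominus> Z n) \<le> nrm A (X m \<ominus> Z m) + nrm A (X m \<ominus> Z n)"
        using nrm_diff_triangle[of "Z m" "X m" "Z n"] nrm_diff_commute[of "Z m" "X m"] XA Z by simp
      also have "nrm A (X m \<ominus> Z n) \<le> nrm A (X m \<ominus> X n) + nrm A (X n \<ominus> Z n)"
        using XA Z by (intro nrm_diff_triangle)
      finally show ?thesis using N1[of m n] N2[of m] N2[of n] that by simp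
    qed
    then show "\<exists>N. \<forall>m\<ge>N. \<forall>n\<ge>N. nrm A (Z m \<ominus> Z n) < e" by blast
  qed
  with X lim show ?thesis by (simp add: same_limit_def)
qed

lemma cauchy_seqs_summable:
  assumes X: "\<And>n. X n \<in> carrier A" and f: "summable f"
    and le: "\<And>n. nrm A (X (Suc n) \<ominus> X n) \<le> f n"
  shows "X \<in> cauchy_seqs A"
  unfolding cauchy_seqs_def mem_Collect_eq
proof (intro conjI allI impI X)
  fix e :: real assume "e > 0"
  then obtain N where N: "\<And>m n. m \<ge> N \<Longrightarrow> norm (sum f {m..<n}) < e"
    using f unfolding summable_Cauchy by blast
  have tele: "nrm A (X (m + k) \<ominus> X m) \<le> sum f {m..<m + k}" for m k
  proof (induction k)
    case (Suc k)
    have "nrm A (X (m + Suc k) \<ominus> X m) \<le>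
        nrm A (X (Suc (m + k)) \<ominus> X (m + k)) + nrm A (X (m + k) \<ominus> X m)"
      using X nrm_diff_triangle by simp
    also have "\<dots> \<le> f (m + k) + sum f {m..<m + k}" using le Suc by (intro add_mono)
    finally show ?case by (simp add: add.commute)
  qed (simp add: X)
  have 1: "nrm A (X n \<ominus> X m) < e" if "m \<ge> N" "m \<le> n" for m n
    using tele[of m "n - m"] N[OF that(1), of n] that(2) by simp
  have "nrm A (X m \<ominus> X n) < e" if "m \<ge> N" "n \<ge> N" for m n
    using 1[of m n] 1[of n m] that nrm_diff_commute[OF X X, of m n] by (cases "m \<le> n") auto
  then show "\<exists>N. \<forall>m\<ge>N. \<forall>n\<ge>N. nrm A (X m \<ominus> X n) < e" by blast
qed

end

sublocale normed_algebra \<subseteq> semi: seminormed_algebra A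
  by unfold_locales (fact nrm_nonneg nrm_triangle nrm_smult nrm_mult)+

lemma (in seminormed_algebra) completion_complete:
  assumes U: "U \<in> cauchy_seqs (normed_completion A)"
  obtains V where "V \<in> carrier (normed_completion A)"
    "(\<lambda>k. nrm (normed_completion A) (U k \<ominus>\<^bsub>normed_completion A\<^esub> V)) \<longlonglongrightarrow> 0"
proof -
  let ?C = "normed_completion A"
  interpret C: normed_algebra ?C by (rule normed_algebra_completion)
  have "\<exists>X\<in>cauchy_seqs A. U k = completion_class X" for k
    using C.semi.cauchy_seqsD[OF U, of k] by (auto simp: completion_carrier)
  then obtain X where X: "\<And>k. X k \<in> cauchy_seqs A" "\<And>k. U k = completion_class (X k)"
    by metis
  have "\<exists>N. \<forall>m\<ge>N. \<forall>n\<ge>N. nrm A (X k m \<ominus> X k n) < 1 / Suc k" for k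
    using X(1)[of k] unfolding cauchy_seqs_def by simp
  then obtain N where N: "\<And>k m n. m \<ge> N k \<Longrightarrow> n \<ge> N k \<Longrightarrow> nrm A (X k m \<ominus> X k n) < 1 / Suc k"
    by metis
  \<comment> \<open>Regarded as a constant sequence, \<open>Y k\<close> is within \<open>1 / (k + 1)\<close> of \<open>U k\<close>.\<close>
  define Y where "Y k = X k (N k)" for k
  have Y: "Y k \<in> carrier A" for k using X(1) by (simp add: Y_def cauchy_seqsD)
  define E where "E k = completion_class (\<lambda>n. Y k)" for k
  have E: "E k \<in> carrier ?C" for k
    using Y by (auto simp: E_def completion_carrier intro: cauchy_seqs_const)
  have UC: "U k \<in> carrier ?C" for k using C.semi.cauchy_seqsD[OF U] .
  have nrm_diff: "nrm ?C (completion_class X \<ominus>\<^bsub>?C\<^esub> completion_class Z) \<le> e"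
    if "X \<in> cauchy_seqs A" "Z \<in> cauchy_seqs A" "\<And>n. n \<ge> N \<Longrightarrow> nrm A (X n \<ominus> Z n) \<le> e" for X Z e N
    unfolding completion_diff[OF that(1,2)]
    using that(3) by (intro LIMSEQ_le_const2[OF completion_nrm[OF cauchy_seqs_diff[OF that(1,2)]]]) auto
  have UE: "nrm ?C (U k \<ominus>\<^bsub>?C\<^esub> E k) \<le> 1 / Suc k" for k
    unfolding X(2) E_def
    using X(1) Y N[of k] by (intro nrm_diff[of _ _ "N k"]) (auto simp: Y_def less_imp_le cauchy_seqs_const)
  have EE: "nrm ?C (E j \<ominus>\<^bsub>?C\<^esub> E k) = nrm A (Y j \<ominus> Y k)" for j k
    using completion_nrm[OF cauchy_seqs_diff, of "\<lambda>n. Y j" "\<lambda>n. Y k"] Y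
    by (simp add: E_def completion_diff cauchy_seqs_const LIMSEQ_const_iff)
  have inv: "\<exists>N. \<forall>k\<ge>N. 1 / Suc k < e" if "e > 0" for e :: real
    using order_tendstoD(2)[OF LIMSEQ_Suc[OF lim_1_over_n], of e] that
    by (simp add: eventually_sequentially)
  have YC: "Y \<in> cauchy_seqs A"
    unfolding cauchy_seqs_def mem_Collect_eq
  proof (intro conjI allI impI Y)
    fix e :: real assume "e > 0"
    then have e3: "e / 3 > 0" by simp
    obtain N1 where N1: "\<And>k. k \<ge> N1 \<Longrightarrow> 1 / Suc k < e / 3" using inv[OF e3] by blast
    obtain N2 where N2: "\<And>j k. j \<ge> N2 \<Longrightarrow> k \<ge> N2 \<Longrightarrow> nrm ?C (U j \<ominus>\<^bsub>?C\<^esub> U k) < e / 3"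
      using U e3 unfolding cauchy_seqs_def by blast
    have "nrm A (Y j \<ominus> Y k) < e" if "j \<ge> max N1 N2" "k \<ge> max N1 N2" for j k
    proof -
      have "nrm ?C (E j \<ominus>\<^bsub>?C\<^esub> E k) \<le> nrm ?C (U j \<ominus>\<^bsub>?C\<^esub> E j) + nrm ?C (U j \<ominus>\<^bsub>?C\<^esub> E k)"
        using C.semi.nrm_diff_triangle[of "E j" "U j" "E k"] C.semi.nrm_diff_commute[of "U j" "E j"] E UC
        by simp
      also have "nrm ?C (U j \<ominus>\<^bsub>?C\<^esub> E k) \<le> nrm ?C (U j \<ominus>\<^bsub>?C\<^esub> U k) + nrm ?C (U k \<ominus>\<^bsub>?C\<^esub> E k)"
        using E UC by (intro C.semi.nrm_diff_triangle)
      finally show ?thesis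
        using UE[of j] UE[of k] N1[of j] N1[of k] N2[of j k] that unfolding EE by linarith
    qed
    then show "\<exists>N. \<forall>j\<ge>N. \<forall>k\<ge>N. nrm A (Y j \<ominus> Y k) < e" by blast
  qed
  define V where "V = completion_class Y"
  have V: "V \<in> carrier ?C" using YC by (simp add: V_def completion_carrier)
  have "(\<lambda>k. nrm ?C (U k \<ominus>\<^bsub>?C\<^esub> V)) \<longlonglongrightarrow> 0"
  proof (rule LIMSEQ_I)
    fix e :: real assume "e > 0"
    then have e3: "e / 3 > 0" by simp
    obtain N1 where N1: "\<And>k. k \<ge> N1 \<Longrightarrow> 1 / Suc k < e / 3" using inv[OF e3] by blast
    obtain N2 where N2: "\<And>j k. j \<ge> N2 \<Longrightarrow> k \<ge> N2 \<Longrightarrow> nrm A (Y j \<ominus> Y k) < e / 3"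
      using YC e3 unfolding cauchy_seqs_def by blast
    have "nrm ?C (U k \<ominus>\<^bsub>?C\<^esub> V) < e" if "k \<ge> max N1 N2" for k
    proof -
      have "nrm ?C (E k \<ominus>\<^bsub>?C\<^esub> V) \<le> e / 3"
        unfolding E_def V_def using Y YC N2[of k] that
        by (intro nrm_diff[of _ _ N2]) (auto simp: less_imp_le cauchy_seqs_const)
      then show ?thesis
        using C.semi.nrm_diff_triangle[OF UC E V, of k k] UE[of k] N1[of k] that \<open>e > 0\<close> by linarith
    qed
    then show "\<exists>N. \<forall>k\<ge>N. norm (nrm ?C (U k \<ominus>\<^bsub>?C\<^esub> V) - 0) < e"
      using UC V by (auto intro!: exI[of _ "max N1 N2"] simp: C.nrm_nonneg)
  qed
  with V show ?thesis by (rule that)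
qed


section \<open>Powers of summable families\<close>

text \<open>Writing \<open>n = qm + r\<close> with \<open>1 \<le> r \<le> m\<close> bounds \<open>u n\<close> by \<open>(u m)\<^sup>q\<close> times a constant that
  depends on \<open>m\<close> only, and the \<open>n\<close>th root of that constant tends to \<open>1\<close>.\<close>

lemma submultiplicative_root_convergent:
  fixes u :: "nat \<Rightarrow> real"
  assumes nonneg: "\<And>n. 0 \<le> u n"
    and submult: "\<And>m n. \<lbrakk>m \<ge> 1; n \<ge> 1\<rbrakk> \<Longrightarrow> u (m + n) \<le> u m * u n"
  shows "convergent (\<lambda>n. root n (u n))"
proof -
  define L where "L = (INF n\<in>{1..}. root n (u n))"
  have bdd: "bdd_below ((\<lambda>n. root n (u n)) ` {1..})"
    using nonneg by (intro bdd_belowI2[of _ 0]) (simp add: real_root_ge_zero)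
  have L_le: "L \<le> root n (u n)" if "n \<ge> 1" for n
    unfolding L_def using bdd that by (intro cINF_lower) auto
  have L0: "0 \<le> L"
    unfolding L_def using nonneg by (intro cINF_greatest) (auto simp: real_root_ge_zero)
  have upper: "\<forall>\<^sub>F n in sequentially. root n (u n) < L + e" if e: "e > 0" for e
  proof -
    have "\<exists>m\<in>{1..}. root m (u m) < L + e / 2"
      using bdd e unfolding L_def by (intro cINF_less_iff[THEN iffD1]) auto
    then obtain m where m: "m \<ge> 1" "root m (u m) < L + e / 2" by auto
    define c where "c = L + e / 2"
    have c: "c > 0" using e L0 by (simp add: c_def)
    have um: "u m \<le> c ^ m"
    proof -
      have "u m = root m (u m) ^ m" using m nonneg by simp
      also have "\<dots> \<le> c ^ m"
        using m nonneg by (intro power_mono) (auto simp: c_def real_root_ge_zero)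
      finally show ?thesis .
    qed
    define K where "K = (\<Sum>r\<le>m. u r / c ^ r) + 1"
    have K: "u r \<le> K * c ^ r" if "r \<le> m" for r
    proof -
      have "u r / c ^ r \<le> (\<Sum>r\<le>m. u r / c ^ r)"
        using that nonneg c by (intro member_le_sum) auto
      then have "u r / c ^ r \<le> K" by (simp add: K_def)
      then show ?thesis using c by (simp add: pos_divide_le_eq)
    qed
    have K1: "K \<ge> 1" using nonneg c by (auto simp: K_def intro!: sum_nonneg)
    have bound: "u (q * m + r) \<le> K * c ^ (q * m + r)" if "1 \<le> r" "r \<le> m" for q r
    proof (induction q)
      case 0 then show ?case using K that by simp
    next
      case (Suc q)
      have "u (Suc q * m + r) \<le> u m * u (q * m + r)"
        using submult[of m "q * m + r"] that m by (simp add: algebra_simps)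
      also have "\<dots> \<le> c ^ m * (K * c ^ (q * m + r))"
        using um Suc nonneg c by (intro mult_mono) auto
      finally show ?case by (simp add: power_add algebra_simps)
    qed
    have bound': "u n \<le> K * c ^ n" if "n \<ge> 1" for n
    proof -
      \<comment> \<open>The shift by one keeps the remainder positive: \<open>submult\<close> speaks of positive exponents.\<close>
      define q r where "q = (n - 1) div m" and "r = (n - 1) mod m + 1"
      have "n = q * m + r" "1 \<le> r" "r \<le> m"
        using that m div_mult_mod_eq[of "n - 1" m] mod_less_divisor[of m "n - 1"]
        by (auto simp: q_def r_def simp del: mod_less_divisor div_mult_mod_eq)
      then show ?thesis using bound by simp
    qed
    have le: "root n (u n) \<le> root n K * c" if "n \<ge> 1" for n
    proof -
      have "root n (u n) \<le> root n (K * c ^ n)"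
        using bound'[OF that] that by (intro real_root_le_mono) auto
      also have "\<dots> = root n K * c"
        using that c by (simp add: real_root_mult real_root_power_cancel)
      finally show ?thesis .
    qed
    have "(\<lambda>n. root n K * c) \<longlonglongrightarrow> 1 * c"
      using K1 by (intro tendsto_mult LIMSEQ_root_const tendsto_const) auto
    then have "\<forall>\<^sub>F n in sequentially. root n K * c < L + e"
      using e by (intro order_tendstoD(2)) (auto simp: c_def)
    then show ?thesis
      using eventually_ge_at_top[of 1] by eventually_elim (rule order_le_less_trans[OF le])
  qed
  have "(\<lambda>n. root n (u n)) \<longlonglongrightarrow> L"
  proof (rule order_tendstoI)
    fix a assume a: "a < L"
    show "\<forall>\<^sub>F n in sequentially. a < root n (u n)"
      using eventually_ge_at_top[of 1] by (rule eventually_mono) (use L_le a in force)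
  next
    fix a assume "L < a"
    then show "\<forall>\<^sub>F n in sequentially. root n (u n) < a" using upper[of "a - L"] by simp
  qed
  then show ?thesis by (rule convergentI)
qed

abbreviation words :: "nat \<Rightarrow> 'i set \<Rightarrow> 'i list set" where
  "words n I \<equiv> {w. length w = n \<and> set w \<subseteq> I}"

lemma word_prod_Cons: "xs \<noteq> [] \<Longrightarrow> word_prod A (x # xs) = x \<otimes>\<^bsub>A\<^esub> word_prod A xs"
  by (cases xs) auto

context seminormed_algebra
begin

lemma word_prod_in: "set xs \<subseteq> carrier A \<Longrightarrow> word_prod A xs \<in> carrier A"
  by (induction xs rule: induct_list012) auto

lemma word_prod_map_in:
  assumes "a ` I \<subseteq> carrier A" "set w \<subseteq> I"
  shows "word_prod A (map a w) \<in> carrier A"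
  using assms by (intro word_prod_in) auto

lemma word_prod_append:
  "\<lbrakk>set xs \<subseteq> carrier A; set ys \<subseteq> carrier A; xs \<noteq> []; ys \<noteq> []\<rbrakk> \<Longrightarrow>
    word_prod A (xs @ ys) = word_prod A xs \<otimes> word_prod A ys"
proof (induction xs rule: induct_list012)
  case (2 x) then show ?case by (simp add: word_prod_Cons)
next
  case (3 x y zs)
  then show ?case by (simp add: mult_assoc word_prod_in)
qed simp

lemma word_prod_snoc:
  "\<lbrakk>set xs \<subseteq> carrier A; y \<in> carrier A; xs \<noteq> []\<rbrakk> \<Longrightarrow>
    word_prod A (xs @ [y]) = word_prod A xs \<otimes> y"
  using word_prod_append[of xs "[y]"] by simp

lemma word_prod_zero: "\<lbrakk>set xs \<subseteq> carrier A; \<zero> \<in> set xs\<rbrakk> \<Longrightarrow> word_prod A xs = \<zero>"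
  by (induction xs rule: induct_list012) (auto simp: word_prod_in)

lemma word_prod_smult:
  "(\<And>i. i \<in> set w \<Longrightarrow> a i \<in> carrier A) \<Longrightarrow>
    word_prod A (map (\<lambda>i. r i \<odot> a i) w) = prod_list (map r w) \<odot> word_prod A (map a w)"
proof (induction w rule: induct_list012)
  case (3 i j w)
  then have "word_prod A (map a (j # w)) \<in> carrier A" by (intro word_prod_in) auto
  with 3 show ?case by (simp add: smult_mult_left smult_mult_right smult_smult mult_ac)
qed auto

lemma word_prod_completion:
  assumes "Xs \<noteq> []" "set Xs \<subseteq> cauchy_seqs A"
  shows "(\<lambda>n. word_prod A (map (\<lambda>X. X n) Xs)) \<in> cauchy_seqs A \<and>
    word_prod (normed_completion A) (map completion_class Xs) =
    completion_class (\<lambda>n. word_prod A (map (\<lambda>X. X n) Xs))"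
  using assms
proof (induction Xs rule: induct_list012)
  case (3 X Y Zs)
  then have X: "X \<in> cauchy_seqs A"
    and IH: "(\<lambda>n. word_prod A (map (\<lambda>X. X n) (Y # Zs))) \<in> cauchy_seqs A"
      "word_prod (normed_completion A) (map completion_class (Y # Zs)) =
        completion_class (\<lambda>n. word_prod A (map (\<lambda>X. X n) (Y # Zs)))"
    by simp_all
  show ?case
    using cauchy_seqs_mult[OF X IH(1)] completion_mult[OF X IH(1)] IH(2) by simp
qed auto

lemma nrm_word_prod_le:
  "set xs \<subseteq> carrier A \<Longrightarrow> xs \<noteq> [] \<Longrightarrow> nrm A (word_prod A xs) \<le> prod_list (map (nrm A) xs)"
proof (induction xs rule: induct_list012)
  case (3 x y zs)
  have "nrm A (word_prod A (x # y # zs)) \<le> nrm A x * nrm A (word_prod A (y # zs))"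
    using 3 word_prod_in[of "y # zs"] by (auto intro: nrm_mult)
  also have "\<dots> \<le> nrm A x * prod_list (map (nrm A) (y # zs))"
    using 3 by (intro mult_left_mono) (auto intro: nrm_nonneg)
  finally show ?case by simp
qed auto

text \<open>A word of length \<open>m + n\<close> is cut after \<open>m\<close> letters.\<close>

lemma gen_power_submult:
  assumes carr: "snd M ` fst M \<subseteq> carrier A" and mn: "m \<ge> 1" "n \<ge> 1"
    and sm: "summable_gen A (gen_power A M m)" and sn: "summable_gen A (gen_power A M n)"
  shows "summable_gen A (gen_power A M (m + n))"
    and "norm1 A (gen_power A M (m + n)) \<le> norm1 A (gen_power A M m) * norm1 A (gen_power A M n)"
proof -
  define f where "f w = nrm A (word_prod A (map (snd M) w))" for w
  have in_carr: "word_prod A (map (snd M) w) \<in> carrier A" if "set w \<subseteq> fst M" for w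
    using carr that by (rule word_prod_map_in)
  have f0: "0 \<le> f w" if "set w \<subseteq> fst M" for w
    unfolding f_def using in_carr[OF that] by (rule nrm_nonneg)
  have norm1: "norm1 A (gen_power A M k) = infsum f (words k (fst M))" for k
    by (simp add: norm1_def gen_power_def f_def[abs_def])
  have summ: "summable_gen A (gen_power A M k) \<longleftrightarrow> f summable_on words k (fst M)" for k
    by (simp add: summable_gen_def gen_power_def f_def[abs_def])
  have fin: "sum f F \<le> infsum f (words m (fst M)) * infsum f (words n (fst M))"
    if F: "finite F" "F \<subseteq> words (m + n) (fst M)" for F
  proof -
    define U V where "U = take m ` F" and "V = drop m ` F"
    have U: "finite U" "U \<subseteq> words m (fst M)" and V: "finite V" "V \<subseteq> words n (fst M)"
      using F by (auto simp: U_def V_def dest!: set_mp[OF set_take_subset] set_mp[OF set_drop_subset])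
    have "sum f F \<le> (\<Sum>w\<in>F. f (take m w) * f (drop m w))"
    proof (rule sum_mono)
      fix w assume w: "w \<in> F"
      define x y where "x = take m w" and "y = drop m w"
      have xy: "w = x @ y" "x \<noteq> []" "y \<noteq> []" "set x \<subseteq> fst M" "set y \<subseteq> fst M"
        using w F(2) mn unfolding x_def y_def
        by (auto dest!: set_mp[OF set_take_subset] set_mp[OF set_drop_subset])
      have "f w = nrm A (word_prod A (map (snd M) x) \<otimes> word_prod A (map (snd M) y))"
        unfolding f_def xy(1) using xy carr by (subst word_prod_append[symmetric]) auto
      also have "\<dots> \<le> f x * f y"
        unfolding f_def using xy by (intro nrm_mult in_carr)
      finally show "f w \<le> f (take m w) * f (drop m w)" by (simp add: x_def y_def)
    qed
    also have "\<dots> = (\<Sum>p\<in>(\<lambda>w. (take m w, drop m w)) ` F. f (fst p) * f (snd p))"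
    proof -
      have "inj_on (\<lambda>w. (take m w, drop m w)) F"
        by (intro inj_onI) (metis append_take_drop_id prod.inject)
      then show ?thesis by (simp add: sum.reindex)
    qed
    also have "\<dots> \<le> (\<Sum>p\<in>U \<times> V. f (fst p) * f (snd p))"
      using U V f0 by (intro sum_mono2) (auto simp: U_def V_def intro!: mult_nonneg_nonneg)
    also have "\<dots> = sum f U * sum f V"
      by (simp add: sum_product sum.cartesian_product case_prod_beta)
    also have "\<dots> \<le> infsum f (words m (fst M)) * infsum f (words n (fst M))"
      using U V sm sn f0 unfolding summ
      by (intro mult_mono finite_sum_le_infsum sum_nonneg infsum_nonneg) auto
    finally show ?thesis .
  qed
  show s: "summable_gen A (gen_power A M (m + n))"
    unfolding summ using fin f0
    by (intro nonneg_bdd_above_summable_on bdd_aboveI2) auto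
  show "norm1 A (gen_power A M (m + n)) \<le> norm1 A (gen_power A M m) * norm1 A (gen_power A M n)"
    unfolding norm1 using s fin unfolding summ by (intro infsum_le_finite_sums) auto
qed

lemma gen_power_summable:
  assumes "snd M ` fst M \<subseteq> carrier A" "summable_gen A M"
  shows "summable_gen A (gen_power A M n)"
proof (induction n)
  case 0
  have "words 0 (fst M) = {[]}" by auto
  then show ?case by (simp add: summable_gen_def gen_power_def)
next
  case (Suc n)
  have 1: "summable_gen A (gen_power A M 1)"
    using assms(2) summable_on_reindex_bij_betw[OF gen_power_1(1)[of M A],
        of "\<lambda>w. nrm A (snd (gen_power A M 1) w)"]
    by (simp add: summable_gen_def gen_power_1[unfolded One_nat_def])
  show ?case
  proof (cases "n = 0")
    case False
    then show ?thesis using gen_power_submult(1)[OF assms(1) _ _ 1 Suc] by simp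
  qed (use 1 in simp)
qed

lemma norm1_gen_power_nonneg:
  "snd M ` fst M \<subseteq> carrier A \<Longrightarrow> 0 \<le> norm1 A (gen_power A M n)"
  by (auto simp: norm1_def gen_power_def intro!: infsum_nonneg nrm_nonneg word_prod_map_in[of _ "fst M"])

text \<open>A word through a zero member has product zero, so only the words in the nonzero members have
  to be summed.\<close>

lemma norm1_gen_power_le:
  assumes M: "snd M ` fst M \<subseteq> carrier A" "summable_gen A M"
    and bound: "\<And>W. \<lbrakk>finite W; W \<subseteq> words n {i \<in> fst M. snd M i \<noteq> \<zero>}\<rbrakk> \<Longrightarrow>
      (\<Sum>w\<in>W. nrm A (word_prod A (map (snd M) w))) \<le> K"
  shows "norm1 A (gen_power A M n) \<le> K"
proof -
  have "(\<Sum>w\<in>W. nrm A (word_prod A (map (snd M) w))) \<le> K"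
    if W: "finite W" "W \<subseteq> words n (fst M)" for W
  proof -
    let ?W = "W \<inter> words n {i \<in> fst M. snd M i \<noteq> \<zero>}"
    have "nrm A (word_prod A (map (snd M) w)) = 0" if w: "w \<in> W - ?W" for w
    proof -
      have wM: "length w = n" "set w \<subseteq> fst M" using w W by auto
      with w obtain i where "i \<in> set w" "snd M i = \<zero>" by auto
      then have "\<zero> \<in> set (map (snd M) w)" by (metis image_eqI set_map)
      moreover have "set (map (snd M) w) \<subseteq> carrier A" using wM M by auto
      ultimately show ?thesis by (simp only: word_prod_zero nrm_zero)
    qed
    then have "(\<Sum>w\<in>W. nrm A (word_prod A (map (snd M) w))) =
        (\<Sum>w\<in>?W. nrm A (word_prod A (map (snd M) w)))"
      using W by (intro sum.mono_neutral_right) auto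
    also have "\<dots> \<le> K" using W by (intro bound) auto
    finally show ?thesis .
  qed
  then show ?thesis
    using gen_power_summable[OF M, of n]
    by (simp add: norm1_def gen_power_def summable_gen_def infsum_le_finite_sums)
qed

lemma rho1_LIMSEQ:
  assumes "snd M ` fst M \<subseteq> carrier A" "summable_gen A M"
  shows "(\<lambda>n. root n (norm1 A (gen_power A M n))) \<longlonglongrightarrow> rho1 A M"
  unfolding rho1_def convergent_LIMSEQ_iff[symmetric]
proof (rule submultiplicative_root_convergent)
  show "0 \<le> norm1 A (gen_power A M n)" for n
    using assms(1) by (rule norm1_gen_power_nonneg)
  show "norm1 A (gen_power A M (m + n)) \<le> norm1 A (gen_power A M m) * norm1 A (gen_power A M n)"
    if "m \<ge> 1" "n \<ge> 1" for m n
    using assms that by (intro gen_power_submult(2) gen_power_summable)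
qed

lemma rho1_nonneg:
  assumes "snd M ` fst M \<subseteq> carrier A" "summable_gen A M"
  shows "0 \<le> rho1 A M"
  using norm1_gen_power_nonneg[OF assms(1)]
  by (intro LIMSEQ_le_const[OF rho1_LIMSEQ[OF assms]]) (auto intro!: exI[of _ 1] real_root_ge_zero)

text \<open>Together with the converse \<open>gen_power_bound\<close>, this replaces the limit of \<open>n\<close>th roots by
  bounds that can be compared between different families and algebras.\<close>

lemma rho1_eq_0I:
  assumes M: "snd M ` fst M \<subseteq> carrier A" "summable_gen A M"
    and bound: "\<And>t. t > 0 \<Longrightarrow> \<exists>K. \<forall>n\<ge>1. t ^ n * norm1 A (gen_power A M n) \<le> K"
  shows "rho1 A M = 0"
proof -
  have "rho1 A M \<le> 1 / t" if t: "t > 0" for t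
  proof -
    obtain K where K: "\<And>n. n \<ge> 1 \<Longrightarrow> t ^ n * norm1 A (gen_power A M n) \<le> K"
      using bound[OF t] by blast
    define K' where "K' = max K 1"
    have "root n (norm1 A (gen_power A M n)) \<le> root n K' * (1 / t)" if n: "n \<ge> 1" for n
    proof -
      have "norm1 A (gen_power A M n) \<le> K' * (1 / t) ^ n"
        using K[OF n] t by (simp add: K'_def field_simps le_max_iff_disj)
      then have "root n (norm1 A (gen_power A M n)) \<le> root n (K' * (1 / t) ^ n)"
        using n by (intro real_root_le_mono) auto
      also have "\<dots> = root n K' * (1 / t)"
        using n t by (simp only: real_root_mult) (simp add: real_root_power_cancel)
      finally show ?thesis .
    qed
    moreover have "(\<lambda>n. root n K' * (1 / t)) \<longlonglongrightarrow> 1 * (1 / t)"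
      by (intro tendsto_mult LIMSEQ_root_const tendsto_const) (simp add: K'_def)
    ultimately have "rho1 A M \<le> 1 * (1 / t)"
      by (intro LIMSEQ_le[OF rho1_LIMSEQ[OF M]]) blast+
    then show ?thesis by simp
  qed
  then have "rho1 A M \<le> e" if "e > 0" for e
  proof -
    have "rho1 A M \<le> 1 / (1 / e)"
      using that by (intro \<open>\<And>t. t > 0 \<Longrightarrow> rho1 A M \<le> 1 / t\<close>) simp
    then show ?thesis by simp
  qed
  then have "rho1 A M \<le> 0" by (rule field_le_epsilon[of _ 0, simplified])
  with rho1_nonneg[OF M] show ?thesis by simp
qed

lemma gen_power_bound:
  assumes M: "snd M ` fst M \<subseteq> carrier A" "summable_gen A M" and "rho1 A M = 0" and t: "t > 0"
  shows "\<exists>K. \<forall>n\<ge>1. t ^ n * norm1 A (gen_power A M n) \<le> K"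
proof -
  have "\<forall>\<^sub>F n in sequentially. root n (norm1 A (gen_power A M n)) < 1 / t"
    using rho1_LIMSEQ[OF M] t assms(3) by (intro order_tendstoD(2)) auto
  then obtain N where N: "\<And>n. n \<ge> N \<Longrightarrow> root n (norm1 A (gen_power A M n)) < 1 / t"
    by (auto simp: eventually_sequentially)
  let ?u = "\<lambda>n. t ^ n * norm1 A (gen_power A M n)"
  have nonneg: "0 \<le> ?u n" for n using t norm1_gen_power_nonneg[OF M(1)] by simp
  have "?u n \<le> (\<Sum>n<N. ?u n) + 1" if n: "n \<ge> 1" for n
  proof (cases "n < N")
    case True
    then have "?u n \<le> (\<Sum>n<N. ?u n)" using nonneg by (intro member_le_sum) auto
    then show ?thesis by simp
  next
    case False
    have "norm1 A (gen_power A M n) = root n (norm1 A (gen_power A M n)) ^ n"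
      using n norm1_gen_power_nonneg[OF M(1)] by simp
    also have "\<dots> \<le> (1 / t) ^ n"
      using False N[of n] norm1_gen_power_nonneg[OF M(1)] n
      by (intro power_mono) (auto simp: real_root_ge_zero)
    finally have "?u n \<le> 1" using t by (simp add: field_simps)
    moreover have "0 \<le> (\<Sum>n<N. ?u n)" using nonneg by (intro sum_nonneg) auto
    ultimately show ?thesis by simp
  qed
  then show ?thesis by blast
qed

end


section \<open>The algebraic tensor product\<close>

lemma lookup_scale_free [simp]:
  "Poly_Mapping.lookup (scale_free c f) k = c * Poly_Mapping.lookup f k"
  by (simp add: scale_free_def Poly_Mapping.map.rep_eq when_def)

lemma keys_scale_free: "Poly_Mapping.keys (scale_free c f) \<subseteq> Poly_Mapping.keys f"
  by (auto simp: in_keys_iff)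

lemma poly_mapping_sum_single:
  assumes "finite K" "Poly_Mapping.keys f \<subseteq> K"
  shows "f = (\<Sum>k\<in>K. scale_free (Poly_Mapping.lookup f k) (Poly_Mapping.single k 1))"
proof (rule poly_mapping_eqI)
  fix l
  have "Poly_Mapping.lookup (\<Sum>k\<in>K. scale_free (Poly_Mapping.lookup f k) (Poly_Mapping.single k 1)) l =
      (\<Sum>k\<in>K. if k = l then Poly_Mapping.lookup f k else 0)"
    by (auto simp: lookup_sum lookup_single when_def intro!: sum.cong)
  also have "\<dots> = Poly_Mapping.lookup f l"
    using assms by (auto simp: sum.delta in_keys_iff)
  finally show "Poly_Mapping.lookup f l =
      Poly_Mapping.lookup (\<Sum>k\<in>K. scale_free (Poly_Mapping.lookup f k) (Poly_Mapping.single k 1)) l"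
    by simp
qed

definition linear_extension ::
  "('k \<Rightarrow> ('l \<Rightarrow>\<^sub>0 complex)) \<Rightarrow> ('k \<Rightarrow>\<^sub>0 complex) \<Rightarrow> ('l \<Rightarrow>\<^sub>0 complex)" where
  "linear_extension h f =
     (\<Sum>k\<in>Poly_Mapping.keys f. scale_free (Poly_Mapping.lookup f k) (h k))"

lemma linear_extension_superset:
  assumes "finite K" "Poly_Mapping.keys f \<subseteq> K"
  shows "linear_extension h f = (\<Sum>k\<in>K. scale_free (Poly_Mapping.lookup f k) (h k))"
  unfolding linear_extension_def using assms
  by (intro sum.mono_neutral_left) (auto simp: in_keys_iff)

lemma linear_extension_add:
  "linear_extension h (f + g) = linear_extension h f + linear_extension h g"
proof -
  let ?K = "Poly_Mapping.keys f \<union> Poly_Mapping.keys g"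
  have "Poly_Mapping.keys (f + g) \<subseteq> ?K" by (rule Poly_Mapping.keys_add)
  then show ?thesis
    by (simp add: linear_extension_superset[of ?K] Poly_Mapping.lookup_add free_vs.scale_left_distrib
        sum.distrib)
qed

lemma linear_extension_scale:
  "linear_extension h (scale_free c f) = scale_free c (linear_extension h f)"
  using keys_scale_free[of c f]
  by (simp add: linear_extension_superset[of "Poly_Mapping.keys f"] free_vs.scale_sum_right)

lemma linear_extension_single: "linear_extension h (Poly_Mapping.single k 1) = h k"
  by (simp add: linear_extension_def)

lemma linear_extension_fun_add:
  "linear_extension (\<lambda>k. h k + h' k) f = linear_extension h f + linear_extension h' f"
  by (simp add: linear_extension_def free_vs.scale_right_distrib sum.distrib)

lemma linear_extension_fun_scale:
  "linear_extension (\<lambda>k. scale_free c (h k)) f = scale_free c (linear_extension h f)"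
  by (simp add: linear_extension_def free_vs.scale_sum_right mult.commute)

lemma free_mult_eq:
  "free_mult A B f g = linear_extension
     (\<lambda>p. linear_extension (\<lambda>q. basis_vec (fst p \<otimes>\<^bsub>A\<^esub> fst q) (snd p \<otimes>\<^bsub>B\<^esub> snd q)) g) f"
  by (simp add: free_mult_def linear_extension_def case_prod_beta free_vs.scale_sum_right)

lemma free_mult_add_left: "free_mult A B (f + f') g = free_mult A B f g + free_mult A B f' g"
  by (simp add: free_mult_eq linear_extension_add)

lemma free_mult_add_right: "free_mult A B f (g + g') = free_mult A B f g + free_mult A B f g'"
  by (simp add: free_mult_eq linear_extension_add linear_extension_fun_add)

lemma free_mult_scale_left: "free_mult A B (scale_free c f) g = scale_free c (free_mult A B f g)"
  by (simp add: free_mult_eq linear_extension_scale)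

lemma free_mult_scale_right: "free_mult A B f (scale_free c g) = scale_free c (free_mult A B f g)"
  by (simp add: free_mult_eq linear_extension_scale linear_extension_fun_scale)

lemma free_mult_basis:
  "free_mult A B (basis_vec a b) (basis_vec c d) = basis_vec (a \<otimes>\<^bsub>A\<^esub> c) (b \<otimes>\<^bsub>B\<^esub> d)"
  by (simp add: free_mult_eq linear_extension_single)

lemma free_mult_zero [simp]: "free_mult A B 0 g = 0" "free_mult A B f 0 = 0"
  using free_mult_scale_left[of A B 0 0 g] free_mult_scale_right[of A B f 0 0] by simp_all

lemma free_mult_diff_left: "free_mult A B (f - f') g = free_mult A B f g - free_mult A B f' g"
  using free_mult_add_left[of A B "f - f'" f' g] by (simp add: algebra_simps)

lemma free_mult_diff_right: "free_mult A B f (g - g') = free_mult A B f g - free_mult A B f g'"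
  using free_mult_add_right[of A B f "g - g'" g'] by (simp add: algebra_simps)

lemma free_space_zero [simp, intro]: "0 \<in> free_space A B"
  by (simp add: free_space_def)

lemma free_space_add [simp, intro]:
  "\<lbrakk>f \<in> free_space A B; g \<in> free_space A B\<rbrakk> \<Longrightarrow> f + g \<in> free_space A B"
  using Poly_Mapping.keys_add[of f g] by (auto simp: free_space_def)

lemma free_space_scale [simp, intro]:
  "f \<in> free_space A B \<Longrightarrow> scale_free c f \<in> free_space A B"
  using keys_scale_free[of c f] by (auto simp: free_space_def)

lemma free_space_diff [simp, intro]:
  "\<lbrakk>f \<in> free_space A B; g \<in> free_space A B\<rbrakk> \<Longrightarrow> f - g \<in> free_space A B"
proof -
  assume fg: "f \<in> free_space A B" "g \<in> free_space A B"
  have "f - g = f + scale_free (-1) g"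
    by (rule poly_mapping_eqI) (simp add: lookup_add lookup_minus)
  then show ?thesis using fg by (simp only: free_space_add free_space_scale)
qed

lemma free_space_basis [simp, intro]:
  "\<lbrakk>a \<in> carrier A; b \<in> carrier B\<rbrakk> \<Longrightarrow> basis_vec a b \<in> free_space A B"
  by (simp add: free_space_def)

lemma free_space_induct [consumes 1, case_names zero basis add scale]:
  assumes f: "f \<in> free_space A B"
    and "P 0"
    and basis: "\<And>a b. \<lbrakk>a \<in> carrier A; b \<in> carrier B\<rbrakk> \<Longrightarrow> P (basis_vec a b)"
    and add: "\<And>f g. \<lbrakk>f \<in> free_space A B; g \<in> free_space A B; P f; P g\<rbrakk> \<Longrightarrow> P (f + g)"
    and scale: "\<And>c f. \<lbrakk>f \<in> free_space A B; P f\<rbrakk> \<Longrightarrow> P (scale_free c f)"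
  shows "P f"
proof -
  have "finite K \<Longrightarrow> K \<subseteq> carrier A \<times> carrier B \<Longrightarrow>
      (\<Sum>k\<in>K. scale_free (c k) (Poly_Mapping.single k 1)) \<in> free_space A B \<and>
      P (\<Sum>k\<in>K. scale_free (c k) (Poly_Mapping.single k 1))" for K c
  proof (induction K rule: finite_induct)
    case (insert k K)
    obtain a b where "k = (a, b)" "a \<in> carrier A" "b \<in> carrier B" using insert by auto
    with insert show ?case by (auto intro!: add scale basis)
  qed (use \<open>P 0\<close> in auto)
  from this[of "Poly_Mapping.keys f" "Poly_Mapping.lookup f"] f show ?thesis
    by (simp add: poly_mapping_sum_single[symmetric] free_space_def)
qed

text \<open>A list \<open>[(a\<^sub>1, b\<^sub>1), \<dots>, (a\<^sub>n, b\<^sub>n)]\<close> stands for the tensor \<open>a\<^sub>1 \<otimes> b\<^sub>1 + \<dots> + a\<^sub>n \<otimes> b\<^sub>n\<close>.\<close>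

definition free_sum :: "('a \<times> 'b) list \<Rightarrow> ('a \<times> 'b \<Rightarrow>\<^sub>0 complex)" where
  "free_sum ts = (\<Sum>(a, b)\<leftarrow>ts. basis_vec a b)"

lemma free_sum_simps [simp]:
  "free_sum [] = 0" "free_sum ((a, b) # ts) = basis_vec a b + free_sum ts"
  "free_sum (ts @ ss) = free_sum ts + free_sum ss"
  by (simp_all add: free_sum_def)

locale tensor_pair = A: seminormed_algebra A + B: seminormed_algebra B
  for A :: "('a, 'm) normed_alg_scheme" and B :: "('b, 'n) normed_alg_scheme"
begin

abbreviation F where "F \<equiv> free_space A B"
abbreviation R where "R \<equiv> bilinear_relations A B"
abbreviation pairs where "pairs \<equiv> carrier A \<times> carrier B"

lemma relations_subspace:
  "0 \<in> R" "\<lbrakk>f \<in> R; g \<in> R\<rbrakk> \<Longrightarrow> f + g \<in> R" "\<lbrakk>f \<in> R; g \<in> R\<rbrakk> \<Longrightarrow> f - g \<in> R"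
  "f \<in> R \<Longrightarrow> scale_free c f \<in> R" "f \<in> R \<Longrightarrow> - f \<in> R"
  unfolding bilinear_relations_def
  by (auto intro: free_vs.span_zero free_vs.span_add free_vs.span_diff free_vs.span_scale
      free_vs.span_neg)

lemma relation_add_left: "\<lbrakk>a \<in> carrier A; a' \<in> carrier A; b \<in> carrier B\<rbrakk> \<Longrightarrow>
    basis_vec (a \<oplus>\<^bsub>A\<^esub> a') b - basis_vec a b - basis_vec a' b \<in> R"
  unfolding bilinear_relations_def by (intro free_vs.span_base) blast

lemma relation_add_right: "\<lbrakk>a \<in> carrier A; b \<in> carrier B; b' \<in> carrier B\<rbrakk> \<Longrightarrow>
    basis_vec a (b \<oplus>\<^bsub>B\<^esub> b') - basis_vec a b - basis_vec a b' \<in> R"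
  unfolding bilinear_relations_def by (intro free_vs.span_base) blast

lemma relation_smult_left: "\<lbrakk>a \<in> carrier A; b \<in> carrier B\<rbrakk> \<Longrightarrow>
    basis_vec (c \<odot>\<^bsub>A\<^esub> a) b - scale_free c (basis_vec a b) \<in> R"
  unfolding bilinear_relations_def by (intro free_vs.span_base) blast

lemma relation_smult_right: "\<lbrakk>a \<in> carrier A; b \<in> carrier B\<rbrakk> \<Longrightarrow>
    basis_vec a (c \<odot>\<^bsub>B\<^esub> b) - scale_free c (basis_vec a b) \<in> R"
  unfolding bilinear_relations_def by (intro free_vs.span_base) blast

lemma relations_induct [consumes 1, case_names zero add scale add_left add_right smult_left smult_right]:
  assumes "r \<in> R"
    and "P 0" "\<And>f g. \<lbrakk>P f; P g\<rbrakk> \<Longrightarrow> P (f + g)" "\<And>c f. P f \<Longrightarrow> P (scale_free c f)"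
    and "\<And>a a' b. \<lbrakk>a \<in> carrier A; a' \<in> carrier A; b \<in> carrier B\<rbrakk> \<Longrightarrow>
      P (basis_vec (a \<oplus>\<^bsub>A\<^esub> a') b - basis_vec a b - basis_vec a' b)"
    and "\<And>a b b'. \<lbrakk>a \<in> carrier A; b \<in> carrier B; b' \<in> carrier B\<rbrakk> \<Longrightarrow>
      P (basis_vec a (b \<oplus>\<^bsub>B\<^esub> b') - basis_vec a b - basis_vec a b')"
    and "\<And>c a b. \<lbrakk>a \<in> carrier A; b \<in> carrier B\<rbrakk> \<Longrightarrow>
      P (basis_vec (c \<odot>\<^bsub>A\<^esub> a) b - scale_free c (basis_vec a b))"
    and "\<And>c a b. \<lbrakk>a \<in> carrier A; b \<in> carrier B\<rbrakk> \<Longrightarrow>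
      P (basis_vec a (c \<odot>\<^bsub>B\<^esub> b) - scale_free c (basis_vec a b))"
  shows "P r"
  using assms(1) unfolding bilinear_relations_def
proof (induction rule: free_vs.span_induct)
  case base
  show ?case using assms(2-4) by (auto simp: free_vs.subspace_def)
next
  case (step x)
  then show ?case
    unfolding Un_iff mem_Collect_eq by (elim disjE exE conjE) (simp_all add: assms(5-8))
qed

lemma free_mult_in: "\<lbrakk>f \<in> F; g \<in> F\<rbrakk> \<Longrightarrow> free_mult A B f g \<in> F"
proof (induction f rule: free_space_induct)
  case (basis a b)
  note ab = basis
  show ?case using basis(3)
    by (induction g rule: free_space_induct)
      (use ab in \<open>auto simp: free_mult_basis free_mult_add_right free_mult_scale_right\<close>)
qed (auto simp: free_mult_add_left free_mult_scale_left)

text \<open>The bilinear relations form an ideal, so the multiplication passes to the quotient.\<close>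

lemma free_mult_relation_right:
  assumes "f \<in> F" "r \<in> R"
  shows "free_mult A B f r \<in> R"
  using assms(1)
proof (induction f rule: free_space_induct)
  case (basis a b)
  show ?case using assms(2)
    by (induction r rule: relations_induct)
      (use basis in \<open>auto simp: free_mult_basis free_mult_add_right free_mult_scale_right
        free_mult_diff_right relations_subspace A.distr_right B.distr_right A.smult_mult_right
        B.smult_mult_right relation_add_left relation_add_right relation_smult_left
        relation_smult_right\<close>)
qed (auto simp: free_mult_add_left free_mult_scale_left relations_subspace)

lemma free_mult_relation_left:
  assumes "f \<in> F" "r \<in> R"
  shows "free_mult A B r f \<in> R"
  using assms(1)
proof (induction f rule: free_space_induct)
  case (basis a b)
  show ?case using assms(2)
    by (induction r rule: relations_induct)
      (use basis in \<open>auto simp: free_mult_basis free_mult_add_left free_mult_scale_left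
        free_mult_diff_left relations_subspace A.distr_left B.distr_left A.smult_mult_left
        B.smult_mult_left relation_add_left relation_add_right relation_smult_left
        relation_smult_right\<close>)
qed (auto simp: free_mult_add_right free_mult_scale_right relations_subspace)

lemma free_mult_assoc:
  assumes "f \<in> F" "g \<in> F" "h \<in> F"
  shows "free_mult A B (free_mult A B f g) h = free_mult A B f (free_mult A B g h)"
  using assms(1)
proof (induction f rule: free_space_induct)
  case (basis a b)
  note ab = basis
  show ?case using assms(2)
  proof (induction g rule: free_space_induct)
    case (basis c d)
    show ?case using assms(3)
      by (induction h rule: free_space_induct)
        (use ab basis in \<open>auto simp: free_mult_basis free_mult_add_right free_mult_scale_right
          A.mult_assoc B.mult_assoc\<close>)
  qed (auto simp: free_mult_add_left free_mult_scale_left free_mult_add_right free_mult_scale_right)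
qed (auto simp: free_mult_add_left free_mult_scale_left)

definition tensor_class :: "('a \<times> 'b \<Rightarrow>\<^sub>0 complex) \<Rightarrow> ('a \<times> 'b \<Rightarrow>\<^sub>0 complex) set" where
  "tensor_class f = tensor_rel A B `` {f}"

abbreviation D where "D \<equiv> algebraic_tensor A B"

lemma equiv_tensor_rel: "equiv F (tensor_rel A B)"
proof (rule equivI)
  show "tensor_rel A B \<subseteq> F \<times> F" by (auto simp: tensor_rel_def)
  show "refl_on F (tensor_rel A B)"
    by (auto simp: refl_on_def tensor_rel_def relations_subspace)
  show "sym (tensor_rel A B)"
    using relations_subspace(5) by (force simp: sym_def tensor_rel_def)
  show "trans (tensor_rel A B)"
    using relations_subspace(2) by (force simp: trans_def tensor_rel_def)
qed

lemma tensor_class_eq_iff: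
  "\<lbrakk>f \<in> F; g \<in> F\<rbrakk> \<Longrightarrow> tensor_class f = tensor_class g \<longleftrightarrow> f - g \<in> R"
  unfolding tensor_class_def using eq_equiv_class_iff[OF equiv_tensor_rel]
  by (auto simp: tensor_rel_def)

lemma tensor_carrier: "carrier D = tensor_class ` F"
  by (auto simp: algebraic_tensor_def tensor_class_def quotient_def)

lemma tensor_class_in [simp, intro]: "f \<in> F \<Longrightarrow> tensor_class f \<in> carrier D"
  by (simp add: tensor_carrier)

lemma tensor_zero: "\<zero>\<^bsub>D\<^esub> = tensor_class 0"
  by (simp add: algebraic_tensor_def tensor_class_def)

lemma tensor_add:
  assumes "f \<in> F" "g \<in> F"
  shows "tensor_class f \<oplus>\<^bsub>D\<^esub> tensor_class g = tensor_class (f + g)"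
proof -
  have "(f + g, f' + g') \<in> tensor_rel A B"
    if "(f, f') \<in> tensor_rel A B" "(g, g') \<in> tensor_rel A B" for f' g'
    using that relations_subspace(2)[of "f - f'" "g - g'"]
    by (simp add: tensor_rel_def add_diff_add)
  from UN_equiv_class_op2[where p = "(+)", OF equiv_tensor_rel assms this] show ?thesis
    by (simp add: algebraic_tensor_def tensor_class_def)
qed

lemma tensor_smult:
  assumes "f \<in> F"
  shows "c \<odot>\<^bsub>D\<^esub> tensor_class f = tensor_class (scale_free c f)"
proof -
  have "(scale_free c f, scale_free c f') \<in> tensor_rel A B" if "(f, f') \<in> tensor_rel A B" for f'
    using that relations_subspace(4)[of "f - f'" c]
    by (simp add: tensor_rel_def free_vs.scale_right_diff_distrib)
  from UN_equiv_class_op[where p = "scale_free c", OF equiv_tensor_rel assms this] show ?thesis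
    by (simp add: algebraic_tensor_def tensor_class_def)
qed

lemma tensor_mult:
  assumes "f \<in> F" "g \<in> F"
  shows "tensor_class f \<otimes>\<^bsub>D\<^esub> tensor_class g = tensor_class (free_mult A B f g)"
proof -
  have "(free_mult A B f g, free_mult A B f' g') \<in> tensor_rel A B"
    if "(f, f') \<in> tensor_rel A B" "(g, g') \<in> tensor_rel A B" for f' g'
  proof -
    have "free_mult A B f g - free_mult A B f' g' =
        free_mult A B (f - f') g + free_mult A B f' (g - g')"
      by (simp add: free_mult_diff_left free_mult_diff_right)
    also have "\<dots> \<in> R"
      using that by (intro relations_subspace(2) free_mult_relation_left free_mult_relation_right)
        (auto simp: tensor_rel_def)
    finally show ?thesis using that by (simp add: tensor_rel_def free_mult_in)
  qed
  from UN_equiv_class_op2[where p = "free_mult A B", OF equiv_tensor_rel assms this] show ?thesis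
    by (simp add: algebraic_tensor_def tensor_class_def)
qed

lemma complex_algebra_tensor: "complex_algebra D"
proof (rule complex_algebra_image)
  define P :: "(complex, 'a \<times> 'b \<Rightarrow>\<^sub>0 complex) module" where
    "P = \<lparr>carrier = F, monoid.mult = free_mult A B, one = undefined,
      ring.zero = 0, add = (+), module.smult = scale_free\<rparr>"
  show "complex_algebra P"
    by (rule complex_algebraI)
      (auto simp: P_def free_mult_in free_mult_assoc free_mult_add_left free_mult_add_right
        free_mult_scale_left free_mult_scale_right free_vs.scale_left_distrib
        free_vs.scale_right_distrib ac_simps)
  show "carrier D = tensor_class ` carrier P"
    by (simp add: tensor_carrier P_def)
qed (simp_all add: tensor_zero tensor_add tensor_smult tensor_mult)

abbreviation weight :: "('a \<times> 'b) list \<Rightarrow> real" where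
  "weight ts \<equiv> (\<Sum>(a, b)\<leftarrow>ts. nrm A a * nrm B b)"

lemma free_sum_in: "set ts \<subseteq> pairs \<Longrightarrow> free_sum ts \<in> F"
  by (induction ts) auto

lemma weight_nonneg: "set ts \<subseteq> pairs \<Longrightarrow> 0 \<le> weight ts"
  by (induction ts) (auto simp: A.nrm_nonneg B.nrm_nonneg)

abbreviation tensor_sum :: "('a \<times> 'b) list \<Rightarrow> ('a \<times> 'b \<Rightarrow>\<^sub>0 complex) set" where
  "tensor_sum ts \<equiv> tensor_class (free_sum ts)"

lemma tensor_sum_in: "set ts \<subseteq> pairs \<Longrightarrow> tensor_sum ts \<in> carrier D"
  by (intro tensor_class_in free_sum_in)

lemma tensor_sum_append:
  "\<lbrakk>set ts \<subseteq> pairs; set ss \<subseteq> pairs\<rbrakk> \<Longrightarrow> tensor_sum (ts @ ss) = tensor_sum ts \<oplus>\<^bsub>D\<^esub> tensor_sum ss"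
  by (simp add: tensor_add free_sum_in)

lemma tensor_sum_smult:
  assumes "set ts \<subseteq> pairs"
  shows "tensor_sum (map (\<lambda>(a, b). (c \<odot>\<^bsub>A\<^esub> a, b)) ts) = c \<odot>\<^bsub>D\<^esub> tensor_sum ts"
proof -
  let ?m = "map (\<lambda>(a, b). (c \<odot>\<^bsub>A\<^esub> a, b))"
  have m: "set (?m ts) \<subseteq> pairs" using assms by auto
  have "free_sum (?m ts) - scale_free c (free_sum ts) \<in> R" using assms
  proof (induction ts)
    case (Cons p ts)
    obtain a b where p: "p = (a, b)" by (cases p)
    have "free_sum (?m (p # ts)) - scale_free c (free_sum (p # ts)) =
      (basis_vec (c \<odot>\<^bsub>A\<^esub> a) b - scale_free c (basis_vec a b)) +
      (free_sum (?m ts) - scale_free c (free_sum ts))"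
      by (simp add: p free_vs.scale_right_distrib)
    also have "\<dots> \<in> R"
      using Cons p by (intro relations_subspace(2) relation_smult_left) auto
    finally show ?case .
  qed (simp add: relations_subspace)
  then show ?thesis
    using assms m by (simp only: tensor_smult free_sum_in tensor_class_eq_iff free_space_scale)
qed

lemma weight_smult:
  "set ts \<subseteq> pairs \<Longrightarrow> weight (map (\<lambda>(a, b). (c \<odot>\<^bsub>A\<^esub> a, b)) ts) = cmod c * weight ts"
  by (induction ts) (auto simp: A.nrm_smult algebra_simps)

definition list_mult :: "('a \<times> 'b) list \<Rightarrow> ('a \<times> 'b) list \<Rightarrow> ('a \<times> 'b) list" where
  "list_mult ts ss =
     concat (map (\<lambda>(a, b). map (\<lambda>(c, d). (a \<otimes>\<^bsub>A\<^esub> c, b \<otimes>\<^bsub>B\<^esub> d)) ss) ts)"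

lemma list_mult_in: "\<lbrakk>set ts \<subseteq> pairs; set ss \<subseteq> pairs\<rbrakk> \<Longrightarrow> set (list_mult ts ss) \<subseteq> pairs"
  by (auto simp: list_mult_def)

lemma tensor_sum_mult:
  assumes "set ts \<subseteq> pairs" "set ss \<subseteq> pairs"
  shows "tensor_sum (list_mult ts ss) = tensor_sum ts \<otimes>\<^bsub>D\<^esub> tensor_sum ss"
proof -
  have 1: "free_sum (map (\<lambda>(c, d). (a \<otimes>\<^bsub>A\<^esub> c, b \<otimes>\<^bsub>B\<^esub> d)) ss) =
      free_mult A B (basis_vec a b) (free_sum ss)" for a b
    by (induction ss) (auto simp: free_mult_basis free_mult_add_right)
  have "free_sum (list_mult ts ss) = free_mult A B (free_sum ts) (free_sum ss)"
    by (induction ts) (auto simp: list_mult_def 1 free_mult_add_left)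
  then show ?thesis using assms by (simp add: tensor_mult free_sum_in)
qed

lemma weight_mult:
  assumes "set ts \<subseteq> pairs" "set ss \<subseteq> pairs"
  shows "weight (list_mult ts ss) \<le> weight ts * weight ss"
proof -
  have 1: "weight (map (\<lambda>(c, d). (a \<otimes>\<^bsub>A\<^esub> c, b \<otimes>\<^bsub>B\<^esub> d)) ss) \<le> nrm A a * nrm B b * weight ss"
    if "a \<in> carrier A" "b \<in> carrier B" for a b
    using assms(2)
  proof (induction ss)
    case (Cons p ss)
    obtain c d where p: "p = (c, d)" by (cases p)
    have "nrm A (a \<otimes>\<^bsub>A\<^esub> c) * nrm B (b \<otimes>\<^bsub>B\<^esub> d) \<le>
        (nrm A a * nrm A c) * (nrm B b * nrm B d)"
      using that Cons.prems p
      by (intro mult_mono A.nrm_mult B.nrm_mult mult_nonneg_nonneg A.nrm_nonneg B.nrm_nonneg) auto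
    with Cons p show ?case by (simp add: algebra_simps)
  qed simp
  show ?thesis using assms(1)
  proof (induction ts)
    case (Cons p ts)
    obtain a b where p: "p = (a, b)" by (cases p)
    show ?case using Cons 1[of a b] p by (simp add: list_mult_def algebra_simps)
  qed (simp add: list_mult_def)
qed

lemma tensor_sum_exists:
  assumes "U \<in> carrier D"
  shows "\<exists>ts. set ts \<subseteq> pairs \<and> U = tensor_sum ts"
proof -
  obtain f where f: "f \<in> F" "U = tensor_class f" using assms by (auto simp: tensor_carrier)
  have "\<exists>ts. set ts \<subseteq> pairs \<and> tensor_class f = tensor_sum ts" using f(1)
  proof (induction f rule: free_space_induct)
    case zero
    show ?case by (rule exI[of _ "[]"]) simp
  next
    case (basis a b)
    then show ?case by (intro exI[of _ "[(a, b)]"]) simp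
  next
    case (add f g)
    then obtain ts ss where "set ts \<subseteq> pairs" "tensor_class f = tensor_sum ts"
      "set ss \<subseteq> pairs" "tensor_class g = tensor_sum ss" by blast
    then show ?case using add(1,2) tensor_sum_append[of ts ss]
      by (intro exI[of _ "ts @ ss"]) (simp add: tensor_add[symmetric])
  next
    case (scale c f)
    then obtain ts where "set ts \<subseteq> pairs" "tensor_class f = tensor_sum ts" by blast
    then show ?case using scale(1) tensor_sum_smult[of ts c]
      by (intro exI[of _ "map (\<lambda>(a, b). (c \<odot>\<^bsub>A\<^esub> a, b)) ts"]) (auto simp: tensor_smult[symmetric])
  qed
  with f show ?thesis by simp
qed

lemma nrm_tensor:
  "nrm D U = Inf {weight ts | ts. set ts \<subseteq> pairs \<and> U = tensor_sum ts}"
  by (simp add: algebraic_tensor_def projective_norm_def tensor_class_def free_sum_def)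

lemma nrm_tensor_le: "set ts \<subseteq> pairs \<Longrightarrow> nrm D (tensor_sum ts) \<le> weight ts"
  unfolding nrm_tensor using weight_nonneg
  by (intro cInf_lower bdd_belowI[of _ 0]) auto

lemma nrm_tensor_approx:
  assumes "U \<in> carrier D" "e > 0"
  obtains ts where "set ts \<subseteq> pairs" "U = tensor_sum ts" "weight ts < nrm D U + e"
proof -
  have "\<exists>w\<in>{weight ts | ts. set ts \<subseteq> pairs \<and> U = tensor_sum ts}. w < nrm D U + e"
    using tensor_sum_exists[OF assms(1)] assms(2) weight_nonneg unfolding nrm_tensor
    by (intro cInf_less_iff[THEN iffD1] bdd_belowI[of _ 0]) auto
  then show ?thesis using that by auto
qed

lemma nrm_tensor_nonneg: "U \<in> carrier D \<Longrightarrow> 0 \<le> nrm D U"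
  unfolding nrm_tensor using tensor_sum_exists[of U] weight_nonneg
  by (intro cInf_greatest) auto

lemma seminormed_algebra_tensor: "seminormed_algebra D"
proof (intro seminormed_algebra.intro complex_algebra_tensor seminormed_algebra_axioms.intro)
  interpret D: complex_algebra D by (rule complex_algebra_tensor)
  show "0 \<le> nrm D U" if "U \<in> carrier D" for U
    using that by (rule nrm_tensor_nonneg)
  show "nrm D (U \<oplus>\<^bsub>D\<^esub> V) \<le> nrm D U + nrm D V" if U: "U \<in> carrier D" and V: "V \<in> carrier D" for U V
  proof (rule field_le_epsilon)
    fix e :: real assume "e > 0"
    then have e: "e / 2 > 0" by simp
    obtain ts where ts: "set ts \<subseteq> pairs" "U = tensor_sum ts" "weight ts < nrm D U + e / 2"
      by (rule nrm_tensor_approx[OF U e])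
    obtain ss where ss: "set ss \<subseteq> pairs" "V = tensor_sum ss" "weight ss < nrm D V + e / 2"
      by (rule nrm_tensor_approx[OF V e])
    have "nrm D (U \<oplus>\<^bsub>D\<^esub> V) \<le> weight (ts @ ss)"
      using ts(1,2) ss(1,2) nrm_tensor_le[of "ts @ ss"] by (simp only: tensor_sum_append) simp
    then show "nrm D (U \<oplus>\<^bsub>D\<^esub> V) \<le> nrm D U + nrm D V + e" using ts(3) ss(3) by simp
  qed
  have smult_le: "nrm D (c \<odot>\<^bsub>D\<^esub> U) \<le> cmod c * nrm D U" if U: "U \<in> carrier D" for c U
  proof (rule field_le_epsilon)
    fix e :: real assume e: "e > 0"
    define d where "d = e / (cmod c + 1)"
    have c1: "cmod c + 1 > 0" by (simp add: add_nonneg_pos)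
    have d: "d > 0" "cmod c * d \<le> e"
      using e c1 by (auto simp: d_def pos_divide_le_eq algebra_simps)
    obtain ts where ts: "set ts \<subseteq> pairs" "U = tensor_sum ts" "weight ts < nrm D U + d"
      by (rule nrm_tensor_approx[OF U d(1)])
    have "set (map (\<lambda>(a, b). (c \<odot>\<^bsub>A\<^esub> a, b)) ts) \<subseteq> pairs" using ts by auto
    from nrm_tensor_le[OF this] have "nrm D (c \<odot>\<^bsub>D\<^esub> U) \<le> cmod c * weight ts"
      using ts(1,2) by (simp only: tensor_sum_smult weight_smult)
    also have "\<dots> \<le> cmod c * (nrm D U + d)" using ts(3) by (intro mult_left_mono) auto
    also have "\<dots> \<le> cmod c * nrm D U + e" using d(2) by (simp add: algebra_simps)
    finally show "nrm D (c \<odot>\<^bsub>D\<^esub> U) \<le> cmod c * nrm D U + e" .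
  qed
  show "nrm D (c \<odot>\<^bsub>D\<^esub> U) = cmod c * nrm D U" if U: "U \<in> carrier D" for c U
  proof (cases "c = 0")
    case True
    then show ?thesis using smult_le[OF U, of 0] nrm_tensor_nonneg[of "0 \<odot>\<^bsub>D\<^esub> U"] U by simp
  next
    case False
    have "nrm D U = nrm D (inverse c \<odot>\<^bsub>D\<^esub> (c \<odot>\<^bsub>D\<^esub> U))"
      using U False by (simp add: D.smult_smult)
    also have "\<dots> \<le> cmod (inverse c) * nrm D (c \<odot>\<^bsub>D\<^esub> U)"
      using U by (intro smult_le) auto
    finally have "cmod c * nrm D U \<le> nrm D (c \<odot>\<^bsub>D\<^esub> U)"
      using False by (simp add: norm_inverse norm_divide field_simps)
    with smult_le[OF U, of c] show ?thesis by simp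
  qed
  show "nrm D (U \<otimes>\<^bsub>D\<^esub> V) \<le> nrm D U * nrm D V" if U: "U \<in> carrier D" and V: "V \<in> carrier D" for U V
  proof -
    have "nrm D (U \<otimes>\<^bsub>D\<^esub> V) \<le> (nrm D U + e) * (nrm D V + e)" if e: "e > 0" for e
    proof -
      obtain ts where ts: "set ts \<subseteq> pairs" "U = tensor_sum ts" "weight ts < nrm D U + e"
        by (rule nrm_tensor_approx[OF U e])
      obtain ss where ss: "set ss \<subseteq> pairs" "V = tensor_sum ss" "weight ss < nrm D V + e"
        by (rule nrm_tensor_approx[OF V e])
      have "nrm D (U \<otimes>\<^bsub>D\<^esub> V) \<le> weight (list_mult ts ss)"
        using nrm_tensor_le[OF list_mult_in[OF ts(1) ss(1)]] tensor_sum_mult[OF ts(1) ss(1)]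
        by (simp add: ts(2) ss(2))
      also have "\<dots> \<le> weight ts * weight ss" using weight_mult ts(1) ss(1) .
      also have "\<dots> \<le> (nrm D U + e) * (nrm D V + e)"
        using ts ss weight_nonneg nrm_tensor_nonneg[OF U] e by (intro mult_mono) auto
      finally show ?thesis .
    qed
    moreover have "((\<lambda>e. (nrm D U + e) * (nrm D V + e)) \<longlongrightarrow> (nrm D U + 0) * (nrm D V + 0)) (at_right 0)"
      by (intro tendsto_intros)
    ultimately have "nrm D (U \<otimes>\<^bsub>D\<^esub> V) \<le> (nrm D U + 0) * (nrm D V + 0)"
      by (intro tendsto_lowerbound[of _ _ "at_right 0"])
        (auto intro!: eventually_at_right_less[THEN eventually_mono])
    then show ?thesis by simp
  qed
qed

end


section \<open>Summable families in 1-quasinilpotent algebras\<close>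

context normed_algebra
begin

text \<open>A summable family may repeat elements, which a subset cannot. Its nonzero members are
  countably many, and multiplying them by numbers from \<open>[1, 2]\<close> makes them distinct: when the
  numbers are chosen one after the other, only finitely many values are excluded each time.
  The products of the new elements are at least as large as those of the old ones.\<close>

lemma rho1_family_eq_0:
  assumes oq: "one_quasinilpotent A" and M: "snd M ` fst M \<subseteq> carrier A" "summable_gen A M"
  shows "rho1 A M = 0"
proof -
  define I a J where "I = fst M" and "a = snd M" and "J = {i \<in> I. a i \<noteq> \<zero>}"
  have a: "a i \<in> carrier A" if "i \<in> I" for i using that M by (auto simp: I_def a_def)
  have JI: "J \<subseteq> I" by (auto simp: J_def)
  have summ: "(\<lambda>i. nrm A (a i)) summable_on I"
    using M(2) by (simp add: summable_gen_def I_def a_def)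
  have "J = {i \<in> I. nrm A (a i) \<noteq> 0}" using a by (auto simp: J_def nrm_eq_0_iff)
  then have "countable J" using summable_countable_real[OF summ] by simp
  define g where "g = to_nat_on J"
  have g: "inj_on g J" using \<open>countable J\<close> unfolding g_def by (rule inj_on_to_nat_on)
  define b where "b n = (if n \<in> g ` J then a (inv_into J g n) else \<zero>)" for n
  have b: "b n \<in> carrier A" for n
    using a JI inv_into_into[of n g J] by (auto simp: b_def)
  have bg: "b (g i) = a i" if "i \<in> J" for i using that g by (simp add: b_def)
  have "\<exists>r. \<forall>n. (1 \<le> r n \<and> r n \<le> (2::real)) \<and>
    (b n \<noteq> \<zero> \<longrightarrow> (\<forall>j<n. of_real (r n) \<odot> b n \<noteq> of_real (r j) \<odot> b j))"
  proof (rule dependent_wellorder_choice[where P = "\<lambda>r n x. (1 \<le> x \<and> x \<le> (2::real)) \<and>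
      (b n \<noteq> \<zero> \<longrightarrow> (\<forall>j<n. of_real x \<odot> b n \<noteq> of_real (r j) \<odot> b j))"])
    fix n and r :: "nat \<Rightarrow> real"
    show "\<exists>x. (1 \<le> x \<and> x \<le> 2) \<and> (b n \<noteq> \<zero> \<longrightarrow> (\<forall>j<n. of_real x \<odot> b n \<noteq> of_real (r j) \<odot> b j))"
    proof (cases "b n = \<zero>")
      case False
      have fin: "finite {x::real. of_real x \<odot> b n = y}" for y
      proof -
        have "x = x'" if "of_real x \<odot> b n = y" "of_real x' \<odot> b n = y" for x x' :: real
        proof -
          have "of_real (x - x') \<odot> b n = of_real x \<odot> b n \<oplus> (-1) \<odot> (of_real x' \<odot> b n)"
            using smult_add_left[OF b, of "of_real x" "- of_real x'" n] by (simp add: smult_smult b)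
          also have "\<dots> = y \<ominus> y"
            using that b[of n] by (auto simp: M.minus_eq minus_eq_smult)
          also have "\<dots> = \<zero>" using that b by (intro diff_self) auto
          finally have "cmod (of_real (x - x')) * nrm A (b n) = 0"
            using nrm_smult[OF b, of "of_real (x - x')" n] by simp
          then show ?thesis using False b nrm_eq_0_iff[of "b n"] by simp
        qed
        then have "{x. of_real x \<odot> b n = y} \<subseteq> {SOME x. of_real x \<odot> b n = y}"
          by (auto intro: someI2)
        then show ?thesis by (rule finite_subset) simp
      qed
      have "finite (\<Union>j<n. {x::real. of_real x \<odot> b n = of_real (r j) \<odot> b j})"
        using fin by blast
      moreover have "infinite {1..2::real}" by simp
      ultimately have "\<exists>x\<in>{1..2}. x \<notin> (\<Union>j<n. {x::real. of_real x \<odot> b n = of_real (r j) \<odot> b j})"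
        by (meson finite_subset subsetI)
      then show ?thesis by auto
    qed (auto intro!: exI[of _ 1])
  qed auto
  then obtain r where r: "\<And>n. 1 \<le> r n" "\<And>n. r n \<le> 2"
    and dist: "\<And>n j. b n \<noteq> \<zero> \<Longrightarrow> j < n \<Longrightarrow> of_real (r n) \<odot> b n \<noteq> of_real (r j) \<odot> b j"
    by metis
  define s where "s i = of_real (r (g i)) \<odot> a i" for i
  have inj: "inj_on s J"
  proof (rule inj_onI)
    fix i j assume ij: "i \<in> J" "j \<in> J" "s i = s j"
    have nz: "b (g i) \<noteq> \<zero>" "b (g j) \<noteq> \<zero>" using ij bg by (auto simp: J_def)
    have "of_real (r (g i)) \<odot> b (g i) = of_real (r (g j)) \<odot> b (g j)"
      using ij bg by (simp add: s_def)
    then have "g i = g j" using dist[OF nz(1), of "g j"] dist[OF nz(2), of "g i"]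
      by (metis linorder_neqE_nat)
    then show "i = j" using g ij by (simp add: inj_on_eq_iff)
  qed
  have s: "s i \<in> carrier A" if "i \<in> I" for i using a that by (simp add: s_def)
  have sle: "nrm A (s i) \<le> 2 * nrm A (a i)" if "i \<in> I" for i
    using r[of "g i"] a[OF that] by (simp add: s_def nrm_smult mult_right_mono nrm_nonneg)
  have SA: "snd (gen_of_set (s ` J)) ` fst (gen_of_set (s ` J)) \<subseteq> carrier A"
    using s JI by (auto simp: gen_of_set_def)
  have "(\<lambda>i. nrm A (s i)) summable_on J"
  proof (rule summable_on_comparison_test)
    show "(\<lambda>i. 2 * nrm A (a i)) summable_on J"
      using summable_on_subset[OF summ JI] by (intro summable_on_cmult_right)
  qed (use s sle JI in \<open>auto intro: nrm_nonneg\<close>)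
  then have Ss: "summable_gen A (gen_of_set (s ` J))"
    unfolding summable_gen_def gen_of_set_def by (simp add: summable_on_reindex[OF inj] o_def)
  have rho0: "rho1 A (gen_of_set (s ` J)) = 0"
    using oq SA Ss unfolding one_quasinilpotent_def by (simp add: gen_of_set_def)
  have le: "norm1 A (gen_power A M n) \<le> norm1 A (gen_power A (gen_of_set (s ` J)) n)" (is "_ \<le> ?N") for n
  proof -
    have "(\<Sum>w\<in>W. nrm A (word_prod A (map a w))) \<le> ?N" if W: "finite W" "W \<subseteq> words n J" for W
    proof -
      have "(\<Sum>w\<in>W. nrm A (word_prod A (map a w))) \<le> (\<Sum>w\<in>W. nrm A (word_prod A (map s w)))"
      proof (rule sum_mono)
        fix w assume "w \<in> W"
        then have "set w \<subseteq> J" using W by auto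
        then have wI: "set w \<subseteq> I" using JI by (rule subset_trans)
        have wa: "word_prod A (map a w) \<in> carrier A"
          using wI a by (intro semi.word_prod_map_in[of _ I]) auto
        have p1: "1 \<le> prod_list (map (\<lambda>i. cmod (of_real (r (g i)))) w)"
        proof (induction w)
          case (Cons i w)
          then show ?case using r(1)[of "g i"] mult_mono[of 1 "r (g i)" 1] by auto
        qed simp
        have "cmod (prod_list (map (\<lambda>i. of_real (r (g i))) w)) =
            prod_list (map (\<lambda>i. cmod (of_real (r (g i)))) w)"
          by (induction w) (auto simp: norm_mult)
        then have "nrm A (word_prod A (map s w)) =
            prod_list (map (\<lambda>i. cmod (of_real (r (g i)))) w) * nrm A (word_prod A (map a w))"
          using semi.word_prod_smult[of w a "\<lambda>i. of_real (r (g i))"] wI a wa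
          by (simp add: s_def[abs_def] nrm_smult subset_iff)
        then show "nrm A (word_prod A (map a w)) \<le> nrm A (word_prod A (map s w))"
          using mult_right_mono[OF p1 nrm_nonneg[OF wa]] by simp
      qed
      also have "\<dots> = (\<Sum>v\<in>map s ` W. nrm A (word_prod A v))"
        using W inj_on_subset[OF inj_on_map_lists[OF inj], of W]
        by (subst sum.reindex) (auto simp: lists_eq_set)
      also have "\<dots> \<le> (\<Sum>\<^sub>\<infinity>v\<in>words n (s ` J). nrm A (word_prod A v))"
      proof (rule finite_sum_le_infsum)
        show "(\<lambda>v. nrm A (word_prod A v)) summable_on words n (s ` J)"
          using semi.gen_power_summable[OF SA Ss, of n]
          by (simp add: summable_gen_def gen_power_def gen_of_set_def)
        show "0 \<le> nrm A (word_prod A v)" if "v \<in> words n (s ` J) - map s ` W" for v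
        proof -
          have "set v \<subseteq> s ` J" using that by simp
          also have "\<dots> \<subseteq> carrier A" using s JI by auto
          finally show ?thesis by (intro nrm_nonneg semi.word_prod_in)
        qed
        show "map s ` W \<subseteq> words n (s ` J)"
        proof
          fix v assume "v \<in> map s ` W"
          then obtain w where "w \<in> W" and v: "v = map s w" by blast
          then have "w \<in> words n J" using W by blast
          then show "v \<in> words n (s ` J)" by (auto simp: v)
        qed
      qed (use W in simp)
      also have "\<dots> = ?N" by (simp add: norm1_def gen_power_def gen_of_set_def)
      finally show ?thesis .
    qed
    then show ?thesis
      by (intro semi.norm1_gen_power_le[OF M]) (simp_all add: J_def I_def a_def)
  qed
  show ?thesis
  proof (rule semi.rho1_eq_0I[OF M])
    fix t :: real assume t: "t > 0"
    obtain K where "\<forall>n\<ge>1. t ^ n * norm1 A (gen_power A (gen_of_set (s ` J)) n) \<le> K"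
      using semi.gen_power_bound[OF SA Ss rho0 t] by blast
    then show "\<exists>K. \<forall>n\<ge>1. t ^ n * norm1 A (gen_power A M n) \<le> K"
      using le t by (intro exI[of _ K]) (meson mult_left_mono order_trans zero_le_power less_imp_le)
  qed
qed

end


section \<open>1-quasinilpotent Banach algebras are radical\<close>

text \<open>The partial sums of \<open>T + T\<^sup>2 + T\<^sup>3 + \<cdots>\<close> satisfy \<open>s\<^sub>n\<^sub>+\<^sub>1 = T + s\<^sub>n T\<close>, so their limit
  is a quasi-inverse of \<open>T\<close>.\<close>

lemma one_quasinilpotent_imp_jacobson_radical:
  fixes A (structure)
  assumes "normed_algebra A"
    and complete: "\<And>X. X \<in> cauchy_seqs A \<Longrightarrow> \<exists>x\<in>carrier A. (\<lambda>n. nrm A (X n \<ominus> x)) \<longlonglongrightarrow> 0"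
    and oq: "one_quasinilpotent A"
  shows "jacobson_radical_algebra A"
proof -
  interpret normed_algebra A by fact
  show ?thesis
    unfolding jacobson_radical_algebra_iff[OF complex_algebra_axioms]
  proof
    fix T assume T: "T \<in> carrier A"
    let ?M = "gen_of_set {T}"
    have M: "snd ?M ` fst ?M \<subseteq> carrier A" "summable_gen A ?M"
      using T by (auto simp: gen_of_set_def summable_gen_def)
    have "rho1 A ?M = 0" using M by (intro rho1_family_eq_0[OF oq])
    then obtain K where K: "\<And>n. n \<ge> 1 \<Longrightarrow> 2 ^ n * norm1 A (gen_power A ?M n) \<le> K"
      using semi.gen_power_bound[OF M, of 2] by auto
    have N: "norm1 A (gen_power A ?M n) = nrm A (word_prod A (replicate n T))" for n
    proof -
      have "words n {T} = {replicate n T}" by (auto intro!: replicate_length_same[symmetric])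
      then show ?thesis by (simp add: norm1_def gen_power_def gen_of_set_def)
    qed
    have p: "nrm A (word_prod A (replicate (Suc n) T)) \<le> K * (1 / 2) ^ Suc n" for n
      using K[of "Suc n"] by (simp add: N field_simps)
    define s where "s = rec_nat \<zero> (\<lambda>_ x. T \<oplus> x \<otimes> T)"
    have s_Suc: "s (Suc n) = T \<oplus> s n \<otimes> T" and s_0: "s 0 = \<zero>" for n by (simp_all add: s_def)
    have s: "s n \<in> carrier A" for n by (induction n) (auto simp: s_0 s_Suc T)
    have "s (Suc n) \<ominus> s n = word_prod A (replicate (Suc n) T)" for n
    proof (induction n)
      case (Suc n)
      have "s (Suc (Suc n)) \<ominus> s (Suc n) = (T \<oplus> s (Suc n) \<otimes> T) \<ominus> (T \<oplus> s n \<otimes> T)"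
        by (simp only: s_Suc)
      also have "\<dots> = (s (Suc n) \<ominus> s n) \<otimes> T" using s T by (simp add: add_diff_add diff_mult)
      also have "\<dots> = word_prod A (replicate (Suc n) T @ [T])"
        unfolding Suc using T by (intro semi.word_prod_snoc[symmetric]) auto
      also have "replicate (Suc n) T @ [T] = replicate (Suc (Suc n)) T"
        by (metis replicate_append_same replicate_Suc)
      finally show ?case .
    qed (simp add: s_Suc s_0 T)
    then have "nrm A (s (Suc n) \<ominus> s n) \<le> K * (1 / 2) ^ Suc n" for n using p by simp
    moreover have "summable (\<lambda>n. K * (1 / 2) ^ Suc n)"
      by (intro summable_mult summable_ignore_initial_segment[of _ 1, simplified]) simp
    ultimately have "s \<in> cauchy_seqs A" using s by (intro semi.cauchy_seqs_summable)
    then obtain c where c: "c \<in> carrier A" "(\<lambda>n. nrm A (s n \<ominus> c)) \<longlonglongrightarrow> 0"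
      using complete by blast
    let ?d = "T \<oplus> c \<otimes> T"
    have d: "?d \<in> carrier A" using c T by auto
    have "(\<lambda>n. nrm A (s (Suc n) \<ominus> c) + nrm A (s n \<ominus> c) * nrm A T) \<longlonglongrightarrow> 0 + 0 * nrm A T"
      by (intro tendsto_intros c(2) LIMSEQ_Suc[OF c(2)])
    moreover have "nrm A (c \<ominus> ?d) \<le> nrm A (s (Suc n) \<ominus> c) + nrm A (s n \<ominus> c) * nrm A T" for n
    proof -
      have "nrm A (c \<ominus> ?d) \<le> nrm A (s (Suc n) \<ominus> c) + nrm A (s (Suc n) \<ominus> ?d)"
        using semi.nrm_diff_triangle[OF c(1) s d] semi.nrm_diff_commute[OF c(1) s] by metis
      also have "s (Suc n) \<ominus> ?d = (s n \<ominus> c) \<otimes> T"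
        using s c T by (simp add: s_Suc add_diff_add diff_mult)
      also have "nrm A ((s n \<ominus> c) \<otimes> T) \<le> nrm A (s n \<ominus> c) * nrm A T"
        using s c T by (intro nrm_mult) auto
      finally show ?thesis by simp
    qed
    ultimately have "nrm A (c \<ominus> ?d) \<le> 0"
      by (intro LIMSEQ_le_const) auto
    then have "c \<ominus> ?d = \<zero>"
      using c d nrm_nonneg[of "c \<ominus> ?d"] nrm_eq_0_iff[of "c \<ominus> ?d"] by simp
    then have "c = ?d" using diff_add_cancel[OF c(1) d] d by simp
    with c show "\<exists>c\<in>carrier A. c = T \<oplus> c \<otimes> T" by blast
  qed
qed


section \<open>Tensor products with a 1-quasinilpotent factor\<close>

lemma set_product_lists: "v \<in> set (product_lists xss) \<Longrightarrow> set v \<subseteq> \<Union>(set ` set xss)"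
proof (induction xss arbitrary: v)
  case (Cons xs xss)
  then obtain x u where "v = x # u" "x \<in> set xs" "u \<in> set (product_lists xss)" by auto
  then show ?case using Cons.IH[of u] by auto
qed simp

context tensor_pair
begin

abbreviation C where "C \<equiv> A \<otimes>\<^sub>\<pi> B"

sublocale D: seminormed_algebra D
  by (rule seminormed_algebra_tensor)

lemma tensor_class_zero: "tensor_sum [] = \<zero>\<^bsub>D\<^esub>"
  by (simp add: tensor_zero)

text \<open>Every element of the completed tensor product is the sum of a series of elementary tensors.
  The blocks \<open>L m\<close> represent the differences of successive terms of a rapidly converging sequence
  of algebraic tensors.\<close>

lemma tensor_decomposition:
  assumes U: "U \<in> carrier C"
  shows "\<exists>L. (\<forall>m. set (L m) \<subseteq> pairs) \<and> (\<forall>n. weight (concat (map L [0..<n])) \<le> 2 * nrm C U) \<and>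
    (\<lambda>n. tensor_sum (concat (map L [0..<n]))) \<in> cauchy_seqs D \<and>
    U = D.completion_class (\<lambda>n. tensor_sum (concat (map L [0..<n])))"
proof -
  interpret C: normed_algebra C
    unfolding projective_tensor_def by (rule D.normed_algebra_completion)
  obtain X where X: "X \<in> cauchy_seqs D" "U = D.completion_class X"
    using U by (auto simp: projective_tensor_def D.completion_carrier)
  note XD = D.cauchy_seqsD[OF X(1)]
  have lim: "(\<lambda>n. nrm D (X n)) \<longlonglongrightarrow> nrm C U"
    using D.completion_nrm[OF X(1)] X(2) by (simp add: projective_tensor_def)
  show ?thesis
  proof (cases "U = \<zero>\<^bsub>C\<^esub>")
    case True
    have c: "concat (map (\<lambda>m. []) [0..<n]) = ([] :: ('a \<times> 'b) list)" for n :: nat by simp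
    have "U = D.completion_class (\<lambda>n. \<zero>\<^bsub>D\<^esub>)"
      using True by (simp add: projective_tensor_def D.completion_zero)
    then show ?thesis
      using C.nrm_nonneg[OF U] D.cauchy_seqs_const[OF D.M.zero_closed]
      by (intro exI[of _ "\<lambda>m. []"]) (simp only: c tensor_class_zero, simp)
  next
    case False
    define \<nu> where "\<nu> = nrm C U"
    have \<nu>: "\<nu> > 0" using False U C.nrm_nonneg[OF U] C.nrm_eq_0_iff[OF U] by (simp add: \<nu>_def)
    define \<delta> where "\<delta> n = \<nu> / 2 ^ (n + 3)" for n :: nat
    have \<delta>: "\<delta> n > 0" for n using \<nu> by (simp add: \<delta>_def)
    have "\<exists>N. \<forall>i\<ge>N. \<forall>j\<ge>N. nrm D (X i \<ominus>\<^bsub>D\<^esub> X j) < \<delta> n" for n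
      using X(1) \<delta>[of n] unfolding cauchy_seqs_def by blast
    then obtain N where N: "\<And>n i j. i \<ge> N n \<Longrightarrow> j \<ge> N n \<Longrightarrow> nrm D (X i \<ominus>\<^bsub>D\<^esub> X j) < \<delta> n"
      by metis
    obtain N' where N': "\<And>n. n \<ge> N' \<Longrightarrow> nrm D (X n) < \<nu> + \<nu> / 4"
      using order_tendstoD(2)[OF lim, of "\<nu> + \<nu> / 4"] \<nu> by (auto simp: \<nu>_def eventually_sequentially)
    \<comment> \<open>At least as large as \<open>N'\<close> and each \<open>N i\<close> with \<open>i \<le> n\<close>, so that \<open>X (k n)\<close> and
      \<open>X (k (Suc n))\<close> differ by less than \<open>\<delta> n\<close>.\<close>
    define k where "k n = (\<Sum>i\<le>n. N i) + N' + n" for n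
    have k: "N n \<le> k n" "N n \<le> k (Suc n)" "N' \<le> k n" "n \<le> k n" for n
    proof -
      have "N n \<le> (\<Sum>i\<le>n. N i)" by (rule member_le_sum) auto
      then show "N n \<le> k n" "N n \<le> k (Suc n)" "N' \<le> k n" "n \<le> k n" by (auto simp: k_def)
    qed
    define Y where "Y n = X (k n)" for n
    have Y: "Y n \<in> carrier D" for n using XD by (simp add: Y_def)
    define W where "W n = (case n of 0 \<Rightarrow> Y 0 | Suc m \<Rightarrow> Y (Suc m) \<ominus>\<^bsub>D\<^esub> Y m)" for n
    have W: "W n \<in> carrier D" for n using Y by (auto simp: W_def split: nat.split)
    have "\<exists>ts. set ts \<subseteq> pairs \<and> W n = tensor_sum ts \<and> weight ts < nrm D (W n) + \<delta> (n - 1)" for n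
      using nrm_tensor_approx[OF W \<delta>] by metis
    then obtain L where L: "\<And>n. set (L n) \<subseteq> pairs" "\<And>n. W n = tensor_sum (L n)"
      "\<And>n. weight (L n) < nrm D (W n) + \<delta> (n - 1)" by metis
    have set: "set (concat (map L [0..<n])) \<subseteq> pairs" for n using L(1) by auto
    have sum: "tensor_sum (concat (map L [0..<Suc n])) = Y n" for n
    proof (induction n)
      case 0
      then show ?case using L(2)[of 0] by (simp add: W_def)
    next
      case (Suc n)
      have "tensor_sum (concat (map L [0..<Suc (Suc n)])) =
          tensor_sum (concat (map L [0..<Suc n]) @ L (Suc n))" by simp
      also have "\<dots> = Y n \<oplus>\<^bsub>D\<^esub> (Y (Suc n) \<ominus>\<^bsub>D\<^esub> Y n)"
        using L(2)[of "Suc n"] unfolding tensor_sum_append[OF set L(1)] Suc by (simp add: W_def)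
      also have "\<dots> = Y (Suc n)"
        using Y D.M.a_comm[of "Y n" "Y (Suc n) \<ominus>\<^bsub>D\<^esub> Y n"] by (simp add: D.diff_add_cancel)
      finally show ?case .
    qed
    \<comment> \<open>Block \<open>0\<close> has weight at most \<open>3/2 \<nu>\<close> and block \<open>n + 1\<close> at most \<open>\<nu> / 2 ^ (n + 2)\<close>. Together
      these bounds add up to \<open>2 \<nu>\<close>.\<close>
    have wS: "weight (concat (map L [0..<Suc n])) \<le> 2 * \<nu> - \<nu> / 2 ^ (n + 1)" for n
    proof (induction n)
      case 0
      have "weight (L 0) < nrm D (Y 0) + \<delta> 0" using L(3)[of 0] by (simp add: W_def)
      also have "nrm D (Y 0) < \<nu> + \<nu> / 4" unfolding Y_def by (intro N' k)
      finally show ?case using \<nu> by (simp add: \<delta>_def)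
    next
      case (Suc n)
      have "nrm D (Y (Suc n) \<ominus>\<^bsub>D\<^esub> Y n) < \<delta> n" unfolding Y_def by (intro N k)
      then have "weight (L (Suc n)) \<le> \<delta> n + \<delta> n" using L(3)[of "Suc n"] by (simp add: W_def)
      also have "\<delta> n + \<delta> n = \<nu> / 2 ^ (n + 2)" by (simp add: \<delta>_def field_simps power_add)
      finally have "weight (L (Suc n)) \<le> \<nu> / 2 ^ (n + 2)" .
      moreover have "\<nu> / 2 ^ (n + 1) = \<nu> / 2 ^ (n + 2) + \<nu> / 2 ^ (n + 2)" by (simp add: field_simps)
      moreover have "weight (concat (map L [0..<Suc (Suc n)])) =
          weight (concat (map L [0..<Suc n])) + weight (L (Suc n))" by simp
      ultimately show ?case using Suc by simp
    qed
    have w: "weight (concat (map L [0..<n])) \<le> 2 * \<nu>" for n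
    proof (cases n)
      case (Suc m)
      have "0 \<le> \<nu> / 2 ^ (m + 1)" using \<nu> by simp
      then show ?thesis using wS[of m] Suc by simp
    qed (use \<nu> in simp)
    let ?Z = "\<lambda>n. tensor_sum (concat (map L [0..<n]))"
    have "(X, ?Z) \<in> same_limit D"
    proof (rule D.same_limit_if_distance_tendsto_0[OF X(1)])
      show "?Z n \<in> carrier D" for n using set by (rule tensor_sum_in)
      have "(\<lambda>n. nrm D (X (Suc n) \<ominus>\<^bsub>D\<^esub> ?Z (Suc n))) \<longlonglongrightarrow> 0"
      proof (rule LIMSEQ_I)
        fix e :: real assume "e > 0"
        then obtain M where M: "\<And>i j. i \<ge> M \<Longrightarrow> j \<ge> M \<Longrightarrow> nrm D (X i \<ominus>\<^bsub>D\<^esub> X j) < e"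
          using X(1) unfolding cauchy_seqs_def by blast
        have "norm (nrm D (X (Suc n) \<ominus>\<^bsub>D\<^esub> ?Z (Suc n)) - 0) < e" if "n \<ge> M" for n
        proof -
          have "nrm D (X (Suc n) \<ominus>\<^bsub>D\<^esub> X (k n)) < e" using that k(4)[of n] by (intro M) auto
          then show ?thesis unfolding sum using XD by (simp add: Y_def D.nrm_nonneg)
        qed
        then show "\<exists>M. \<forall>n\<ge>M. norm (nrm D (X (Suc n) \<ominus>\<^bsub>D\<^esub> ?Z (Suc n)) - 0) < e" by blast
      qed
      then show "(\<lambda>n. nrm D (X n \<ominus>\<^bsub>D\<^esub> ?Z n)) \<longlonglongrightarrow> 0" by (rule LIMSEQ_imp_Suc)
    qed
    then have "?Z \<in> cauchy_seqs D" "U = D.completion_class ?Z"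
      using X(2) D.completion_class_cong by (auto simp: same_limit_def)
    then show ?thesis using L(1) w unfolding \<nu>_def by blast
  qed
qed

text \<open>Multiplying out: each term of the product picks one index from each factor, which is what
  \<open>product_lists\<close> enumerates.\<close>

lemma word_prod_tensor_sum:
  assumes "xss \<noteq> []" and ab: "\<And>i. i \<in> \<Union>(set ` set xss) \<Longrightarrow> \<alpha> i \<in> carrier A \<and> \<beta> i \<in> carrier B"
  shows "word_prod D (map (\<lambda>xs. tensor_sum (map (\<lambda>i. (\<alpha> i, \<beta> i)) xs)) xss) =
    tensor_sum (map (\<lambda>v. (word_prod A (map \<alpha> v), word_prod B (map \<beta> v))) (product_lists xss))"
  using assms
proof (induction xss rule: induct_list012)
  case (2 xs)
  have eq: "map (\<lambda>v. (word_prod A (map \<alpha> v), word_prod B (map \<beta> v))) (product_lists [xs]) =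
      map (\<lambda>i. (\<alpha> i, \<beta> i)) xs"
    by (induction xs) auto
  show ?case unfolding eq by simp
next
  case (3 xs ys yss)
  let ?P = "\<lambda>v. (word_prod A (map \<alpha> v), word_prod B (map \<beta> v))"
  let ?ps = "product_lists (ys # yss)"
  have ne: "v \<noteq> []" if "v \<in> set ?ps" for v
    using in_set_product_lists_length[OF that] by auto
  have in_v: "set v \<subseteq> \<Union>(set ` set (ys # yss))" if "v \<in> set ?ps" for v
    using that by (rule set_product_lists)
  have xs: "set (map (\<lambda>i. (\<alpha> i, \<beta> i)) xs) \<subseteq> pairs" using 3(4) by auto
  have ps: "set (map ?P ?ps) \<subseteq> pairs"
  proof -
    have "word_prod A (map \<alpha> v) \<in> carrier A \<and> word_prod B (map \<beta> v) \<in> carrier B"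
      if "v \<in> set ?ps" for v
      using in_v[OF that] 3(4)
      by (intro conjI A.word_prod_in B.word_prod_in) auto
    then show ?thesis by auto
  qed
  have "word_prod D (map (\<lambda>xs. tensor_sum (map (\<lambda>i. (\<alpha> i, \<beta> i)) xs)) (xs # ys # yss)) =
      tensor_sum (map (\<lambda>i. (\<alpha> i, \<beta> i)) xs) \<otimes>\<^bsub>D\<^esub> tensor_sum (map ?P ?ps)"
    using 3(2) 3(4) by simp
  also have "\<dots> = tensor_sum (list_mult (map (\<lambda>i. (\<alpha> i, \<beta> i)) xs) (map ?P ?ps))"
    using tensor_sum_mult[OF xs ps] by simp
  also have "list_mult (map (\<lambda>i. (\<alpha> i, \<beta> i)) xs) (map ?P ?ps) =
      concat (map (\<lambda>i. map (\<lambda>v. ?P (i # v)) ?ps) xs)"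
    unfolding list_mult_def map_map o_def
    by (intro arg_cong[of _ _ concat] map_cong refl) (simp add: word_prod_Cons ne o_def)
  also have "\<dots> = map ?P (product_lists (xs # ys # yss))"
    by (simp add: map_concat o_def del: product_lists.simps(2)) (simp add: product_lists.simps(2) map_concat o_def)
  finally show ?case .
qed simp

text \<open>Since \<open>\<parallel>b\<^sub>1 \<cdots> b\<^sub>n\<parallel> \<le> \<parallel>b\<^sub>1\<parallel> \<cdots> \<parallel>b\<^sub>n\<parallel>\<close>, the norms of the second factors can be moved to the
  first ones. This leaves a sum over products in \<open>A\<close> alone.\<close>

lemma nrm_word_prod_tensor_sum_le:
  assumes "xss \<noteq> []" and ab: "\<And>i. i \<in> \<Union>(set ` set xss) \<Longrightarrow> \<alpha> i \<in> carrier A \<and> \<beta> i \<in> carrier B"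
  shows "nrm D (word_prod D (map (\<lambda>xs. tensor_sum (map (\<lambda>i. (\<alpha> i, \<beta> i)) xs)) xss)) \<le>
    (\<Sum>v\<leftarrow>product_lists xss. nrm A (word_prod A (map (\<lambda>i. of_real (nrm B (\<beta> i)) \<odot>\<^bsub>A\<^esub> \<alpha> i) v)))"
proof -
  let ?P = "\<lambda>v. (word_prod A (map \<alpha> v), word_prod B (map \<beta> v))"
  have v: "v \<noteq> []" "set v \<subseteq> \<Union>(set ` set xss)" if "v \<in> set (product_lists xss)" for v
  proof -
    show "v \<noteq> []" using in_set_product_lists_length[OF that] assms(1) by auto
    show "set v \<subseteq> \<Union>(set ` set xss)"
      using that by (rule set_product_lists)
  qed
  have P: "word_prod A (map \<alpha> v) \<in> carrier A" "word_prod B (map \<beta> v) \<in> carrier B"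
    if "v \<in> set (product_lists xss)" for v
  proof -
    have "\<alpha> i \<in> carrier A \<and> \<beta> i \<in> carrier B" if "i \<in> set v" for i
      using v(2)[OF \<open>v \<in> set (product_lists xss)\<close>] that by (intro ab) (rule subsetD)
    then show "word_prod A (map \<alpha> v) \<in> carrier A" "word_prod B (map \<beta> v) \<in> carrier B"
      by (auto intro!: A.word_prod_in B.word_prod_in)
  qed
  have "nrm D (word_prod D (map (\<lambda>xs. tensor_sum (map (\<lambda>i. (\<alpha> i, \<beta> i)) xs)) xss)) \<le>
      weight (map ?P (product_lists xss))"
  proof -
    have "set (map ?P (product_lists xss)) \<subseteq> pairs" using P by auto
    from nrm_tensor_le[OF this] show ?thesis by (simp only: word_prod_tensor_sum[OF assms])
  qed
  also have "\<dots> = (\<Sum>v\<leftarrow>product_lists xss. nrm A (word_prod A (map \<alpha> v)) * nrm B (word_prod B (map \<beta> v)))"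
    by (simp add: o_def)
  also have "\<dots> \<le> (\<Sum>v\<leftarrow>product_lists xss.
      nrm A (word_prod A (map (\<lambda>i. of_real (nrm B (\<beta> i)) \<odot>\<^bsub>A\<^esub> \<alpha> i) v)))"
  proof (rule sum_list_mono)
    fix v assume vp: "v \<in> set (product_lists xss)"
    have va: "\<alpha> i \<in> carrier A" "\<beta> i \<in> carrier B" if "i \<in> set v" for i
      using v(2)[OF vp] ab that by blast+
    have "nrm B (word_prod B (map \<beta> v)) \<le> prod_list (map (nrm B) (map \<beta> v))"
      using va v(1)[OF vp] by (intro B.nrm_word_prod_le) auto
    also have "\<dots> = cmod (prod_list (map (\<lambda>i. of_real (nrm B (\<beta> i))) v))"
      using va by (induction v) (auto simp: norm_mult B.nrm_nonneg)
    finally have "nrm A (word_prod A (map \<alpha> v)) * nrm B (word_prod B (map \<beta> v)) \<le>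
        cmod (prod_list (map (\<lambda>i. of_real (nrm B (\<beta> i))) v)) * nrm A (word_prod A (map \<alpha> v))"
      using A.nrm_nonneg[OF P(1)[OF vp]] by (simp add: mult.commute mult_left_mono)
    also have "\<dots> = nrm A (word_prod A (map (\<lambda>i. of_real (nrm B (\<beta> i)) \<odot>\<^bsub>A\<^esub> \<alpha> i) v))"
      using A.word_prod_smult[of v \<alpha> "\<lambda>i. of_real (nrm B (\<beta> i))"] va P(1)[OF vp]
      by (simp add: A.nrm_smult)
    finally show "nrm A (word_prod A (map \<alpha> v)) * nrm B (word_prod B (map \<beta> v)) \<le>
      nrm A (word_prod A (map (\<lambda>i. of_real (nrm B (\<beta> i)) \<odot>\<^bsub>A\<^esub> \<alpha> i) v))" .
  qed
  finally show ?thesis .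
qed

end

text \<open>The first factors of all elementary tensors in expansions of the elements of \<open>S\<close>, scaled by
  the norms of the second factors, form a summable family \<open>M\<close> in \<open>A\<close>. Expanding a product of
  elements of \<open>S\<close> into elementary tensors bounds the norm of \<open>S\<^sup>n\<close> by the norm of \<open>M\<^sup>n\<close>.
  This is done on finite partial sums, before passing to the limit.\<close>

lemma one_quasinilpotent_tensor:
  assumes "normed_algebra A" "normed_algebra B" and oq: "one_quasinilpotent A"
  shows "one_quasinilpotent (A \<otimes>\<^sub>\<pi> B)"
proof -
  interpret A: normed_algebra A by fact
  interpret B: normed_algebra B by fact
  interpret tensor_pair A B ..
  interpret C: normed_algebra C
    unfolding projective_tensor_def by (rule D.normed_algebra_completion)
  show ?thesis
    unfolding one_quasinilpotent_def
  proof (intro allI impI)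
    fix S assume S: "S \<subseteq> carrier C \<and> summable_gen C (gen_of_set S)"
    then have S1: "snd (gen_of_set S) ` fst (gen_of_set S) \<subseteq> carrier C"
      and S2: "summable_gen C (gen_of_set S)" by (auto simp: gen_of_set_def)
    have Ss: "nrm C summable_on S" using S2 by (simp add: summable_gen_def gen_of_set_def)
    define P where "P U L \<longleftrightarrow> (\<forall>m. set (L m) \<subseteq> pairs) \<and>
        (\<forall>n. weight (concat (map L [0..<n])) \<le> 2 * nrm C U) \<and>
        (\<lambda>n. tensor_sum (concat (map L [0..<n]))) \<in> cauchy_seqs D \<and>
        U = D.completion_class (\<lambda>n. tensor_sum (concat (map L [0..<n])))" for U L
    have "\<forall>U\<in>S. \<exists>L. P U L"
      unfolding P_def
    proof (intro ballI tensor_decomposition)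
      show "U \<in> carrier C" if "U \<in> S" for U using S that by blast
    qed
    then obtain L where "\<And>U. U \<in> S \<Longrightarrow> P U (L U)" by metis
    then have L: "\<And>U m. U \<in> S \<Longrightarrow> set (L U m) \<subseteq> pairs"
      "\<And>U n. U \<in> S \<Longrightarrow> weight (concat (map (L U) [0..<n])) \<le> 2 * nrm C U"
      "\<And>U. U \<in> S \<Longrightarrow> (\<lambda>n. tensor_sum (concat (map (L U) [0..<n]))) \<in> cauchy_seqs D"
      "\<And>U. U \<in> S \<Longrightarrow> U = D.completion_class (\<lambda>n. tensor_sum (concat (map (L U) [0..<n])))"
      unfolding P_def by simp_all
    \<comment> \<open>The index \<open>(U, m, p)\<close> denotes the tensor at position \<open>p\<close> of block \<open>m\<close> in the expansion
      of \<open>U\<close>, and \<open>ix U n\<close> lists the indices of the first \<open>n\<close> blocks.\<close>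
    define \<alpha> \<beta> where "\<alpha> = (\<lambda>(U, m, p). fst (L U m ! p))" and "\<beta> = (\<lambda>(U, m, p). snd (L U m ! p))"
    define I where "I = {(U, m, p). U \<in> S \<and> p < length (L U m)}"
    define \<gamma> where "\<gamma> i = of_real (nrm B (\<beta> i)) \<odot>\<^bsub>A\<^esub> \<alpha> i" for i
    define M where "M = (I, \<gamma>)"
    define ix where "ix U n = concat (map (\<lambda>m. map (\<lambda>p. (U, m, p)) [0..<length (L U m)]) [0..<n])" for U n
    have set_ix: "set (ix U n) = {(U', m, p). U' = U \<and> m < n \<and> p < length (L U m)}" for U n
      by (auto simp: ix_def)
    have ix_I: "set (ix U n) \<subseteq> I" if "U \<in> S" for U n using that by (auto simp: set_ix I_def)
    have dist: "distinct (ix U n)" for U n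
    proof (induction n)
      case (Suc n)
      have "ix U (Suc n) = ix U n @ map (\<lambda>p. (U, n, p)) [0..<length (L U n)]" by (simp add: ix_def)
      then show ?case using Suc by (auto simp: set_ix distinct_map inj_on_def)
    qed (simp add: ix_def)
    have map_ix: "map (\<lambda>i. (\<alpha> i, \<beta> i)) (ix U n) = concat (map (L U) [0..<n])" for U n
    proof -
      have "map (\<lambda>i. (\<alpha> i, \<beta> i)) (map (\<lambda>p. (U, m, p)) [0..<length (L U m)]) = L U m" for m
        by (rule nth_equalityI) (auto simp: \<alpha>_def \<beta>_def)
      then show ?thesis by (simp only: ix_def map_concat map_map o_def)
    qed
    have ab: "\<alpha> i \<in> carrier A" "\<beta> i \<in> carrier B" if "i \<in> I" for i
      using that L(1) nth_mem by (fastforce simp: I_def \<alpha>_def \<beta>_def)+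
    have \<gamma>: "\<gamma> i \<in> carrier A" "nrm A (\<gamma> i) = nrm A (\<alpha> i) * nrm B (\<beta> i)" if "i \<in> I" for i
      using ab[OF that] by (auto simp: \<gamma>_def A.nrm_smult B.nrm_nonneg)
    have M1: "snd M ` fst M \<subseteq> carrier A" using \<gamma> by (auto simp: M_def)
    have sum_ix: "(\<Sum>i\<in>set (ix U n). nrm A (\<gamma> i)) \<le> 2 * nrm C U" if "U \<in> S" for U n
    proof -
      have "(\<Sum>i\<in>set (ix U n). nrm A (\<gamma> i)) = (\<Sum>i\<leftarrow>ix U n. nrm A (\<gamma> i))"
        using dist by (simp add: sum_list_distinct_conv_sum_set)
      also have "\<dots> = (\<Sum>i\<leftarrow>ix U n. nrm A (\<alpha> i) * nrm B (\<beta> i))"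
        using ix_I[OF that, of n] by (intro arg_cong[of _ _ sum_list] map_cong refl \<gamma>(2)) blast
      also have "\<dots> = weight (map (\<lambda>i. (\<alpha> i, \<beta> i)) (ix U n))" by (simp add: o_def)
      also have "\<dots> \<le> 2 * nrm C U" unfolding map_ix using that by (rule L(2))
      finally show ?thesis .
    qed
    have M2: "summable_gen A M"
      unfolding summable_gen_def M_def fst_conv snd_conv
    proof (rule nonneg_bdd_above_summable_on)
      show "0 \<le> nrm A (\<gamma> i)" if "i \<in> I" for i using \<gamma>(1)[OF that] by (rule A.nrm_nonneg)
      show "bdd_above (sum (\<lambda>i. nrm A (\<gamma> i)) ` {F. F \<subseteq> I \<and> finite F})"
      proof (rule bdd_aboveI2)
        fix F assume "F \<in> {F. F \<subseteq> I \<and> finite F}"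
        then have F: "F \<subseteq> I" "finite F" by auto
        define n where "n = Suc (Max (insert 0 ((\<lambda>i. fst (snd i)) ` F)))"
        have n: "fst (snd i) < n" if "i \<in> F" for i
          using that F by (auto simp: n_def less_Suc_eq_le intro!: Max_ge)
        let ?S = "fst ` F"
        have S': "?S \<subseteq> S" "finite ?S" using F by (auto simp: I_def)
        have sub: "F \<subseteq> (\<Union>U\<in>?S. set (ix U n))"
        proof
          fix i assume i: "i \<in> F"
          obtain U m p where "i = (U, m, p)" by (cases i)
          then show "i \<in> (\<Union>U\<in>?S. set (ix U n))"
            using i F n[OF i] by (force simp: set_ix I_def)
        qed
        have "(\<Sum>i\<in>F. nrm A (\<gamma> i)) \<le> (\<Sum>i\<in>(\<Union>U\<in>?S. set (ix U n)). nrm A (\<gamma> i))"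
        proof (rule sum_mono2)
          show "finite (\<Union>U\<in>?S. set (ix U n))" using S' by blast
          have "(\<Union>U\<in>?S. set (ix U n)) \<subseteq> I" using S' ix_I by blast
          then show "0 \<le> nrm A (\<gamma> i)" if "i \<in> (\<Union>U\<in>?S. set (ix U n)) - F" for i
            using that by (intro A.nrm_nonneg \<gamma>(1)) blast
        qed (rule sub)
        also have "\<dots> = (\<Sum>U\<in>?S. \<Sum>i\<in>set (ix U n). nrm A (\<gamma> i))"
        proof (rule sum.UNION_disjoint)
          show "\<forall>U\<in>?S. \<forall>U'\<in>?S. U \<noteq> U' \<longrightarrow> set (ix U n) \<inter> set (ix U' n) = {}"
            by (auto simp: set_ix)
        qed (use S' in simp_all)
        also have "\<dots> \<le> (\<Sum>U\<in>?S. 2 * nrm C U)" using S' sum_ix by (intro sum_mono) auto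
        also have "\<dots> = 2 * sum (nrm C) ?S" by (simp add: sum_distrib_left)
        also have "\<dots> \<le> 2 * infsum (nrm C) S"
          using S' S Ss by (intro mult_left_mono finite_sum_le_infsum) (auto intro: C.nrm_nonneg)
        finally show "(\<Sum>i\<in>F. nrm A (\<gamma> i)) \<le> 2 * infsum (nrm C) S" .
      qed
    qed
    have rho0: "rho1 A M = 0" by (rule A.rho1_family_eq_0[OF oq M1 M2])
    have le: "norm1 C (gen_power C (gen_of_set S) N) \<le> norm1 A (gen_power A M N)" if N1: "N \<ge> 1" for N
    proof -
      define f where "f v = nrm A (word_prod A (map \<gamma> v))" for v
      have f0: "0 \<le> f v" if "set v \<subseteq> I" for v
        using that \<gamma>(1) by (auto simp: f_def intro!: A.nrm_nonneg A.semi.word_prod_map_in[of _ I])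
      have fs: "f summable_on words N I"
        using A.semi.gen_power_summable[OF M1 M2, of N]
        by (simp add: summable_gen_def gen_power_def M_def f_def[abs_def])
      have fin: "(\<Sum>w\<in>F. nrm C (word_prod C w)) \<le> infsum f (words N I)"
        if F: "finite F" "F \<subseteq> words N S" for F
      proof -
        define Q where "Q w n = word_prod D (map (\<lambda>U. tensor_sum (map (\<lambda>i. (\<alpha> i, \<beta> i)) (ix U n))) w)" for w n
        define V where "V w n = set (product_lists (map (\<lambda>U. ix U n) w))" for w n
        have ne: "w \<noteq> []" if "w \<in> F" for w using that F N1 by auto
        have lim: "(\<lambda>n. nrm D (Q w n)) \<longlonglongrightarrow> nrm C (word_prod C w)" if w: "w \<in> F" for w
        proof -
          define X where "X U n = tensor_sum (concat (map (L U) [0..<n]))" for U n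
          have wS: "set w \<subseteq> S" using w F by auto
          have X: "X U \<in> cauchy_seqs D" "D.completion_class (X U) = U" if "U \<in> set w" for U
            using that wS L(3,4)[of U] unfolding X_def[abs_def] by auto
          have mapX: "map D.completion_class (map X w) = w"
            using X(2) by (simp add: map_idI)
          have Q: "Q w n = word_prod D (map (\<lambda>X. X n) (map X w))" for n
            by (simp add: Q_def map_ix X_def o_def)
          have "map X w \<noteq> []" "set (map X w) \<subseteq> cauchy_seqs D"
            using ne[OF w] X(1) by auto
          from D.word_prod_completion[OF this] have "(\<lambda>n. Q w n) \<in> cauchy_seqs D"
            "word_prod C w = D.completion_class (\<lambda>n. Q w n)"
            unfolding mapX Q[symmetric] projective_tensor_def by auto
          then show ?thesis using D.completion_nrm by (simp add: projective_tensor_def)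
        qed
        have "(\<Sum>w\<in>F. nrm D (Q w n)) \<le> infsum f (words N I)" for n
        proof -
          have ixw: "i \<in> I" if "w \<in> F" "i \<in> \<Union>(set ` set (map (\<lambda>U. ix U n) w))" for w i
            using that F ix_I[of _ n] by fastforce
          have VI: "V w n \<subseteq> words N I" if w: "w \<in> F" for w
          proof
            fix v assume v: "v \<in> V w n"
            then have "length v = N"
              using in_set_product_lists_length[of v] w F by (auto simp: V_def)
            moreover have "set v \<subseteq> \<Union>(set ` set (map (\<lambda>U. ix U n) w))"
              using v unfolding V_def by (rule set_product_lists)
            ultimately show "v \<in> words N I" using ixw[OF w] by blast
          qed
          have fst_V: "map fst v = w" if "v \<in> V w n" for v w
          proof -
            have la: "list_all2 (\<lambda>i xs. i \<in> set xs) v (map (\<lambda>U. ix U n) w)"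
              using that by (simp add: V_def product_lists_set)
            have len: "length v = length w" using list_all2_lengthD[OF la] by simp
            have nth: "v ! i \<in> set (ix (w ! i) n)" if "i < length w" for i
              using list_all2_nthD2[OF la, of i] that by simp
            have "fst (v ! i) = w ! i" if "i < length w" for i
              using nth[OF that] unfolding set_ix by (rule CollectE) (simp add: case_prod_beta)
            then show ?thesis using len by (intro nth_equalityI) simp_all
          qed
          have "nrm D (Q w n) \<le> sum f (V w n)" if w: "w \<in> F" for w
          proof -
            have "Q w n = word_prod D (map (\<lambda>xs. tensor_sum (map (\<lambda>i. (\<alpha> i, \<beta> i)) xs)) (map (\<lambda>U. ix U n) w))"
              by (simp add: Q_def o_def)
            also have "nrm D \<dots> \<le> (\<Sum>v\<leftarrow>product_lists (map (\<lambda>U. ix U n) w). f v)"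
              unfolding f_def \<gamma>_def[abs_def]
              using ne[OF w] ixw[OF w] ab by (intro nrm_word_prod_tensor_sum_le) auto
            also have "\<dots> = sum f (V w n)"
              unfolding V_def using dist
              by (intro sum_list_distinct_conv_sum_set distinct_product_lists) auto
            finally show ?thesis .
          qed
          then have "(\<Sum>w\<in>F. nrm D (Q w n)) \<le> (\<Sum>w\<in>F. sum f (V w n))" by (intro sum_mono)
          also have "\<dots> = sum f (\<Union>w\<in>F. V w n)"
          proof (rule sum.UNION_disjoint[symmetric])
            show "\<forall>w\<in>F. \<forall>w'\<in>F. w \<noteq> w' \<longrightarrow> V w n \<inter> V w' n = {}"
              using fst_V by blast
          qed (use F in \<open>simp_all add: V_def\<close>)
          also have "\<dots> \<le> infsum f (words N I)"
          proof (rule finite_sum_le_infsum[OF fs])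
            show "finite (\<Union>w\<in>F. V w n)" using F by (simp add: V_def)
            show "(\<Union>w\<in>F. V w n) \<subseteq> words N I" using VI by blast
          qed (use f0 in simp)
          finally show ?thesis .
        qed
        moreover have "(\<lambda>n. \<Sum>w\<in>F. nrm D (Q w n)) \<longlonglongrightarrow> (\<Sum>w\<in>F. nrm C (word_prod C w))"
          using lim by (intro tendsto_sum)
        ultimately show ?thesis by (intro LIMSEQ_le_const2) auto
      qed
      have "(\<lambda>w. nrm C (word_prod C w)) summable_on words N S"
        using C.semi.gen_power_summable[OF S1 S2, of N]
        by (simp add: summable_gen_def gen_power_def gen_of_set_def)
      with fin show ?thesis
        by (simp add: norm1_def gen_power_def gen_of_set_def M_def f_def[symmetric, abs_def] infsum_le_finite_sums)
    qed
    show "rho1 C (gen_of_set S) = 0"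
    proof (rule C.semi.rho1_eq_0I[OF S1 S2])
      fix t :: real assume t: "t > 0"
      obtain K where "\<forall>n\<ge>1. t ^ n * norm1 A (gen_power A M n) \<le> K"
        using A.semi.gen_power_bound[OF M1 M2 rho0 t] by blast
      then show "\<exists>K. \<forall>n\<ge>1. t ^ n * norm1 C (gen_power C (gen_of_set S) n) \<le> K"
        using le t by (intro exI[of _ K]) (meson mult_left_mono order_trans zero_le_power less_imp_le)
    qed
  qed
qed


section \<open>Coefficients in tensor products with a free algebra\<close>

text \<open>What the comparison of coefficients needs of the algebra \<open>\<ell>\<^sup>1\<close> of the free monoid: \<open>coef w b\<close>
  is the coefficient of \<open>b\<close> at the word \<open>w\<close>, and multiplication by \<open>x i\<close> from the right appends
  the letter \<open>i\<close>.\<close>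

locale free_generators = B: normed_algebra B for B :: "('b, 'n) normed_alg_scheme" +
  fixes x :: "nat \<Rightarrow> 'b" and coef :: "nat list \<Rightarrow> 'b \<Rightarrow> complex"
  assumes gen_in: "x i \<in> carrier B"
    and nrm_gen: "nrm B (x i) \<le> 1"
    and coef_add: "\<lbrakk>b \<in> carrier B; b' \<in> carrier B\<rbrakk> \<Longrightarrow> coef w (b \<oplus>\<^bsub>B\<^esub> b') = coef w b + coef w b'"
    and coef_smult: "b \<in> carrier B \<Longrightarrow> coef w (c \<odot>\<^bsub>B\<^esub> b) = c * coef w b"
    and coef_sum_le: "\<lbrakk>finite W; b \<in> carrier B\<rbrakk> \<Longrightarrow> (\<Sum>w\<in>W. cmod (coef w b)) \<le> nrm B b"
    and coef_gen: "coef w (x i) = (if w = [i] then 1 else 0)"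
    and coef_Nil_mult: "b \<in> carrier B \<Longrightarrow> coef [] (b \<otimes>\<^bsub>B\<^esub> x i) = 0"
    and coef_snoc_mult: "b \<in> carrier B \<Longrightarrow>
      coef (w @ [j]) (b \<otimes>\<^bsub>B\<^esub> x i) = (if j = i then coef w b else 0)"

locale coefficient_maps = A: normed_algebra A + free_generators B x coef
  for A :: "('a, 'm) normed_alg_scheme" and B :: "('b, 'n) normed_alg_scheme"
    and x :: "nat \<Rightarrow> 'b" and coef :: "nat list \<Rightarrow> 'b \<Rightarrow> complex"
begin

sublocale tensor_pair A B ..

text \<open>The linear extension of \<open>a \<otimes> b \<mapsto> coef w b \<odot> a\<close> to the free vector space. It vanishes on the
  bilinear relations, so it represents a map from the tensor product to \<open>A\<close>.\<close>

definition \<phi> :: "nat list \<Rightarrow> ('a \<times> 'b \<Rightarrow>\<^sub>0 complex) \<Rightarrow> 'a" where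
  "\<phi> w f = (\<Oplus>\<^bsub>A\<^esub>p\<in>Poly_Mapping.keys f.
     (Poly_Mapping.lookup f p * coef w (snd p)) \<odot>\<^bsub>A\<^esub> fst p)"

lemma phi_superset:
  assumes "finite K" "Poly_Mapping.keys f \<subseteq> K" "K \<subseteq> pairs"
  shows "\<phi> w f = (\<Oplus>\<^bsub>A\<^esub>p\<in>K. (Poly_Mapping.lookup f p * coef w (snd p)) \<odot>\<^bsub>A\<^esub> fst p)"
  unfolding \<phi>_def using assms
  by (intro A.M.add.finprod_mono_neutral_cong_left) (auto simp: in_keys_iff subset_iff)

lemma phi_in [simp, intro]: "f \<in> F \<Longrightarrow> \<phi> w f \<in> carrier A"
  unfolding \<phi>_def free_space_def by (intro A.M.finsum_closed) auto

lemma phi_add: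
  assumes "f \<in> F" "g \<in> F"
  shows "\<phi> w (f + g) = \<phi> w f \<oplus>\<^bsub>A\<^esub> \<phi> w g"
proof -
  let ?K = "Poly_Mapping.keys f \<union> Poly_Mapping.keys g"
  have K: "finite ?K" "?K \<subseteq> pairs" using assms by (auto simp: free_space_def)
  have fg: "Poly_Mapping.keys (f + g) \<subseteq> ?K" by (rule Poly_Mapping.keys_add)
  let ?t = "\<lambda>f p. (Poly_Mapping.lookup f p * coef w (snd p)) \<odot>\<^bsub>A\<^esub> fst p"
  have "\<phi> w (f + g) = (\<Oplus>\<^bsub>A\<^esub>p\<in>?K. ?t f p \<oplus>\<^bsub>A\<^esub> ?t g p)"
    unfolding phi_superset[OF K(1) fg K(2)] using K(2)
    by (intro A.M.finsum_cong')
      (auto simp: Poly_Mapping.lookup_add distrib_right A.smult_add_left subset_iff)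
  also have "\<dots> = (\<Oplus>\<^bsub>A\<^esub>p\<in>?K. ?t f p) \<oplus>\<^bsub>A\<^esub> (\<Oplus>\<^bsub>A\<^esub>p\<in>?K. ?t g p)"
    using K(2) by (intro A.M.finsum_addf) auto
  also have "\<dots> = \<phi> w f \<oplus>\<^bsub>A\<^esub> \<phi> w g"
    using K by (simp add: phi_superset[of ?K])
  finally show ?thesis .
qed

lemma phi_scale:
  assumes "f \<in> F"
  shows "\<phi> w (scale_free c f) = c \<odot>\<^bsub>A\<^esub> \<phi> w f"
proof -
  let ?K = "Poly_Mapping.keys f"
  have K: "finite ?K" "?K \<subseteq> pairs" using assms by (auto simp: free_space_def)
  have "\<phi> w (scale_free c f) =
      (\<Oplus>\<^bsub>A\<^esub>p\<in>?K. c \<odot>\<^bsub>A\<^esub> ((Poly_Mapping.lookup f p * coef w (snd p)) \<odot>\<^bsub>A\<^esub> fst p))"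
    unfolding phi_superset[OF K(1) keys_scale_free K(2)] using K(2)
    by (intro A.M.finsum_cong') (auto simp: A.smult_smult mult.assoc subset_iff)
  also have "\<dots> = c \<odot>\<^bsub>A\<^esub> \<phi> w f"
    unfolding \<phi>_def using K by (intro A.finsum_smult_ldistr[symmetric]) auto
  finally show ?thesis .
qed

lemma phi_zero [simp]: "\<phi> w 0 = \<zero>\<^bsub>A\<^esub>"
  by (simp add: \<phi>_def)

lemma phi_basis:
  assumes "a \<in> carrier A" "b \<in> carrier B"
  shows "\<phi> w (basis_vec a b) = coef w b \<odot>\<^bsub>A\<^esub> a"
  using assms A.M.finsum_insert[of "{}" "(a, b)" "\<lambda>p. (Poly_Mapping.lookup (basis_vec a b) p * coef w (snd p)) \<odot>\<^bsub>A\<^esub> fst p"]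
  by (simp add: \<phi>_def)

lemma phi_diff:
  assumes "f \<in> F" "g \<in> F"
  shows "\<phi> w (f - g) = \<phi> w f \<ominus>\<^bsub>A\<^esub> \<phi> w g"
proof -
  have "f - g = f + scale_free (-1) g"
    by (rule poly_mapping_eqI) (simp add: lookup_add lookup_minus)
  then show ?thesis
    using assms
    by (simp only: phi_add phi_scale free_space_scale A.M.minus_eq A.minus_eq_smult phi_in)
qed

lemma phi_relation: "r \<in> R \<Longrightarrow> \<phi> w r = \<zero>\<^bsub>A\<^esub>"
proof -
  assume "r \<in> R"
  then have "r \<in> F \<and> \<phi> w r = \<zero>\<^bsub>A\<^esub>"
  proof (induction r rule: relations_induct)
    case (add_left a a' b)
    then show ?case
      by (simp add: phi_diff phi_basis A.smult_add_right A.add_diff_cancel_left')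
  next
    case (add_right a b b')
    then show ?case
      by (simp add: phi_diff phi_basis coef_add A.smult_add_left A.add_diff_cancel_left')
  next
    case (smult_left c a b)
    then show ?case
      by (simp add: phi_diff phi_basis phi_scale A.smult_smult mult.commute)
  next
    case (smult_right c a b)
    then show ?case
      by (simp add: phi_diff phi_basis phi_scale coef_smult A.smult_smult)
  qed (auto simp: phi_add phi_scale)
  then show ?thesis by simp
qed

text \<open>Every representation of \<open>f\<close> by elementary tensors \<open>a\<^sub>j \<otimes> b\<^sub>j\<close> bounds the left-hand side by
  \<open>\<Sum>\<^sub>j \<parallel>a\<^sub>j\<parallel> (\<Sum>\<^sub>w \<bar>coef w b\<^sub>j\<bar>) \<le> \<Sum>\<^sub>j \<parallel>a\<^sub>j\<parallel> \<parallel>b\<^sub>j\<parallel>\<close>.\<close>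

lemma phi_sum_le:
  assumes f: "f \<in> F" and W: "finite W"
  shows "(\<Sum>w\<in>W. nrm A (\<phi> w f)) \<le> nrm D (tensor_class f)"
proof (rule field_le_epsilon)
  fix e :: real assume e: "e > 0"
  obtain ts where ts: "set ts \<subseteq> pairs" "tensor_class f = tensor_sum ts"
    "weight ts < nrm D (tensor_class f) + e"
    by (rule nrm_tensor_approx[OF tensor_class_in[OF f] e])
  have "f - free_sum ts \<in> R"
    using ts(1,2) f by (simp add: tensor_class_eq_iff free_sum_in)
  have eq: "\<phi> w f = \<phi> w (free_sum ts)" for w
  proof -
    have "\<phi> w f \<ominus>\<^bsub>A\<^esub> \<phi> w (free_sum ts) = \<zero>\<^bsub>A\<^esub>"
      using phi_relation[OF \<open>f - free_sum ts \<in> R\<close>] f ts(1) by (simp add: phi_diff free_sum_in)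
    then show ?thesis
      using A.diff_add_cancel[of "\<phi> w f" "\<phi> w (free_sum ts)"] f ts(1) by (simp add: free_sum_in)
  qed
  have "(\<Sum>w\<in>W. nrm A (\<phi> w (free_sum ts))) \<le> weight ts" using ts(1)
  proof (induction ts)
    case (Cons p ts)
    obtain a b where p: "p = (a, b)" by (cases p)
    with Cons have ab: "a \<in> carrier A" "b \<in> carrier B" and t: "set ts \<subseteq> pairs" by auto
    have "(\<Sum>w\<in>W. nrm A (\<phi> w (free_sum (p # ts)))) \<le>
        (\<Sum>w\<in>W. cmod (coef w b) * nrm A a + nrm A (\<phi> w (free_sum ts)))"
    proof (rule sum_mono)
      fix w
      have "nrm A (\<phi> w (free_sum (p # ts))) = nrm A ((coef w b \<odot>\<^bsub>A\<^esub> a) \<oplus>\<^bsub>A\<^esub> \<phi> w (free_sum ts))"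
        using ab t by (simp add: p phi_add phi_basis free_sum_in)
      also have "\<dots> \<le> nrm A (coef w b \<odot>\<^bsub>A\<^esub> a) + nrm A (\<phi> w (free_sum ts))"
        using ab t by (intro A.nrm_triangle) (auto simp: free_sum_in)
      finally show "nrm A (\<phi> w (free_sum (p # ts))) \<le>
          cmod (coef w b) * nrm A a + nrm A (\<phi> w (free_sum ts))"
        using ab by (simp add: A.nrm_smult)
    qed
    also have "\<dots> = (\<Sum>w\<in>W. cmod (coef w b)) * nrm A a + (\<Sum>w\<in>W. nrm A (\<phi> w (free_sum ts)))"
      by (simp add: sum.distrib sum_distrib_right)
    also have "\<dots> \<le> nrm B b * nrm A a + weight ts"
      using Cons.IH[OF t] coef_sum_le[OF W ab(2)] A.nrm_nonneg[OF ab(1)]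
      by (intro add_mono mult_right_mono)
    finally show ?case by (simp add: p mult.commute)
  qed simp
  with ts(3) show "(\<Sum>w\<in>W. nrm A (\<phi> w f)) \<le> nrm D (tensor_class f) + e"
    unfolding eq by simp
qed

lemma phi_le: "f \<in> F \<Longrightarrow> nrm A (\<phi> w f) \<le> nrm D (tensor_class f)"
  using phi_sum_le[of f "{w}"] by simp

lemma phi_mult_gen:
  assumes f: "f \<in> F" and a: "a \<in> carrier A"
  shows "\<phi> [] (free_mult A B f (basis_vec a (x i))) = \<zero>\<^bsub>A\<^esub>"
    and "\<phi> (w @ [j]) (free_mult A B f (basis_vec a (x i))) =
      (if j = i then \<phi> w f \<otimes>\<^bsub>A\<^esub> a else \<zero>\<^bsub>A\<^esub>)"
proof -
  have bv: "basis_vec a (x i) \<in> F" using a gen_in by simp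
  have "\<phi> [] (free_mult A B f (basis_vec a (x i))) = \<zero>\<^bsub>A\<^esub> \<and>
    \<phi> (w @ [j]) (free_mult A B f (basis_vec a (x i))) =
      (if j = i then \<phi> w f \<otimes>\<^bsub>A\<^esub> a else \<zero>\<^bsub>A\<^esub>)" using f
  proof (induction f rule: free_space_induct)
    case (basis a' b)
    then show ?case using a gen_in[of i]
      by (simp add: free_mult_basis phi_basis coef_Nil_mult coef_snoc_mult A.smult_mult_left)
  next
    case (add f g)
    then show ?case using bv a
      by (auto simp: free_mult_add_left phi_add free_mult_in A.distr_left)
  next
    case (scale c f)
    then show ?case using bv a
      by (auto simp: free_mult_scale_left phi_scale free_mult_in A.smult_mult_left)
  qed (use a in simp)
  then show "\<phi> [] (free_mult A B f (basis_vec a (x i))) = \<zero>\<^bsub>A\<^esub>"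
    "\<phi> (w @ [j]) (free_mult A B f (basis_vec a (x i))) =
      (if j = i then \<phi> w f \<otimes>\<^bsub>A\<^esub> a else \<zero>\<^bsub>A\<^esub>)" by auto
qed

text \<open>Let \<open>c\<close> be a quasi-inverse of \<open>T = a\<^sub>0 \<otimes> x\<^sub>0 + a\<^sub>1 \<otimes> x\<^sub>1 + \<cdots>\<close>. In \<open>c = T + c T\<close>, the
  coefficient of \<open>c T\<close> at \<open>w i\<close> is that of \<open>c\<close> at \<open>w\<close> times \<open>a\<^sub>i\<close>. By induction, the coefficient
  of \<open>c\<close> at a nonempty word is the product of the \<open>a\<^sub>i\<close> along it, so the norm of \<open>c\<close> can serve as
  \<open>K\<close>. The coefficient maps live on algebraic tensors, hence the coefficients of \<open>c\<close> appear as
  limits along a Cauchy sequence that represents \<open>c\<close>.\<close>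

lemma word_prod_sum_bounded:
  assumes J: "jacobson_radical_algebra C"
    and a: "\<And>i. a i \<in> carrier A" and summ: "summable (\<lambda>i. nrm A (a i))"
  shows "\<exists>K. \<forall>W. finite W \<and> [] \<notin> W \<longrightarrow> (\<Sum>w\<in>W. nrm A (word_prod A (map a w))) \<le> K"
proof -
  interpret C: normed_algebra C
    unfolding projective_tensor_def by (rule D.normed_algebra_completion)
  define T where "T n = free_sum (map (\<lambda>i. (a i, x i)) [0..<n])" for n
  have T_Suc: "T (Suc n) = T n + basis_vec (a n) (x n)" and T_0: "T 0 = 0" for n
    by (simp_all add: T_def)
  have T: "T n \<in> F" for n unfolding T_def using a gen_in by (intro free_sum_in) auto
  define X where "X n = tensor_class (T n)" for n
  have XD: "X n \<in> carrier D" for n using T by (simp add: X_def)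
  have XC: "X \<in> cauchy_seqs D"
  proof (rule D.cauchy_seqs_summable[OF XD summ])
    fix n
    have "X (Suc n) = X n \<oplus>\<^bsub>D\<^esub> tensor_class (basis_vec (a n) (x n))"
      using T a gen_in by (simp add: X_def T_Suc tensor_add)
    then have "X (Suc n) \<ominus>\<^bsub>D\<^esub> X n = tensor_sum [(a n, x n)]"
      using XD[of n] a gen_in by (simp add: D.add_diff_cancel_left')
    then have "nrm D (X (Suc n) \<ominus>\<^bsub>D\<^esub> X n) \<le> weight [(a n, x n)]"
      using a gen_in nrm_tensor_le[of "[(a n, x n)]"] by simp
    also have "\<dots> \<le> nrm A (a n)"
      using mult_left_mono[OF nrm_gen[of n] A.nrm_nonneg[OF a[of n]]] by simp
    finally show "nrm D (X (Suc n) \<ominus>\<^bsub>D\<^esub> X n) \<le> nrm A (a n)" .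
  qed
  have "D.completion_class X \<in> carrier C"
    using XC by (simp add: projective_tensor_def D.completion_carrier)
  with J have "\<exists>c\<in>carrier C. c = D.completion_class X \<oplus>\<^bsub>C\<^esub> c \<otimes>\<^bsub>C\<^esub> D.completion_class X"
    unfolding jacobson_radical_algebra_iff[OF C.complex_algebra_axioms] by (rule bspec)
  then obtain c where c: "c \<in> carrier C"
    and c_eq: "c = D.completion_class X \<oplus>\<^bsub>C\<^esub> c \<otimes>\<^bsub>C\<^esub> D.completion_class X"
    by (rule bexE)
  obtain Y where Y: "Y \<in> cauchy_seqs D" "c = D.completion_class Y"
    using c by (auto simp: projective_tensor_def D.completion_carrier)
  have "\<exists>f\<in>F. Y n = tensor_class f" for n
    using D.cauchy_seqsD[OF Y(1), of n] by (auto simp: tensor_carrier)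
  then obtain y where y: "\<And>n. y n \<in> F" "\<And>n. Y n = tensor_class (y n)" by metis
  \<comment> \<open>The defect of the equation \<open>c = T + c T\<close> at the \<open>n\<close>th approximation.\<close>
  define z where "z n = y n - (T n + free_mult A B (y n) (T n))" for n
  have z: "z n \<in> F" for n using y(1) T by (auto simp: z_def free_mult_in)
  have z_class: "tensor_class (z n) = Y n \<ominus>\<^bsub>D\<^esub> (X n \<oplus>\<^bsub>D\<^esub> Y n \<otimes>\<^bsub>D\<^esub> X n)" for n
  proof -
    have "z n + (T n + free_mult A B (y n) (T n)) = y n" by (simp add: z_def)
    then have "tensor_class (z n) \<oplus>\<^bsub>D\<^esub> (X n \<oplus>\<^bsub>D\<^esub> Y n \<otimes>\<^bsub>D\<^esub> X n) = Y n"
      using z T y(1) by (simp add: X_def y(2) tensor_add tensor_mult free_mult_in)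
    then show ?thesis
      using z[of n] XD[of n] y D.add_diff_cancel_right'[of "tensor_class (z n)" "X n \<oplus>\<^bsub>D\<^esub> Y n \<otimes>\<^bsub>D\<^esub> X n"]
      by (metis D.M.a_closed D.mult_in tensor_class_in)
  qed
  have z_lim: "(\<lambda>n. nrm D (tensor_class (z n))) \<longlonglongrightarrow> 0"
  proof -
    have YX: "(\<lambda>n. Y n \<otimes>\<^bsub>D\<^esub> X n) \<in> cauchy_seqs D" by (rule D.cauchy_seqs_mult[OF Y(1) XC])
    have "D.completion_class Y = D.completion_class (\<lambda>n. X n \<oplus>\<^bsub>D\<^esub> Y n \<otimes>\<^bsub>D\<^esub> X n)"
      using c_eq unfolding Y(2) projective_tensor_def D.completion_mult[OF Y(1) XC]
        D.completion_add[OF XC YX] .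
    then show ?thesis
      unfolding z_class D.completion_class_eq_iff[OF Y(1) D.cauchy_seqs_add[OF XC YX]] .
  qed
  have phi_z: "(\<lambda>n. nrm A (\<phi> w (z n))) \<longlonglongrightarrow> 0" for w
    by (rule tendsto_sandwich[OF _ _ tendsto_const z_lim])
      (use phi_le[OF z] z in \<open>auto intro!: always_eventually A.nrm_nonneg\<close>)
  have phi_z_eq: "\<phi> w (z n) = \<phi> w (y n) \<ominus>\<^bsub>A\<^esub> (\<phi> w (T n) \<oplus>\<^bsub>A\<^esub> \<phi> w (free_mult A B (y n) (T n)))" for w n
    unfolding z_def using y(1) T by (simp add: phi_diff phi_add free_mult_in)
  have phi_T: "\<phi> w (T n) = (if \<exists>i<n. w = [i] then a (hd w) else \<zero>\<^bsub>A\<^esub>)" for w n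
    by (induction n) (use a gen_in T in \<open>auto simp: T_0 T_Suc phi_add phi_basis coef_gen less_Suc_eq\<close>)
  have phi_yT_Nil: "\<phi> [] (free_mult A B f (T n)) = \<zero>\<^bsub>A\<^esub>" if "f \<in> F" for f n
    by (induction n)
      (use that a gen_in T in \<open>auto simp: T_0 T_Suc free_mult_add_right phi_add free_mult_in phi_mult_gen\<close>)
  have phi_yT_snoc: "\<phi> (w @ [i]) (free_mult A B f (T n)) = (if i < n then \<phi> w f \<otimes>\<^bsub>A\<^esub> a i else \<zero>\<^bsub>A\<^esub>)"
    if "f \<in> F" for f n w i
    by (induction n)
      (use that a gen_in T in \<open>auto simp: T_0 T_Suc free_mult_add_right phi_add free_mult_in phi_mult_gen less_Suc_eq\<close>)
  \<comment> \<open>The coefficient of \<open>c\<close> at the empty word is \<open>0\<close>, as neither \<open>T\<close> nor \<open>c T\<close> has one.\<close>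
  define q where "q w = (if w = [] then \<zero>\<^bsub>A\<^esub> else word_prod A (map a w))" for w
  have q: "q w \<in> carrier A" for w
    using a by (auto simp: q_def intro!: A.semi.word_prod_in)
  have q_snoc: "q (w @ [i]) = (if w = [] then a i else \<zero>\<^bsub>A\<^esub>) \<oplus>\<^bsub>A\<^esub> q w \<otimes>\<^bsub>A\<^esub> a i" for w i
  proof (cases "w = []")
    case False
    have "word_prod A (map a w) \<in> carrier A" using a by (intro A.semi.word_prod_in) auto
    with False show ?thesis
      using a A.semi.word_prod_snoc[of "map a w" "a i"] by (auto simp: q_def)
  qed (simp add: q_def a)
  have lim_q: "(\<lambda>n. nrm A (\<phi> w (y n) \<ominus>\<^bsub>A\<^esub> q w)) \<longlonglongrightarrow> 0" for w
  proof (induction w rule: rev_induct)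
    case Nil
    have "\<phi> [] (z n) = \<phi> [] (y n) \<ominus>\<^bsub>A\<^esub> q []" for n
      unfolding phi_z_eq using y(1) by (simp add: phi_T phi_yT_Nil q_def)
    then show ?case using phi_z[of "[]"] by simp
  next
    case (snoc i w)
    have le: "nrm A (\<phi> (w @ [i]) (y n) \<ominus>\<^bsub>A\<^esub> q (w @ [i])) \<le>
        nrm A (\<phi> (w @ [i]) (z n)) + nrm A (\<phi> w (y n) \<ominus>\<^bsub>A\<^esub> q w) * nrm A (a i)" if n: "n > i" for n
    proof -
      define u where "u = (if w = [] then a i else \<zero>\<^bsub>A\<^esub>)"
      have u: "u \<in> carrier A" using a by (simp add: u_def)
      note yw = phi_in[OF y(1)[of n]]
      have v: "u \<oplus>\<^bsub>A\<^esub> \<phi> w (y n) \<otimes>\<^bsub>A\<^esub> a i \<in> carrier A" using u a yw by auto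
      have "\<phi> (w @ [i]) (z n) = \<phi> (w @ [i]) (y n) \<ominus>\<^bsub>A\<^esub> (u \<oplus>\<^bsub>A\<^esub> \<phi> w (y n) \<otimes>\<^bsub>A\<^esub> a i)"
        unfolding phi_z_eq phi_T phi_yT_snoc[OF y(1)] using n by (auto simp: u_def)
      moreover have "nrm A ((u \<oplus>\<^bsub>A\<^esub> \<phi> w (y n) \<otimes>\<^bsub>A\<^esub> a i) \<ominus>\<^bsub>A\<^esub> q (w @ [i])) \<le>
          nrm A (\<phi> w (y n) \<ominus>\<^bsub>A\<^esub> q w) * nrm A (a i)"
      proof -
        have "(u \<oplus>\<^bsub>A\<^esub> \<phi> w (y n) \<otimes>\<^bsub>A\<^esub> a i) \<ominus>\<^bsub>A\<^esub> q (w @ [i]) = (\<phi> w (y n) \<ominus>\<^bsub>A\<^esub> q w) \<otimes>\<^bsub>A\<^esub> a i"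
          unfolding q_snoc u_def[symmetric] using u a yw q by (simp add: A.add_diff_add A.diff_mult)
        then show ?thesis using a yw q by (simp add: A.nrm_mult)
      qed
      ultimately show ?thesis
        using A.semi.nrm_diff_triangle[OF yw v q, of "w @ [i]" "w @ [i]"] by simp
    qed
    show ?case
    proof (rule tendsto_sandwich[OF _ _ tendsto_const])
      show "(\<lambda>n. nrm A (\<phi> (w @ [i]) (z n)) + nrm A (\<phi> w (y n) \<ominus>\<^bsub>A\<^esub> q w) * nrm A (a i)) \<longlonglongrightarrow> 0"
        using tendsto_add[OF phi_z[of "w @ [i]"] tendsto_mult_right[OF snoc, of "nrm A (a i)"]] by simp
      show "\<forall>\<^sub>F n in sequentially. nrm A (\<phi> (w @ [i]) (y n) \<ominus>\<^bsub>A\<^esub> q (w @ [i])) \<le>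
          nrm A (\<phi> (w @ [i]) (z n)) + nrm A (\<phi> w (y n) \<ominus>\<^bsub>A\<^esub> q w) * nrm A (a i)"
        using eventually_gt_at_top[of i] by (rule eventually_mono) (rule le)
    qed (use y q in \<open>auto intro!: always_eventually A.nrm_nonneg\<close>)
  qed
  have lim_nrm: "(\<lambda>n. nrm A (\<phi> w (y n))) \<longlonglongrightarrow> nrm A (q w)" for w
  proof -
    have "(\<lambda>n. nrm A (\<phi> w (y n)) - nrm A (q w)) \<longlonglongrightarrow> 0"
      by (rule tendsto_0_le[OF lim_q[of w], where K = 1])
        (use y q A.semi.abs_nrm_diff_le A.nrm_nonneg in \<open>auto intro!: always_eventually\<close>)
    then show ?thesis by (simp add: LIM_zero_iff)
  qed
  have "(\<Sum>w\<in>W. nrm A (word_prod A (map a w))) \<le> nrm C c" if W: "finite W" "[] \<notin> W" for W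
  proof -
    have "(\<lambda>n. nrm D (Y n)) \<longlonglongrightarrow> nrm C c"
      using D.completion_nrm[OF Y(1)] Y(2) by (simp add: projective_tensor_def)
    moreover have "(\<lambda>n. \<Sum>w\<in>W. nrm A (\<phi> w (y n))) \<longlonglongrightarrow> (\<Sum>w\<in>W. nrm A (q w))"
      using lim_nrm by (intro tendsto_sum)
    moreover have "(\<Sum>w\<in>W. nrm A (\<phi> w (y n))) \<le> nrm D (Y n)" for n
      unfolding y(2) using y(1) W(1) by (rule phi_sum_le)
    ultimately have "(\<Sum>w\<in>W. nrm A (q w)) \<le> nrm C c"
      using LIMSEQ_le by blast
    also have "(\<Sum>w\<in>W. nrm A (q w)) = (\<Sum>w\<in>W. nrm A (word_prod A (map a w)))"
      using W(2) by (intro sum.cong) (auto simp: q_def)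
    finally show ?thesis .
  qed
  then show ?thesis by blast
qed

text \<open>The previous lemma is applied to the multiples \<open>t s\<close> of the nonzero elements \<open>s\<close> of \<open>S\<close>,
  numbered by an injection \<open>g\<close> into the natural numbers. Numbers outside its range are assigned \<open>0\<close>.\<close>

lemma jacobson_radical_imp_one_quasinilpotent:
  assumes J: "jacobson_radical_algebra C"
  shows "one_quasinilpotent A"
  unfolding one_quasinilpotent_def
proof (intro allI impI)
  fix S assume "S \<subseteq> carrier A \<and> summable_gen A (gen_of_set S)"
  then have S: "S \<subseteq> carrier A" and Ss: "nrm A summable_on S"
    and M: "snd (gen_of_set S) ` fst (gen_of_set S) \<subseteq> carrier A" "summable_gen A (gen_of_set S)"
    by (auto simp: summable_gen_def gen_of_set_def)
  define S0 where "S0 = {s \<in> S. s \<noteq> \<zero>\<^bsub>A\<^esub>}"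
  have "S0 = {s \<in> S. nrm A s \<noteq> 0}" using S by (auto simp: S0_def A.nrm_eq_0_iff)
  then have "countable S0" using summable_countable_real[OF Ss] by simp
  define g where "g = to_nat_on S0"
  have g: "inj_on g S0" unfolding g_def using \<open>countable S0\<close> by (rule inj_on_to_nat_on)
  have S0: "S0 \<subseteq> S" "S0 \<subseteq> carrier A" using S by (auto simp: S0_def)
  show "rho1 A (gen_of_set S) = 0"
  proof (rule A.semi.rho1_eq_0I[OF M])
    fix t :: real assume t: "t > 0"
    define a where "a n = (if n \<in> g ` S0 then of_real t \<odot>\<^bsub>A\<^esub> inv_into S0 g n else \<zero>\<^bsub>A\<^esub>)" for n
    have ag: "a (g s) = of_real t \<odot>\<^bsub>A\<^esub> s" if "s \<in> S0" for s using that g by (simp add: a_def)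
    have a: "a n \<in> carrier A" for n
      using S0(2) inv_into_into[of n g S0] by (auto simp: a_def)
    have "(\<lambda>n. nrm A (a n)) summable_on g ` S0"
    proof -
      have "(\<lambda>s. t * nrm A s) summable_on S0"
        using summable_on_subset[OF Ss S0(1)] by (intro summable_on_cmult_right)
      then have "(\<lambda>s. nrm A (a (g s))) summable_on S0"
        by (rule summable_on_cong[THEN iffD1, rotated])
          (use ag t S0 in \<open>auto simp: A.nrm_smult\<close>)
      then show ?thesis by (simp add: summable_on_reindex[OF g] o_def)
    qed
    then have "(\<lambda>n. nrm A (a n)) summable_on UNIV"
      by (rule summable_on_cong_neutral[THEN iffD1, rotated -1]) (auto simp: a_def)
    then have "summable (\<lambda>n. nrm A (a n))"
      using A.nrm_nonneg[OF a] by (simp add: summable_on_UNIV_nonneg_real_iff)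
    from word_prod_sum_bounded[OF J a this] obtain K
      where "\<forall>W. finite W \<and> [] \<notin> W \<longrightarrow> (\<Sum>w\<in>W. nrm A (word_prod A (map a w))) \<le> K"
      by (rule exE)
    then have K: "(\<Sum>w\<in>W. nrm A (word_prod A (map a w))) \<le> K" if "finite W" "[] \<notin> W" for W
      using that by simp
    have "t ^ n * norm1 A (gen_power A (gen_of_set S) n) \<le> K" if n: "n \<ge> 1" for n
    proof -
      have "(\<Sum>w\<in>W. nrm A (word_prod A w)) \<le> K / t ^ n" if W: "finite W" "W \<subseteq> words n S0" for W
      proof -
        have inj: "inj_on (map g) W"
          using W inj_on_subset[OF inj_on_map_lists[OF g], of W] by (auto simp: lists_eq_set)
        have wt: "t ^ n * nrm A (word_prod A w) = nrm A (word_prod A (map a (map g w)))" if w: "w \<in> W" for w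
        proof -
          have wS: "set w \<subseteq> S0" "length w = n" using w W by auto
          have m: "map a (map g w) = map (\<lambda>s. of_real t \<odot>\<^bsub>A\<^esub> s) w" using wS ag by auto
          have p: "prod_list (map (\<lambda>s. of_real t) w) = (of_real t ^ n :: complex)"
            unfolding wS(2)[symmetric] by (induction w) auto
          have "word_prod A (map (\<lambda>s. of_real t \<odot>\<^bsub>A\<^esub> s) w) =
              prod_list (map (\<lambda>s. of_real t) w) \<odot>\<^bsub>A\<^esub> word_prod A (map (\<lambda>s. s) w)"
            using wS S0 by (intro A.semi.word_prod_smult) auto
          then have "word_prod A (map a (map g w)) = of_real t ^ n \<odot>\<^bsub>A\<^esub> word_prod A w"
            unfolding m p by simp
          moreover have "word_prod A w \<in> carrier A" using wS S0 by (intro A.semi.word_prod_in) auto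
          ultimately show ?thesis using t by (simp only: A.nrm_smult) (simp add: norm_power)
        qed
        have "t ^ n * (\<Sum>w\<in>W. nrm A (word_prod A w)) = (\<Sum>w\<in>W. nrm A (word_prod A (map a (map g w))))"
          unfolding sum_distrib_left using wt by (intro sum.cong refl)
        also have "\<dots> = (\<Sum>v\<in>map g ` W. nrm A (word_prod A (map a v)))"
          by (simp add: sum.reindex[OF inj] o_def)
        also have "\<dots> \<le> K" using W n by (intro K) auto
        finally show ?thesis using t by (simp add: field_simps)
      qed
      then have "norm1 A (gen_power A (gen_of_set S) n) \<le> K / t ^ n"
        by (intro A.semi.norm1_gen_power_le[OF M]) (simp_all add: gen_of_set_def S0_def)
      then show ?thesis using t by (simp add: field_simps)
    qed
    then show "\<exists>K. \<forall>n\<ge>1. t ^ n * norm1 A (gen_power A (gen_of_set S) n) \<le> K" by blast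
  qed
qed

end


section \<open>The \<open>\<ell>\<^sup>1\<close> algebra of the free monoid\<close>

definition l1 :: "(nat list \<Rightarrow> complex) set" where
  "l1 = {f. (\<lambda>w. cmod (f w)) summable_on UNIV}"

definition l1_norm :: "(nat list \<Rightarrow> complex) \<Rightarrow> real" where
  "l1_norm f = (\<Sum>\<^sub>\<infinity>w. cmod (f w))"

definition convolution :: "(nat list \<Rightarrow> complex) \<Rightarrow> (nat list \<Rightarrow> complex) \<Rightarrow> nat list \<Rightarrow> complex" where
  "convolution f g w = (\<Sum>k\<le>length w. f (take k w) * g (drop k w))"

lemma l1_sum_le: "\<lbrakk>f \<in> l1; finite W\<rbrakk> \<Longrightarrow> (\<Sum>w\<in>W. cmod (f w)) \<le> l1_norm f"
  unfolding l1_def l1_norm_def by (intro finite_sum_le_infsum) auto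

lemma l1I:
  assumes "\<And>W. finite W \<Longrightarrow> (\<Sum>w\<in>W. cmod (f w)) \<le> K"
  shows "f \<in> l1" "l1_norm f \<le> K"
proof -
  show f: "f \<in> l1"
    unfolding l1_def mem_Collect_eq
    by (intro nonneg_bdd_above_summable_on bdd_aboveI2[of _ _ K]) (auto intro: assms)
  show "l1_norm f \<le> K"
    using f unfolding l1_def l1_norm_def by (intro infsum_le_finite_sums) (auto intro: assms)
qed

lemma l1_norm_nonneg: "0 \<le> l1_norm f"
  unfolding l1_norm_def by (intro infsum_nonneg) auto

lemma l1_le_norm: "f \<in> l1 \<Longrightarrow> cmod (f w) \<le> l1_norm f"
  using l1_sum_le[of f "{w}"] by simp

lemma l1_zero: "(\<lambda>w. 0) \<in> l1" "l1_norm (\<lambda>w. 0) = 0"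
  by (simp_all add: l1_def l1_norm_def)

lemma l1_add:
  assumes "f \<in> l1" "g \<in> l1"
  shows "(\<lambda>w. f w + g w) \<in> l1" "l1_norm (\<lambda>w. f w + g w) \<le> l1_norm f + l1_norm g"
proof -
  have "(\<Sum>w\<in>W. cmod (f w + g w)) \<le> l1_norm f + l1_norm g" if "finite W" for W
  proof -
    have "(\<Sum>w\<in>W. cmod (f w + g w)) \<le> (\<Sum>w\<in>W. cmod (f w)) + (\<Sum>w\<in>W. cmod (g w))"
      unfolding sum.distrib[symmetric] by (intro sum_mono norm_triangle_ineq)
    also have "\<dots> \<le> l1_norm f + l1_norm g" using assms that by (intro add_mono l1_sum_le)
    finally show ?thesis .
  qed
  from l1I[OF this] show "(\<lambda>w. f w + g w) \<in> l1" "l1_norm (\<lambda>w. f w + g w) \<le> l1_norm f + l1_norm g"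
    by auto
qed

lemma l1_scale:
  assumes "f \<in> l1"
  shows "(\<lambda>w. c * f w) \<in> l1" "l1_norm (\<lambda>w. c * f w) = cmod c * l1_norm f"
  using assms by (auto simp: l1_def l1_norm_def norm_mult infsum_cmult_right' intro: summable_on_cmult_right)

lemma l1_diff:
  assumes "f \<in> l1" "g \<in> l1"
  shows "(\<lambda>w. f w - g w) \<in> l1"
  using l1_add(1)[OF assms(1) l1_scale(1)[OF assms(2), of "-1"]] by simp

lemma l1_norm_minus: "l1_norm (\<lambda>w. f w - g w) = l1_norm (\<lambda>w. g w - f w)"
  by (simp add: l1_norm_def norm_minus_commute)

lemma l1_norm_eq_0: "f \<in> l1 \<Longrightarrow> l1_norm f = 0 \<longleftrightarrow> f = (\<lambda>w. 0)"
  using l1_le_norm[of f] l1_zero(2) by fastforce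

text \<open>The pairs obtained by cutting the words of a finite set in two are distinct, so they are
  among the terms of a product of two finite partial sums.\<close>

lemma l1_convolution:
  assumes "f \<in> l1" "g \<in> l1"
  shows "convolution f g \<in> l1" "l1_norm (convolution f g) \<le> l1_norm f * l1_norm g"
proof -
  have "(\<Sum>w\<in>W. cmod (convolution f g w)) \<le> l1_norm f * l1_norm g" if W: "finite W" for W
  proof -
    let ?h = "\<lambda>(u, v). cmod (f u) * cmod (g v)"
    let ?s = "\<lambda>(w, k). (take k w, drop k w)"
    define P where "P = (SIGMA w:W. {..length w})"
    have P: "finite P" using W by (simp add: P_def)
    have inj: "inj_on ?s P"
    proof (rule inj_onI)
      fix p q assume pq: "p \<in> P" "q \<in> P" "?s p = ?s q"
      obtain w k w' k' where p: "p = (w, k)" and q: "q = (w', k')" by (cases p, cases q)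
      have t: "take k w = take k' w'" "drop k w = drop k' w'" using pq(3) p q by simp_all
      have "w = take k w @ drop k w" by simp
      also have "\<dots> = take k' w' @ drop k' w'" by (simp only: t)
      also have "\<dots> = w'" by simp
      finally have "w = w'" .
      moreover have "length (take k w) = length (take k' w')" by (simp only: t(1))
      then have "k = k'" using pq(1,2) p q by (simp add: P_def)
      ultimately show "p = q" using p q by simp
    qed
    have "(\<Sum>w\<in>W. cmod (convolution f g w)) \<le>
        (\<Sum>w\<in>W. \<Sum>k\<le>length w. cmod (f (take k w)) * cmod (g (drop k w)))"
      unfolding convolution_def norm_mult[symmetric] by (intro sum_mono norm_sum)
    also have "\<dots> = (\<Sum>p\<in>P. ?h (?s p))"
      unfolding P_def using W by (subst sum.Sigma) (auto intro!: sum.cong)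
    also have "\<dots> = (\<Sum>q\<in>?s ` P. ?h q)"
      by (subst sum.reindex[OF inj]) (simp add: o_def)
    also have "\<dots> \<le> (\<Sum>q\<in>fst ` ?s ` P \<times> snd ` ?s ` P. ?h q)"
      using P by (intro sum_mono2) (auto intro: rev_image_eqI)
    also have "\<dots> = (\<Sum>u\<in>fst ` ?s ` P. cmod (f u)) * (\<Sum>v\<in>snd ` ?s ` P. cmod (g v))"
      by (simp add: sum_product sum.cartesian_product)
    also have "\<dots> \<le> l1_norm f * l1_norm g"
      using P assms by (intro mult_mono l1_sum_le sum_nonneg l1_norm_nonneg) auto
    finally show ?thesis .
  qed
  from l1I[OF this] show "convolution f g \<in> l1" "l1_norm (convolution f g) \<le> l1_norm f * l1_norm g"
    by auto
qed

text \<open>Both sides sum over the ways to cut a word into three parts.\<close>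

lemma convolution_assoc: "convolution (convolution f g) h = convolution f (convolution g h)"
proof
  fix w :: "nat list"
  let ?n = "length w"
  \<comment> \<open>The cuts are made after \<open>j\<close> and after \<open>k \<ge> j\<close> letters.\<close>
  define F where "F j k = f (take j w) * g (take (k - j) (drop j w)) * h (drop k w)" for j k
  have "convolution (convolution f g) h w = (\<Sum>k\<le>?n. \<Sum>j\<le>k. F j k)"
    unfolding convolution_def sum_distrib_right
    by (intro sum.cong refl) (auto simp: F_def min_def drop_take intro!: sum.cong)
  also have "\<dots> = (\<Sum>(k, j)\<in>(SIGMA k:{..?n}. {..k}). F j k)"
    by (subst sum.Sigma) auto
  also have "\<dots> = (\<Sum>(j, i)\<in>(SIGMA j:{..?n}. {..?n - j}). F j (i + j))"
    by (rule sum.reindex_bij_witness[of _ "\<lambda>(j, i). (i + j, j)" "\<lambda>(k, j). (j, k - j)"]) auto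
  also have "\<dots> = (\<Sum>j\<le>?n. \<Sum>i\<le>?n - j. F j (i + j))"
    by (subst sum.Sigma) auto
  also have "\<dots> = convolution f (convolution g h) w"
    unfolding convolution_def sum_distrib_left
    by (intro sum.cong refl) (auto simp: F_def mult.assoc intro!: sum.cong)
  finally show "convolution (convolution f g) h w = convolution f (convolution g h) w" .
qed

lemma l1_complete:
  fixes X :: "nat \<Rightarrow> nat list \<Rightarrow> complex"
  assumes X: "\<And>n. X n \<in> l1"
    and cauchy: "\<And>e. e > 0 \<Longrightarrow> \<exists>N. \<forall>m\<ge>N. \<forall>n\<ge>N. l1_norm (\<lambda>w. X m w - X n w) < e"
  shows "\<exists>f\<in>l1. \<forall>e>0. \<exists>N. \<forall>n\<ge>N. l1_norm (\<lambda>w. X n w - f w) \<le> e"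
proof -
  have "Cauchy (\<lambda>n. X n w)" for w
    unfolding Cauchy_def dist_norm
  proof (intro allI impI)
    fix e :: real assume "e > 0"
    then obtain N where N: "\<And>m n. m \<ge> N \<Longrightarrow> n \<ge> N \<Longrightarrow> l1_norm (\<lambda>w. X m w - X n w) < e"
      using cauchy by blast
    have "cmod (X m w - X n w) < e" if "m \<ge> N" "n \<ge> N" for m n
      using l1_le_norm[OF l1_diff[OF X[of m] X[of n]], of w] N[OF that] by simp
    then show "\<exists>M. \<forall>m\<ge>M. \<forall>n\<ge>M. cmod (X m w - X n w) < e" by blast
  qed
  then have "\<exists>l. (\<lambda>n. X n w) \<longlonglongrightarrow> l" for w
    by (simp add: Cauchy_convergent_iff convergent_def)
  then obtain f where f: "\<And>w. (\<lambda>n. X n w) \<longlonglongrightarrow> f w" by metis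
  have key: "\<exists>N. \<forall>m\<ge>N. (\<lambda>w. X m w - f w) \<in> l1 \<and> l1_norm (\<lambda>w. X m w - f w) \<le> e" if e: "e > 0" for e
  proof -
    obtain N where N: "\<And>m n. m \<ge> N \<Longrightarrow> n \<ge> N \<Longrightarrow> l1_norm (\<lambda>w. X m w - X n w) < e"
      using cauchy[OF e] by blast
    have bound: "(\<Sum>w\<in>W. cmod (X m w - f w)) \<le> e" if "finite W" "m \<ge> N" for W m
    proof (rule LIMSEQ_le_const2)
      show "(\<lambda>n. \<Sum>w\<in>W. cmod (X m w - X n w)) \<longlonglongrightarrow> (\<Sum>w\<in>W. cmod (X m w - f w))"
        by (intro tendsto_intros f)
      have "(\<Sum>w\<in>W. cmod (X m w - X n w)) \<le> e" if "n \<ge> N" for n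
        using l1_sum_le[OF l1_diff[OF X[of m] X[of n]] \<open>finite W\<close>] N[OF \<open>m \<ge> N\<close> that] by simp
      then show "\<exists>N. \<forall>n\<ge>N. (\<Sum>w\<in>W. cmod (X m w - X n w)) \<le> e" by blast
    qed
    have "(\<lambda>w. X m w - f w) \<in> l1 \<and> l1_norm (\<lambda>w. X m w - f w) \<le> e" if "m \<ge> N" for m
      using l1I[of "\<lambda>w. X m w - f w" e] bound[OF _ that] by simp
    then show ?thesis by (intro exI[of _ N]) simp
  qed
  obtain m where m: "(\<lambda>w. X m w - f w) \<in> l1" using key[of 1] by auto
  have "f \<in> l1" using l1_diff[OF X[of m] m] by simp
  moreover have "\<exists>N. \<forall>n\<ge>N. l1_norm (\<lambda>w. X n w - f w) \<le> e" if e: "e > 0" for e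
  proof -
    obtain N where "\<forall>m\<ge>N. (\<lambda>w. X m w - f w) \<in> l1 \<and> l1_norm (\<lambda>w. X m w - f w) \<le> e"
      using key[OF e] by (rule exE)
    then show ?thesis by (intro exI[of _ N]) simp
  qed
  ultimately show ?thesis by (intro bexI[of _ f] allI impI)
qed

definition word_delta :: "nat \<Rightarrow> nat list \<Rightarrow> complex" where
  "word_delta i w = (if w = [i] then 1 else 0)"

lemma word_delta: "word_delta i \<in> l1" "l1_norm (word_delta i) \<le> 1"
proof -
  have "(\<Sum>w\<in>W. cmod (word_delta i w)) \<le> 1" if "finite W" for W
  proof -
    have "(\<Sum>w\<in>W. cmod (word_delta i w)) = (\<Sum>w\<in>W. if w = [i] then 1 else 0)"
      by (intro sum.cong) (auto simp: word_delta_def)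
    also have "\<dots> \<le> 1" using that by (simp add: sum.delta')
    finally show ?thesis .
  qed
  from l1I[OF this] show "word_delta i \<in> l1" "l1_norm (word_delta i) \<le> 1" by auto
qed

lemma convolution_delta:
  "convolution f (word_delta i) [] = 0"
  "convolution f (word_delta i) (w @ [j]) = (if j = i then f w else 0)"
proof -
  show "convolution f (word_delta i) [] = 0" by (simp add: convolution_def word_delta_def)
  have "convolution f (word_delta i) (w @ [j]) =
      (\<Sum>k\<le>length (w @ [j]). if k = length w then (if j = i then f w else 0) else 0)"
    unfolding convolution_def
  proof (rule sum.cong)
    fix k assume k: "k \<in> {..length (w @ [j])}"
    have "drop k (w @ [j]) = [i] \<longleftrightarrow> k = length w \<and> j = i"
    proof
      assume d: "drop k (w @ [j]) = [i]"
      from arg_cong[OF d, of length] have "k = length w" using k by simp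
      with d show "k = length w \<and> j = i" by simp
    qed simp
    then show "f (take k (w @ [j])) * word_delta i (drop k (w @ [j])) =
        (if k = length w then (if j = i then f w else 0) else 0)"
      by (simp add: word_delta_def)
  qed simp
  also have "\<dots> = (if j = i then f w else 0)" by (simp add: sum.delta)
  finally show "convolution f (word_delta i) (w @ [j]) = (if j = i then f w else 0)" .
qed

text \<open>Real numbers are coded by sets of natural numbers. Hence a function can be coded by the
  countable set of all triples of an argument, the choice between real and imaginary part, and an
  element of the code of that part of the value.\<close>

lemma functions_lepoll_complex:
  "(UNIV :: (nat list \<Rightarrow> complex) set) \<lesssim> (UNIV :: complex set)"
proof -
  obtain r :: "real \<Rightarrow> nat set" where r: "inj r"
    using eqpoll_imp_lepoll[OF eqpoll_sym[OF nat_sets_eqpoll_reals]] by (auto simp: lepoll_def)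
  obtain s :: "nat set \<Rightarrow> real" where s: "inj s"
    using eqpoll_imp_lepoll[OF nat_sets_eqpoll_reals] by (auto simp: lepoll_def)
  define code :: "(nat list \<Rightarrow> complex) \<Rightarrow> nat set" where
    "code f = to_nat ` {(w, b, n). n \<in> r (if b then Re (f w) else Im (f w))}" for f
  have "inj code"
  proof (rule injI)
    fix f g assume "code f = code g"
    then have eq: "{(w, b, n). n \<in> r (if b then Re (f w) else Im (f w))} =
        {(w, b, n). n \<in> r (if b then Re (g w) else Im (g w))}"
      unfolding code_def by (simp add: inj_image_eq_iff)
    have "r (Re (f w)) = r (Re (g w)) \<and> r (Im (f w)) = r (Im (g w))" for w
    proof -
      have "n \<in> r (if b then Re (f w) else Im (f w)) \<longleftrightarrow> n \<in> r (if b then Re (g w) else Im (g w))" for b n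
        using arg_cong[OF eq, of "\<lambda>S. (w, b, n) \<in> S"] by simp
      from this[where b = True] this[where b = False] show ?thesis by auto
    qed
    then show "f = g" using r by (auto simp: fun_eq_iff complex_eq_iff inj_eq)
  qed
  then have "inj (\<lambda>f. complex_of_real (s (code f)))"
    using s by (auto simp: inj_def)
  then show ?thesis by (auto simp: lepoll_def)
qed


text \<open>The algebra \<open>\<ell>\<^sup>1\<close> of the free monoid is transported along an injection \<open>h\<close> into the given type.
  The axioms of metric spaces demand symmetry and nonnegativity of the distance at all points of
  the type, including those outside the carrier. Therefore the operations and the norm are composed
  with a retraction: \<open>k\<close> inverts \<open>h\<close> on the carrier and maps all other points to \<open>0\<close>.\<close>

lemma free_generators_exist:
  assumes "(UNIV :: complex set) \<lesssim> (UNIV :: 'b set)"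
  shows "\<exists>(B :: 'b normed_alg) x coef. banach_algebra B \<and> free_generators B x coef"
proof -
  have "(UNIV :: (nat list \<Rightarrow> complex) set) \<lesssim> (UNIV :: 'b set)"
    using functions_lepoll_complex assms by (rule lepoll_trans)
  then obtain h :: "(nat list \<Rightarrow> complex) \<Rightarrow> 'b" where h: "inj h" by (auto simp: lepoll_def)
  define k where "k y = (if y \<in> h ` l1 then inv_into l1 h y else (\<lambda>w. 0))" for y
  have k: "k y \<in> l1" for y by (auto simp: k_def l1_zero intro: inv_into_into)
  have kh: "k (h f) = f" if "f \<in> l1" for f
    using that inj_on_subset[OF h, of l1] by (simp add: k_def)
  define B :: "'b normed_alg" where
    "B = \<lparr>carrier = h ` l1, monoid.mult = (\<lambda>y z. h (convolution (k y) (k z))), one = undefined,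
      ring.zero = h (\<lambda>w. 0), add = (\<lambda>y z. h (\<lambda>w. k y w + k z w)),
      module.smult = (\<lambda>c y. h (\<lambda>w. c * k y w)), nrm = (\<lambda>y. l1_norm (k y))\<rparr>"
  have B_simps: "carrier B = h ` l1" "y \<otimes>\<^bsub>B\<^esub> z = h (convolution (k y) (k z))"
    "\<zero>\<^bsub>B\<^esub> = h (\<lambda>w. 0)" "y \<oplus>\<^bsub>B\<^esub> z = h (\<lambda>w. k y w + k z w)"
    "c \<odot>\<^bsub>B\<^esub> y = h (\<lambda>w. c * k y w)" "nrm B y = l1_norm (k y)" for y z c
    by (simp_all add: B_def)
  have h_eq: "h f = h g \<longleftrightarrow> f = g" for f g using h by (rule inj_eq)
  have alg: "complex_algebra B"
  proof (rule complex_algebra_image)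
    define P :: "(complex, nat list \<Rightarrow> complex) module" where
      "P = \<lparr>carrier = l1, monoid.mult = convolution, one = undefined, ring.zero = (\<lambda>w. 0),
        add = (\<lambda>f g w. f w + g w), module.smult = (\<lambda>c f w. c * f w)\<rparr>"
    show "complex_algebra P"
      by (rule complex_algebraI)
        (auto simp: P_def l1_add l1_zero l1_scale l1_convolution convolution_assoc fun_eq_iff
          algebra_simps convolution_def sum.distrib sum_distrib_left)
    show "carrier B = h ` carrier P" by (simp add: B_simps P_def)
  qed (simp_all add: B_simps kh)
  interpret B: complex_algebra B by (rule alg)
  interpret B: normed_algebra B
  proof
    show "nrm B y = 0 \<longleftrightarrow> y = \<zero>\<^bsub>B\<^esub>" if "y \<in> carrier B" for y
      using that by (auto simp: B_simps kh h_eq l1_norm_eq_0)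
  qed (auto simp: B_simps kh k l1_add l1_scale l1_convolution l1_norm_nonneg)
  have a_inv: "\<ominus>\<^bsub>B\<^esub> y = h (\<lambda>w. - k y w)" for y
    unfolding a_inv_def m_inv_def
  proof (rule the_equality)
    have m: "(\<lambda>w. - k y w) \<in> l1" using l1_scale(1)[OF k, of "-1" y] by simp
    then show "h (\<lambda>w. - k y w) \<in> carrier (add_monoid B) \<and>
        y \<otimes>\<^bsub>add_monoid B\<^esub> h (\<lambda>w. - k y w) = \<one>\<^bsub>add_monoid B\<^esub> \<and>
        h (\<lambda>w. - k y w) \<otimes>\<^bsub>add_monoid B\<^esub> y = \<one>\<^bsub>add_monoid B\<^esub>"
      by (simp add: B_simps kh)
    fix z assume "z \<in> carrier (add_monoid B) \<and> y \<otimes>\<^bsub>add_monoid B\<^esub> z = \<one>\<^bsub>add_monoid B\<^esub> \<and>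
        z \<otimes>\<^bsub>add_monoid B\<^esub> y = \<one>\<^bsub>add_monoid B\<^esub>"
    then obtain g where g: "g \<in> l1" "z = h g" and "(\<lambda>w. k y w + k z w) = (\<lambda>w. 0)"
      by (auto simp: B_simps h_eq)
    then have "k y w + g w = 0" for w using kh by (auto dest: fun_cong[of _ _ w])
    then show "z = h (\<lambda>w. - k y w)" unfolding g(2) h_eq by (auto simp: fun_eq_iff add_eq_0_iff)
  qed
  have neg: "(\<lambda>w. - k y w) \<in> l1" for y using l1_scale(1)[OF k, of "-1" y] by simp
  have diff: "nrm B (y \<ominus>\<^bsub>B\<^esub> z) = l1_norm (\<lambda>w. k y w - k z w)" for y z
    using l1_diff[OF k[of y] k[of z]] neg[of z] by (simp add: a_minus_def a_inv B_simps kh)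
  interpret MS: Metric_space "carrier B" "\<lambda>y z. nrm B (y \<ominus>\<^bsub>B\<^esub> z)"
  proof
    show "0 \<le> nrm B (y \<ominus>\<^bsub>B\<^esub> z)" for y z by (simp add: diff l1_norm_nonneg)
    show "nrm B (y \<ominus>\<^bsub>B\<^esub> z) = nrm B (z \<ominus>\<^bsub>B\<^esub> y)" for y z
      unfolding diff by (rule l1_norm_minus)
    show "nrm B (y \<ominus>\<^bsub>B\<^esub> z) = 0 \<longleftrightarrow> y = z" if "y \<in> carrier B" "z \<in> carrier B" for y z
      using that B.diff_add_cancel[of y z] by (auto simp: B.nrm_eq_0_iff)
    show "nrm B (x \<ominus>\<^bsub>B\<^esub> z) \<le> nrm B (x \<ominus>\<^bsub>B\<^esub> y) + nrm B (y \<ominus>\<^bsub>B\<^esub> z)"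
      if "x \<in> carrier B" "y \<in> carrier B" "z \<in> carrier B" for x y z
      using that by (rule B.semi.nrm_diff_triangle)
  qed
  have "MS.mcomplete"
    unfolding MS.mcomplete_def
  proof (intro allI impI)
    fix \<sigma> assume \<sigma>: "MS.MCauchy \<sigma>"
    have cauchy: "\<exists>N. \<forall>m\<ge>N. \<forall>n\<ge>N. l1_norm (\<lambda>w. k (\<sigma> m) w - k (\<sigma> n) w) < e" if e: "e > 0" for e
    proof -
      obtain N where N: "\<And>m n. N \<le> m \<Longrightarrow> N \<le> n \<Longrightarrow> nrm B (\<sigma> m \<ominus>\<^bsub>B\<^esub> \<sigma> n) < e"
        using \<sigma>[unfolded MS.MCauchy_def, THEN conjunct2, rule_format, OF e] by metis
      show ?thesis using N unfolding diff by (intro exI[of _ N] allI impI)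
    qed
    have "\<exists>f\<in>l1. \<forall>e>0. \<exists>N. \<forall>n\<ge>N. l1_norm (\<lambda>w. k (\<sigma> n) w - f w) \<le> e"
      using k cauchy by (rule l1_complete[of "\<lambda>n. k (\<sigma> n)"])
    then obtain f where f: "f \<in> l1" "\<forall>e>0. \<exists>N. \<forall>n\<ge>N. l1_norm (\<lambda>w. k (\<sigma> n) w - f w) \<le> e"
      by (rule bexE)
    have "limitin MS.mtopology \<sigma> (h f) sequentially"
      unfolding MS.limit_metric_sequentially
    proof (intro conjI allI impI)
      show "h f \<in> carrier B" using f by (simp add: B_simps)
      fix e :: real assume "e > 0"
      then have "e / 2 > 0" by simp
      with f(2) obtain N where N: "\<forall>n\<ge>N. l1_norm (\<lambda>w. k (\<sigma> n) w - f w) \<le> e / 2" by metis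
      have "range \<sigma> \<subseteq> carrier B"
        using \<sigma>[unfolded MS.MCauchy_def] by (rule conjunct1)
      then have "\<sigma> n \<in> carrier B" for n by blast
      moreover have "nrm B (\<sigma> n \<ominus>\<^bsub>B\<^esub> h f) < e" if "n \<ge> N" for n
        using N[rule_format, OF that] \<open>e > 0\<close> unfolding diff kh[OF f(1)] by simp
      ultimately show "\<exists>N. \<forall>n\<ge>N. \<sigma> n \<in> carrier B \<and> nrm B (\<sigma> n \<ominus>\<^bsub>B\<^esub> h f) < e" by blast
    qed
    then show "\<exists>y. limitin MS.mtopology \<sigma> y sequentially" by blast
  qed
  then have "banach_algebra B"
    by (intro banach_algebra.intro banach_algebra_axioms.intro B.normed_algebra_axioms)
  moreover have "free_generators B (\<lambda>i. h (word_delta i)) (\<lambda>w y. k y w)"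
  proof
    show "k (h (word_delta i)) w = (if w = [i] then 1 else 0)" for w i
      by (simp add: kh word_delta word_delta_def)
  qed (auto simp: B_simps kh word_delta l1_add l1_scale l1_convolution k l1_sum_le convolution_delta)
  ultimately show ?thesis by blast
qed

section \<open>The equivalence\<close>

theorem theorem3p7:
  fixes A :: "'a normed_alg"
  assumes "banach_algebra A"
    and "(UNIV :: complex set) \<lesssim> (UNIV :: 'b set)"
  shows "(tensor_radical TYPE('b) A \<longleftrightarrow> one_quasinilpotent A) \<and>
         (one_quasinilpotent A \<longleftrightarrow>
            (\<forall>B :: 'b normed_alg. banach_algebra B \<longrightarrow> one_quasinilpotent (A \<otimes>\<^sub>\<pi> B)))"
proof -
  interpret A: normed_algebra A using assms(1) by (rule banach_algebra.axioms)
  let ?iii = "\<forall>B :: 'b normed_alg. banach_algebra B \<longrightarrow> one_quasinilpotent (A \<otimes>\<^sub>\<pi> B)"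
  have "one_quasinilpotent A" if rad: "tensor_radical TYPE('b) A"
  proof -
    obtain B :: "'b normed_alg" and x coef where B: "banach_algebra B" "free_generators B x coef"
      using free_generators_exist[OF assms(2)] by blast
    interpret free_generators B x coef by (rule B(2))
    interpret coefficient_maps A B x coef ..
    show ?thesis
      using rad B(1) unfolding tensor_radical_def by (intro jacobson_radical_imp_one_quasinilpotent) blast
  qed
  moreover have ?iii if "one_quasinilpotent A"
    using that A.normed_algebra_axioms banach_algebra.axioms(1)
    by (intro allI impI one_quasinilpotent_tensor)
  moreover have "tensor_radical TYPE('b) A" if iii: ?iii
    unfolding tensor_radical_def
  proof (intro allI impI)
    fix B :: "'b normed_alg" assume B: "banach_algebra B"
    then interpret B: normed_algebra B by (rule banach_algebra.axioms)
    interpret tensor_pair A B ..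
    show "jacobson_radical_algebra (A \<otimes>\<^sub>\<pi> B)"
    proof (rule one_quasinilpotent_imp_jacobson_radical)
      show "normed_algebra (A \<otimes>\<^sub>\<pi> B)"
        unfolding projective_tensor_def by (rule D.normed_algebra_completion)
      show "\<exists>U\<in>carrier (A \<otimes>\<^sub>\<pi> B). (\<lambda>n. nrm (A \<otimes>\<^sub>\<pi> B) (X n \<ominus>\<^bsub>A \<otimes>\<^sub>\<pi> B\<^esub> U)) \<longlonglongrightarrow> 0"
        if "X \<in> cauchy_seqs (A \<otimes>\<^sub>\<pi> B)" for X
        using D.completion_complete that unfolding projective_tensor_def by blast
      show "one_quasinilpotent (A \<otimes>\<^sub>\<pi> B)" using iii B by blast
    qed
  qed
  ultimately show ?thesis by blast
qed

end
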